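(* Let $F:X\to X$ be a solenoidal map on $X=S^1\times D^2$, with transfer operator (pushforward) $L_F$. Then there is a unique probability measure $\mu\in\mathcal L^1$ such that $L_F\mu=\mu$.
   Context: $D^2$ is the closed unit disc, $m_1$ is Lebesgue measure on $S^1=\mathbb R/\mathbb Z$. A solenoidal map is a $C^2$ map $F:X\to X$ of the form $F(x,y)=(T(x),G(x,y))$, where $T:S^1\to S^1$ is $C^2$, expanding ($|T'|>1$) of degree $q$, and $G:X\to D^2$ is differentiable, with (i) some $0<\alpha<1$ such that $|G(x,y_1)-G(x,y_2)|\le\alpha|y_1-y_2|$ for all $x\in S^1$, $y_1,y_2\in D^2$, and (ii) $\|\partial G/\partial x\|_\infty<\infty$. $[L_F\mu](E)=\mu(F^{-1}(E))$ for signed Borel measures $\mu$ on $X$. For signed Borel measures $\mu,\nu$ on $D^2$, $W_1^0(\mu,\nu)=\sup\{|\int g\,d\mu-\int g\,d\nu| : Lip(g)\le1,\|g\|_\infty\le1\}$. $\mathcal{AB}$ is the set of signed Borel measures $\mu$ on $X$, with Jordan decomposition $\mu=\mu^+-\mu^-$, such that the marginals of $\mu^+$ and $\mu^-$ on $S^1$ (pushforwards under $(x,y)\mapsto x$) are absolutely continuous with respect to $m_1$. For a positive $\mu\in\mathcal{AB}$ with marginal density $\phi_x$ and Rokhlin disintegration into probability measures $\{\mu_\gamma\}_{\gamma\in S^1}$ on the leaves $\{\gamma\}\times D^2$ (so $\mu(E)=\int\mu_\gamma(E\cap(\{\gamma\}\times D^2))\phi_x(\gamma)\,dm_1(\gamma)$),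 the restriction $\mu|_\gamma$ is the positive measure on $D^2$ equal to $\phi_x(\gamma)$ times the pushforward of $\mu_\gamma$ under $(x,y)\mapsto y$. Then $\mathcal L^1=\{\mu\in\mathcal{AB}:\int_{S^1}W_1^0(\mu^+|_\gamma,\mu^-|_\gamma)\,dm_1(\gamma)<\infty\}$. *)

theory Defs
  imports "HOL-Probability.Probability"
begin

section \<open>The circle as the quotient of the reals by the integers\<close>

quotient_type circle = real / "\<lambda>s t::real. s - t \<in> \<int>"
  morphisms circle_rep circle_proj
proof (rule equivpI)
  show "reflp (\<lambda>s t::real. s - t \<in> \<int>)"
    by (simp add: reflp_def)
  show "symp (\<lambda>s t::real. s - t \<in> \<int>)"
    by (metis (mono_tags, lifting) Ints_minus minus_diff_eq sympI)
  show "transp (\<lambda>s t::real. s - t \<in> \<int>)"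
  proof (rule transpI)
    fix x y z :: real
    assume "x - y \<in> \<int>" "y - z \<in> \<int>"
    then have "(x - y) + (y - z) \<in> \<int>" by (rule Ints_add)
    then show "x - z \<in> \<int>" by simp
  qed
qed

lemma circle_proj_eq_iff: "circle_proj s = circle_proj t \<longleftrightarrow> s - t \<in> \<int>"
  using circle.abs_eq_iff by simp

lemma circle_proj_surj: "\<exists>t. x = circle_proj t"
  by (induction x rule: circle.abs_induct) blast

instantiation circle :: topological_space
begin

definition open_circle :: "circle set \<Rightarrow> bool"
  where "open_circle U \<longleftrightarrow> open (circle_proj -` U)"

instance
proof
  show "open (UNIV :: circle set)" by (simp add: open_circle_def)
  show "open (S \<inter> T)" if "open S" "open T" for S T :: "circle set"
    using that by (simp add: open_circle_def open_Int)
  show "open (\<Union>K)" if "\<forall>S\<in>K. open S" for K :: "circle set set"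
    using that by (auto simp: open_circle_def vimage_Union intro: open_UN)
qed

end

lemma open_image_circle_proj:
  assumes "open (B :: real set)"
  shows "open (circle_proj ` B)"
proof -
  have "circle_proj -` (circle_proj ` B) = (\<Union>k\<in>\<int>. (+) k ` B)"
  proof (intro set_eqI iffI)
    fix s assume "s \<in> circle_proj -` (circle_proj ` B)"
    then obtain t where t: "t \<in> B" "s - t \<in> \<int>"
      by (auto simp: circle_proj_eq_iff)
    have "s = (s - t) + t" by simp
    then show "s \<in> (\<Union>k\<in>\<int>. (+) k ` B)" using t by blast
  next
    fix s assume "s \<in> (\<Union>k\<in>\<int>. (+) k ` B)"
    then obtain k t where "k \<in> \<int>" "t \<in> B" "s = k + t" by blast
    then have "circle_proj s = circle_proj t" by (simp add: circle_proj_eq_iff)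
    then show "s \<in> circle_proj -` (circle_proj ` B)" using \<open>t \<in> B\<close> by simp
  qed
  then show ?thesis
    using assms by (auto simp: open_circle_def intro!: open_UN open_translation)
qed

instance circle :: second_countable_topology
proof
  obtain B :: "real set set" where B: "countable B" "topological_basis B"
    using ex_countable_basis by blast
  have "topological_basis ((`) circle_proj ` B)"
  proof (rule topological_basisI)
    fix V assume "V \<in> (`) circle_proj ` B"
    then show "open V"
      using B(2) by (auto intro: open_image_circle_proj topological_basis_open)
  next
    fix U :: "circle set" and x
    assume U: "open U" "x \<in> U"
    obtain t where t: "x = circle_proj t" using circle_proj_surj by blast
    have "open (circle_proj -` U)" "t \<in> circle_proj -` U"
      using U t by (simp_all add: open_circle_def)
    then obtain W where "W \<in> B" "t \<in> W" "W \<subseteq> circle_proj -` U"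
      using B(2) by (meson topological_basisE)
    then show "\<exists>V\<in>(`) circle_proj ` B. x \<in> V \<and> V \<subseteq> U"
      using t by (intro bexI[of _ "circle_proj ` W"]) auto
  qed
  then show "\<exists>B::circle set set. countable B \<and> open = generate_topology B"
    using B(1) topological_basis_imp_subbasis by (metis countable_image)
qed

definition m1 :: "circle measure"
  where "m1 = distr (restrict_space lborel {0..<1}) borel circle_proj"

section \<open>Phase space\<close>

abbreviation disc :: "(real ^ 2) set"
  where "disc \<equiv> cball 0 1"

definition disc_borel :: "(real ^ 2) measure"
  where "disc_borel = restrict_space borel disc"

abbreviation solid_torus :: "(circle \<times> (real ^ 2)) set"
  where "solid_torus \<equiv> UNIV \<times> disc"

definition torus_borel :: "(circle \<times> (real ^ 2)) measure"
  where "torus_borel = restrict_space borel solid_torus"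

definition leaf :: "circle \<Rightarrow> (circle \<times> (real ^ 2)) set"
  where "leaf \<gamma> = {\<gamma>} \<times> disc"

section \<open>Solenoidal maps\<close>

text \<open>
  Derivatives are taken within S. They are unique for the sets used below, which are convex
  with nonempty interior.
\<close>

definition C2_on :: "('a::real_normed_vector \<Rightarrow> 'b::real_normed_vector) \<Rightarrow> 'a set \<Rightarrow> bool"
  where "C2_on f S \<longleftrightarrow>
    (\<exists>(f' :: 'a \<Rightarrow> 'a \<Rightarrow>\<^sub>L 'b) (f'' :: 'a \<Rightarrow> 'a \<Rightarrow>\<^sub>L ('a \<Rightarrow>\<^sub>L 'b)).
      (\<forall>x\<in>S. (f has_derivative blinfun_apply (f' x)) (at x within S)) \<and>
      (\<forall>x\<in>S. (f' has_derivative blinfun_apply (f'' x)) (at x within S)) \<and>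
      continuous_on S f'')"

text \<open>
  The charts of the circle are local inverses of the projection, and every continuous self-map of
  the circle (of the solid torus) lifts to the universal cover, that is, the reals (the product
  of the reals and the disc). So a map is twice continuously differentiable iff it has a lift
  that is.
\<close>

definition circle_lift :: "(circle \<Rightarrow> circle) \<Rightarrow> (real \<Rightarrow> real) \<Rightarrow> bool"
  where "circle_lift T \<tau> \<longleftrightarrow> (\<forall>t. circle_proj (\<tau> t) = T (circle_proj t))"

definition torus_lift ::
    "(circle \<times> (real ^ 2) \<Rightarrow> circle \<times> (real ^ 2)) \<Rightarrow>
      (real \<times> (real ^ 2) \<Rightarrow> real \<times> (real ^ 2)) \<Rightarrow> bool"
  where "torus_lift F \<Phi> \<longleftrightarrow>
    (\<forall>t. \<forall>y\<in>disc. map_prod circle_proj id (\<Phi> (t, y)) = F (circle_proj t, y))"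

definition C2_self_map :: "(circle \<times> (real ^ 2) \<Rightarrow> circle \<times> (real ^ 2)) \<Rightarrow> bool"
  where "C2_self_map F \<longleftrightarrow>
    F ` solid_torus \<subseteq> solid_torus \<and> (\<exists>\<Phi>. torus_lift F \<Phi> \<and> C2_on \<Phi> (UNIV \<times> disc))"

definition expanding_circle_map :: "int \<Rightarrow> (circle \<Rightarrow> circle) \<Rightarrow> bool"
  where "expanding_circle_map q T \<longleftrightarrow>
    (\<exists>\<tau>. circle_lift T \<tau> \<and> C2_on \<tau> UNIV \<and> (\<forall>t. \<bar>deriv \<tau> t\<bar> > 1) \<and>
      (\<forall>t. \<tau> (t + 1) = \<tau> t + of_int q))"

definition solenoidal_map :: "int \<Rightarrow> (circle \<times> (real ^ 2) \<Rightarrow> circle \<times> (real ^ 2)) \<Rightarrow> bool"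
  where "solenoidal_map q F \<longleftrightarrow>
    C2_self_map F \<and>
    (\<exists>T G.
      (\<forall>x. \<forall>y\<in>disc. F (x, y) = (T x, G (x, y))) \<and>
      expanding_circle_map q T \<and>
      (\<lambda>(t, y). G (circle_proj t, y)) differentiable_on (UNIV \<times> disc) \<and>
      (\<exists>\<alpha>. 0 < \<alpha> \<and> \<alpha> < 1 \<and>
        (\<forall>x. \<forall>y1\<in>disc. \<forall>y2\<in>disc. norm (G (x, y1) - G (x, y2)) \<le> \<alpha> * norm (y1 - y2))) \<and>
      (\<exists>B. \<forall>t. \<forall>y\<in>disc.
        norm (vector_derivative (\<lambda>s. G (circle_proj s, y)) (at t)) \<le> B))"

section \<open>Signed measures and the transfer operator\<close>

text \<open>
  As for \<^const>\<open>measure\<close>, the value outside the sigma-algebra is 0 by convention.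
  That the empty set has measure 0 follows from the summability of a constant sequence.
\<close>

definition signed_measure :: "'a measure \<Rightarrow> ('a set \<Rightarrow> real) \<Rightarrow> bool"
  where "signed_measure M \<mu> \<longleftrightarrow>
    (\<forall>E. E \<notin> sets M \<longrightarrow> \<mu> E = 0) \<and>
    (\<forall>A::nat \<Rightarrow> 'a set. range A \<subseteq> sets M \<longrightarrow> disjoint_family A \<longrightarrow>
      (\<lambda>n. \<mu> (A n)) sums \<mu> (\<Union>n. A n))"

definition jordan_decomposition ::
    "'a measure \<Rightarrow> ('a set \<Rightarrow> real) \<Rightarrow> 'a measure \<Rightarrow> 'a measure \<Rightarrow> bool"
  where "jordan_decomposition M \<mu> P N \<longleftrightarrow>
    finite_measure P \<and> finite_measure N \<and> sets P = sets M \<and> sets N = sets M \<and>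
    (\<exists>A\<in>sets M. emeasure P (space M - A) = 0 \<and> emeasure N A = 0) \<and>
    (\<forall>E\<in>sets M. \<mu> E = measure P E - measure N E)"

definition transfer_operator ::
    "(circle \<times> (real ^ 2) \<Rightarrow> circle \<times> (real ^ 2)) \<Rightarrow>
      ((circle \<times> (real ^ 2)) set \<Rightarrow> real) \<Rightarrow> (circle \<times> (real ^ 2)) set \<Rightarrow> real"
  where "transfer_operator F \<mu> E =
    (if E \<in> sets torus_borel then \<mu> (F -` E \<inter> solid_torus) else 0)"

section \<open>The space of measures with integrable leafwise norm\<close>

definition circle_marginal :: "(circle \<times> (real ^ 2)) measure \<Rightarrow> circle measure"
  where "circle_marginal P = distr P borel fst"

definition AB :: "((circle \<times> (real ^ 2)) set \<Rightarrow> real) set"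
  where "AB = {\<mu>. signed_measure torus_borel \<mu> \<and>
    (\<exists>P N. jordan_decomposition torus_borel \<mu> P N \<and>
      absolutely_continuous m1 (circle_marginal P) \<and>
      absolutely_continuous m1 (circle_marginal N))}"

text \<open>
  \<phi> is the marginal density of P, and \<kappa> is a Rokhlin disintegration of P along the leaves.
\<close>

definition disintegration ::
    "(circle \<times> (real ^ 2)) measure \<Rightarrow> (circle \<Rightarrow> real) \<Rightarrow>
      (circle \<Rightarrow> (circle \<times> (real ^ 2)) measure) \<Rightarrow> bool"
  where "disintegration P \<phi> \<kappa> \<longleftrightarrow>
    \<phi> \<in> borel_measurable borel \<and> (\<forall>\<gamma>. 0 \<le> \<phi> \<gamma>) \<and>
    circle_marginal P = density m1 (\<lambda>\<gamma>. ennreal (\<phi> \<gamma>)) \<and>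
    (\<forall>\<gamma>. prob_space (\<kappa> \<gamma>) \<and> sets (\<kappa> \<gamma>) = sets (restrict_space torus_borel (leaf \<gamma>))) \<and>
    (\<forall>E\<in>sets torus_borel.
      (\<lambda>\<gamma>. emeasure (\<kappa> \<gamma>) (E \<inter> leaf \<gamma>)) \<in> borel_measurable borel \<and>
      emeasure P E = (\<integral>\<^sup>+\<gamma>. emeasure (\<kappa> \<gamma>) (E \<inter> leaf \<gamma>) * ennreal (\<phi> \<gamma>) \<partial>m1))"

definition leaf_restriction ::
    "(circle \<Rightarrow> real) \<Rightarrow> (circle \<Rightarrow> (circle \<times> (real ^ 2)) measure) \<Rightarrow> circle \<Rightarrow> (real ^ 2) measure"
  where "leaf_restriction \<phi> \<kappa> \<gamma> = scale_measure (ennreal (\<phi> \<gamma>)) (distr (\<kappa> \<gamma>) disc_borel snd)"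

definition W10 :: "(real ^ 2) measure \<Rightarrow> (real ^ 2) measure \<Rightarrow> ennreal"
  where "W10 \<mu> \<nu> =
    (SUP g \<in> {g :: real ^ 2 \<Rightarrow> real. 1-lipschitz_on disc g \<and> (\<forall>y\<in>disc. \<bar>g y\<bar> \<le> 1)}.
      ennreal \<bar>(\<integral>y. g y \<partial>\<mu>) - (\<integral>y. g y \<partial>\<nu>)\<bar>)"

text \<open>
  The Jordan decomposition is unique, and disintegrations are unique up to null sets of the
  marginal, so the integral below does not depend on the choices.
\<close>

definition L1_space :: "((circle \<times> (real ^ 2)) set \<Rightarrow> real) set"
  where "L1_space = {\<mu> \<in> AB. \<exists>P N \<phi>P \<phi>N \<kappa>P \<kappa>N.
    jordan_decomposition torus_borel \<mu> P N \<and>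
    disintegration P \<phi>P \<kappa>P \<and> disintegration N \<phi>N \<kappa>N \<and>
    (\<integral>\<^sup>+\<gamma>. W10 (leaf_restriction \<phi>P \<kappa>P \<gamma>) (leaf_restriction \<phi>N \<kappa>N \<gamma>) \<partial>m1) < \<infinity>}"

end

theory Submission
  imports Defs
begin

text \<open>
  Write \<open>F (x, y) = (T x, G (x, y))\<close>. The base map \<open>T\<close> and the fibre map \<open>G\<close> are treated
  separately.
  
  The expanding circle map has exactly one absolutely continuous invariant probability measure.
  In the coordinate of the circle, the transfer operator sums a density over the inverse branches,
  weighted by their Jacobians. The branches contract and the logarithms of the Jacobians are
  Lipschitz, so the operator improves the Lipschitz constant of the logarithm of a positive
  density, down to a fixed bound. A density with such a bound and with integral 1 is
  bounded below by a constant, and this constant can be split off with the remainder still being a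
  positive density of the same regularity. Two densities thus share a fixed proportion of
  mass after every step, and their difference decays exponentially (\<open>transfer_contraction\<close>). This
  gives the fixed density \<open>h\<close>; and it gives that the preimages of every Borel set become
  independent of every Borel set in the limit (\<open>acim_mixing\<close>), which leaves no
  other invariant density (\<open>acim_unique\<close>).
  
  Over the invariant circle measure there is exactly one \<open>F\<close>-invariant probability measure.
  For uniqueness, two points of one leaf come exponentially close under iteration of \<open>F\<close>, so the integral
  of a function that is Lipschitz in the fibre is determined by the marginal
  (\<open>invariant_measure_unique\<close>). For existence, a random backward orbit of \<open>T\<close> is drawn from a
  point \<open>x\<close>, each preimage being chosen with the conditional probability that \<open>h\<close> prescribes, by means of
  independent uniform variables. Pushing a fibre point forward along the backward orbit from
  further and further in the past converges, by contraction, to a random fibre point over \<open>x\<close>. Its law is the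
  conditional measure on the leaf of \<open>x\<close>. The resulting measure on the solid torus
  therefore comes with its Rokhlin disintegration (\<open>solenoid_disintegration\<close>), and it is
  invariant because a step of the backward orbit reverses a step of \<open>T\<close> (\<open>random_preimage_reverses_T\<close>).
  
  A probability measure is its own positive part, so the integral of its leafwise norm is at most its
  total mass; besides the disintegration, membership in \<open>L1_space\<close> amounts to the absolute
  continuity of the marginal. The marginal of an invariant measure is \<open>T\<close>-invariant, hence unique, and so is the measure.
\<close>

section \<open>The circle in coordinates\<close>

lift_definition circle_coord :: "circle \<Rightarrow> real" is frac
proof -
  fix s t :: real
  assume "s - t \<in> \<int>"
  then obtain k where "s - t = of_int k" by (elim Ints_cases)
  then have "s = t + of_int k" by simp
  then show "frac s = frac t" by simp
qed

lemma circle_coord_proj: "circle_coord (circle_proj t) = frac t"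
  by (rule circle_coord.abs_eq)

lemma circle_proj_frac: "circle_proj (frac t) = circle_proj t"
  by (simp add: circle_proj_eq_iff frac_def)

lemma circle_proj_coord [simp]: "circle_proj (circle_coord x) = x"
  using circle_proj_surj[of x] by (auto simp: circle_coord_proj circle_proj_frac)

lemma circle_coord_range: "0 \<le> circle_coord x" "circle_coord x < 1"
  using circle_proj_surj[of x] by (auto simp: circle_coord_proj frac_lt_1)

lemma circle_coord_proj_id: "0 \<le> t \<Longrightarrow> t < 1 \<Longrightarrow> circle_coord (circle_proj t) = t"
  by (simp add: circle_coord_proj frac_eq)

lemma continuous_circle_proj: "continuous_on UNIV circle_proj"
  by (simp add: continuous_on_open_vimage open_circle_def)

lemma measurable_circle_proj [measurable]: "circle_proj \<in> borel_measurable borel"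
  by (intro borel_measurable_continuous_onI continuous_circle_proj)

lemma measurable_circle_coord [measurable]: "circle_coord \<in> borel_measurable borel"
proof (rule borel_measurableI_greater)
  fix a :: real
  have "open {x. a < circle_coord x}"
  proof (cases "a < 0")
    case True
    then have "{x. a < circle_coord x} = UNIV"
      using circle_coord_range(1) by (auto intro: less_le_trans)
    then show ?thesis by simp
  next
    case False
    have "{x. a < circle_coord x} = circle_proj ` {a<..<1}"
    proof (intro set_eqI iffI)
      fix x assume "x \<in> {x. a < circle_coord x}"
      then show "x \<in> circle_proj ` {a<..<1}"
        using circle_coord_range(2)[of x] by (intro image_eqI[of _ _ "circle_coord x"]) auto
    next
      fix x assume "x \<in> circle_proj ` {a<..<1}"
      with False show "x \<in> {x. a < circle_coord x}" by (auto simp: circle_coord_proj_id)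
    qed
    then show ?thesis by (simp add: open_image_circle_proj)
  qed
  then show "{x \<in> space borel. a < circle_coord x} \<in> sets borel" by simp
qed

abbreviation unit_lborel :: "real measure"
  where "unit_lborel \<equiv> restrict_space lborel {0..<1}"

lemma prob_space_unit_lborel: "prob_space unit_lborel"
  by (rule prob_spaceI) (simp add: space_restrict_space emeasure_restrict_space)

interpretation unit: prob_space unit_lborel
  by (rule prob_space_unit_lborel)

lemma sets_m1 [simp, measurable_cong]: "sets m1 = sets borel"
  by (simp add: m1_def)

lemma space_m1 [simp]: "space m1 = UNIV"
  by (simp add: m1_def)

lemma measurable_circle_proj_unit [measurable]: "circle_proj \<in> borel_measurable unit_lborel"
  by (intro measurable_restrict_space1) simp

lemma borel_measurable_unit: "f \<in> borel_measurable borel \<Longrightarrow> f \<in> borel_measurable unit_lborel"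
  by (intro measurable_restrict_space1) simp

lemma prob_space_m1: "prob_space m1"
  unfolding m1_def by (rule unit.prob_space_distr) simp

lemma nn_integral_m1: "f \<in> borel_measurable borel \<Longrightarrow>
    (\<integral>\<^sup>+x. f x \<partial>m1) = (\<integral>\<^sup>+t. f (circle_proj t) \<partial>unit_lborel)"
  unfolding m1_def by (subst nn_integral_distr) auto

lemma periodic_of_nat:
  fixes f :: "real \<Rightarrow> 'b"
  assumes "\<And>t. f (t + 1) = f t"
  shows "f (t + real k) = f t"
proof (induction k)
  case (Suc k)
  have "f (t + real (Suc k)) = f ((t + real k) + 1)" by (simp add: algebra_simps)
  then show ?case using Suc assms by simp
qed simp

lemma periodic_of_int:
  fixes f :: "real \<Rightarrow> 'b"
  assumes "\<And>t. f (t + 1) = f t"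
  shows "f (t + of_int k) = f t"
proof (cases k)
  case (nonneg n)
  then show ?thesis using periodic_of_nat[of f] assms by simp
next
  case (neg n)
  have "f ((t + of_int k) + real (Suc n)) = f (t + of_int k)"
    using periodic_of_nat[of f "t + of_int k" "Suc n"] assms by simp
  then show ?thesis using neg by simp
qed

lemma periodic_frac:
  fixes f :: "real \<Rightarrow> 'b"
  assumes "\<And>t. f (t + 1) = f t"
  shows "f (frac t) = f t"
  using periodic_of_int[of f "frac t" "\<lfloor>t\<rfloor>"] assms by (simp add: frac_def)

lemma nn_integral_unit: "(\<integral>\<^sup>+t. f t \<partial>unit_lborel) = (\<integral>\<^sup>+t. f t * indicator {0..<1} t \<partial>lborel)"
  by (subst nn_integral_restrict_space) auto

lemma nn_integral_shift_unit:
  fixes f :: "real \<Rightarrow> ennreal" and b :: real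
  assumes [measurable]: "f \<in> borel_measurable borel"
  shows "(\<integral>\<^sup>+t. f t * indicator {b..<b+1} t \<partial>lborel) = (\<integral>\<^sup>+t. f (t + b) \<partial>unit_lborel)"
proof -
  have "(\<integral>\<^sup>+t. f t * indicator {b..<b+1} t \<partial>lborel)
      = (\<integral>\<^sup>+t. f (b + 1 * t) * indicator {b..<b+1} (b + 1 * t) \<partial>lborel)"
    by (subst nn_integral_real_affine[where c=1 and t=b]) auto
  also have "\<dots> = (\<integral>\<^sup>+t. f (t + b) * indicator {0..<1} t \<partial>lborel)"
    by (intro nn_integral_cong) (auto simp: indicator_def add.commute)
  finally show ?thesis by (simp add: nn_integral_unit)
qed

text \<open>
  The interval of length 1 that starts at \<open>b\<close> contains one integer \<open>m\<close>; moving the part to the left of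
  \<open>m\<close> by one period turns the interval into the one that starts at \<open>m\<close>.
\<close>

lemma nn_integral_periodic_shift_unit:
  fixes f :: "real \<Rightarrow> ennreal"
  assumes [measurable]: "f \<in> borel_measurable borel" and per: "\<And>t. f (t + 1) = f t"
  shows "(\<integral>\<^sup>+t. f (t + b) \<partial>unit_lborel) = (\<integral>\<^sup>+t. f t \<partial>unit_lborel)"
proof -
  define m where "m = \<lceil>b\<rceil>"
  have m: "b \<le> of_int m" "of_int m < b + 1" unfolding m_def by linarith+
  have "(\<integral>\<^sup>+t. f (t + b) \<partial>unit_lborel) = (\<integral>\<^sup>+t. f t * indicator {b..<b+1} t \<partial>lborel)"
    by (simp add: nn_integral_shift_unit)
  also have "\<dots> = (\<integral>\<^sup>+t. f t * indicator {b..<m} t + f t * indicator {m..<b+1} t \<partial>lborel)"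
    by (intro nn_integral_cong) (use m in \<open>auto simp: indicator_def\<close>)
  also have "\<dots> = (\<integral>\<^sup>+t. f t * indicator {b..<m} t \<partial>lborel) + (\<integral>\<^sup>+t. f t * indicator {m..<b+1} t \<partial>lborel)"
    by (intro nn_integral_add) auto
  also have "(\<integral>\<^sup>+t. f t * indicator {b..<m} t \<partial>lborel)
      = (\<integral>\<^sup>+t. f (-1 + 1 * t) * indicator {b..<m} (-1 + 1 * t) \<partial>lborel)"
    by (subst nn_integral_real_affine[where c=1 and t="-1"]) auto
  also have "\<dots> = (\<integral>\<^sup>+t. f t * indicator {b+1..<m+1} t \<partial>lborel)"
  proof (intro nn_integral_cong)
    fix t :: real
    have "f (-1 + 1 * t) = f t" using per[of "t - 1"] by simp
    then show "f (-1 + 1 * t) * indicator {b..<m} (-1 + 1 * t) = f t * indicator {b+1..<m+1} t"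
      by (auto simp: indicator_def)
  qed
  also have "\<dots> + (\<integral>\<^sup>+t. f t * indicator {m..<b+1} t \<partial>lborel)
     = (\<integral>\<^sup>+t. f t * indicator {b+1..<m+1} t + f t * indicator {m..<b+1} t \<partial>lborel)"
    by (intro nn_integral_add[symmetric]) auto
  also have "\<dots> = (\<integral>\<^sup>+t. f t * indicator {real_of_int m..<real_of_int m+1} t \<partial>lborel)"
    by (intro nn_integral_cong) (use m in \<open>auto simp: indicator_def\<close>)
  also have "\<dots> = (\<integral>\<^sup>+t. f (t + of_int m) \<partial>unit_lborel)"
    by (rule nn_integral_shift_unit) simp
  also have "\<dots> = (\<integral>\<^sup>+t. f t \<partial>unit_lborel)"
    using periodic_of_int[of f] per by simp
  finally show ?thesis .
qed

lemma nn_integral_periodic_reflect_unit: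
  fixes f :: "real \<Rightarrow> ennreal"
  assumes [measurable]: "f \<in> borel_measurable borel" and per: "\<And>t. f (t + 1) = f t"
  shows "(\<integral>\<^sup>+t. f (- t) \<partial>unit_lborel) = (\<integral>\<^sup>+t. f t \<partial>unit_lborel)"
proof -
  have "(\<integral>\<^sup>+t. f t \<partial>unit_lborel) = (\<integral>\<^sup>+t. f t * indicator {0..<1} t \<partial>lborel)"
    by (rule nn_integral_unit)
  also have "\<dots> = (\<integral>\<^sup>+t. f (1 + (-1) * t) * indicator {0..<1} (1 + (-1) * t) \<partial>lborel)"
    by (subst nn_integral_real_affine[where c="-1" and t="1"]) auto
  also have "\<dots> = (\<integral>\<^sup>+t. f (- t) * indicator {0..<1} t \<partial>lborel)"
  proof (intro nn_integral_cong_AE)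
    have "AE t in lborel. t \<noteq> (0::real) \<and> t \<noteq> 1"
      by (intro AE_conjI AE_lborel_singleton)
    then show "AE t in lborel. f (1 + (-1) * t) * indicator {0..<1} (1 + (-1) * t) = f (- t) * indicator {0..<1} t"
    proof eventually_elim
      case (elim t)
      have "f (1 + (-1) * t) = f (- t)" using per[of "- t"] by (simp add: add.commute)
      then show ?case using elim by (auto simp: indicator_def)
    qed
  qed
  finally show ?thesis by (simp add: nn_integral_unit)
qed

section \<open>The transfer operator of the inverse branches\<close>

lemma log_lipschitz_continuous:
  fixes f :: "real \<Rightarrow> real"
  assumes "\<And>s t. f s \<le> f t * exp (a * \<bar>s - t\<bar>)"
  shows "continuous_on UNIV f"
proof -
  have "(f \<longlongrightarrow> f t) (at t)" for t
  proof (rule tendsto_sandwich)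
    have "f t * exp (- (a * \<bar>s - t\<bar>)) \<le> f s" for s
      using assms[of t s] by (simp add: exp_minus field_simps abs_minus_commute)
    then show "\<forall>\<^sub>F s in at t. f t * exp (- (a * \<bar>s - t\<bar>)) \<le> f s" by simp
    show "\<forall>\<^sub>F s in at t. f s \<le> f t * exp (a * \<bar>s - t\<bar>)" using assms by simp
    show "((\<lambda>s. f t * exp (- (a * \<bar>s - t\<bar>))) \<longlongrightarrow> f t) (at t)"
      by (auto intro!: tendsto_eq_intros)
    show "((\<lambda>s. f t * exp (a * \<bar>s - t\<bar>)) \<longlongrightarrow> f t) (at t)"
      by (auto intro!: tendsto_eq_intros)
  qed
  then show ?thesis by (simp add: continuous_on_def)
qed

lemma nn_integral_unit_blocks:
  fixes v :: "real \<Rightarrow> ennreal"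
  assumes [measurable]: "v \<in> borel_measurable borel"
  shows "(\<integral>\<^sup>+s. v s * indicator {0..<real n} s \<partial>lborel) = (\<Sum>k<n. \<integral>\<^sup>+s. v (s + real k) \<partial>unit_lborel)"
proof (induction n)
  case (Suc n)
  have "(\<integral>\<^sup>+s. v s * indicator {0..<real (Suc n)} s \<partial>lborel)
     = (\<integral>\<^sup>+s. v s * indicator {0..<real n} s + v s * indicator {real n..<real n + 1} s \<partial>lborel)"
    by (intro nn_integral_cong) (auto simp: indicator_def)
  also have "\<dots> = (\<integral>\<^sup>+s. v s * indicator {0..<real n} s \<partial>lborel) +
      (\<integral>\<^sup>+s. v s * indicator {real n..<real n + 1} s \<partial>lborel)"
    by (intro nn_integral_add) auto
  finally show ?case using Suc by (simp add: nn_integral_shift_unit)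
qed simp

text \<open>
  With a lift \<open>\<tau>\<close> of \<open>T\<close> and \<open>\<epsilon>\<close> the sign of its derivative, \<open>\<rho>\<close> is the inverse of \<open>\<epsilon> \<tau>\<close>. The sign
  makes \<open>\<rho>\<close> increasing, so that both orientations are treated at once. The absolute degree is \<open>n\<close>, and
  \<open>\<rho>\<close> runs through one period of the circle while its argument runs through \<open>n\<close> periods. Its derivative
  is \<open>w\<close>, and the distortion bound says that the logarithm of \<open>w\<close> is Lipschitz.
\<close>

locale expanding_branches =
  fixes T :: "circle \<Rightarrow> circle" and \<rho> w :: "real \<Rightarrow> real" and n :: nat and \<theta> K \<epsilon> :: real
  assumes T_measurable [measurable]: "T \<in> borel_measurable borel"
    and \<rho>_deriv: "(\<rho> has_real_derivative w s) (at s)"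
    and \<rho>_shift: "\<rho> (s + real n) = \<rho> s + 1"
    and T_\<rho>: "T (circle_proj (\<rho> s)) = circle_proj (\<epsilon> * s)"
    and w_pos: "0 < w s" and w_le: "w s \<le> \<theta>" and theta_less: "\<theta> < 1"
    and w_distortion: "w s \<le> w t * exp (K * \<bar>s - t\<bar>)" and K_pos: "0 < K"
    and \<epsilon>: "\<epsilon> = 1 \<or> \<epsilon> = -1"
begin

text \<open>
  The \<open>n\<close> preimages of the point with coordinate \<open>s\<close> have the coordinates \<open>branch k s\<close>, up to
  integers, for \<open>k < n\<close>.
\<close>

definition branch :: "nat \<Rightarrow> real \<Rightarrow> real"
  where "branch k s = \<rho> (\<epsilon> * s + real k)"

definition jac :: "nat \<Rightarrow> real \<Rightarrow> real"
  where "jac k s = w (\<epsilon> * s + real k)"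

definition transfer :: "(real \<Rightarrow> real) \<Rightarrow> real \<Rightarrow> real"
  where "transfer f s = (\<Sum>k<n. f (branch k s) * jac k s)"

lemma theta_pos: "0 < \<theta>"
  using w_pos[of 0] w_le[of 0] by simp

lemma n_pos: "0 < n"
  using \<rho>_shift[of 0] by (intro gr0I) simp

lemma T_branch: "T (circle_proj (branch k s)) = circle_proj s"
proof -
  have "\<epsilon> * (\<epsilon> * s + real k) - s \<in> \<int>" using \<epsilon> by auto
  then show ?thesis by (simp add: branch_def T_\<rho> circle_proj_eq_iff)
qed

lemma measurable_\<rho> [measurable]: "\<rho> \<in> borel_measurable borel"
  using \<rho>_deriv by (intro borel_measurable_continuous_onI)
    (meson DERIV_isCont continuous_at_imp_continuous_on)

lemma continuous_w: "continuous_on UNIV w"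
  by (rule log_lipschitz_continuous) (rule w_distortion)

lemma measurable_w [measurable]: "w \<in> borel_measurable borel"
  by (intro borel_measurable_continuous_onI continuous_w)

lemma measurable_branch [measurable]: "branch k \<in> borel_measurable borel"
  unfolding branch_def by measurable

lemma measurable_jac [measurable]: "jac k \<in> borel_measurable borel"
  unfolding jac_def by measurable

lemma jac_pos: "0 < jac k s"
  by (simp add: jac_def w_pos)

text \<open>
  Both sides are derivatives of \<open>\<rho> (s + n) = \<rho> s + 1\<close>.
\<close>

lemma w_shift: "w (s + real n) = w s"
proof -
  have "((\<lambda>s. \<rho> (s + real n)) has_real_derivative w (s + real n)) (at s)"
    using \<rho>_deriv[of "s + real n"] by (rule DERIV_shift[THEN iffD1])
  moreover have "((\<lambda>s. \<rho> (s + real n)) has_real_derivative w s) (at s)"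
    unfolding \<rho>_shift by (auto intro!: derivative_eq_intros \<rho>_deriv)
  ultimately show ?thesis by (rule DERIV_unique)
qed

lemma \<rho>_lipschitz: "\<bar>\<rho> s - \<rho> t\<bar> \<le> \<theta> * \<bar>s - t\<bar>"
proof -
  have "norm (\<rho> s - \<rho> t) \<le> \<theta> * norm (s - t)"
    by (rule field_differentiable_bound[of UNIV \<rho> w])
      (use \<rho>_deriv w_pos w_le in \<open>auto simp: less_imp_le has_field_derivative_at_within\<close>)
  then show ?thesis by simp
qed

lemma eps_diff: "\<bar>(\<epsilon> * s + c) - (\<epsilon> * t + c)\<bar> = \<bar>s - t\<bar>"
  using \<epsilon> by auto

lemma branch_lipschitz: "\<bar>branch k s - branch k t\<bar> \<le> \<theta> * \<bar>s - t\<bar>"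
  using \<rho>_lipschitz[of "\<epsilon> * s + real k" "\<epsilon> * t + real k"] eps_diff by (simp add: branch_def)

lemma jac_distortion: "jac k s \<le> jac k t * exp (K * \<bar>s - t\<bar>)"
  using w_distortion[of "\<epsilon> * s + real k" "\<epsilon> * t + real k"] eps_diff by (simp add: jac_def)

text \<open>
  Moving \<open>s\<close> by one period permutes the \<open>n\<close> summands cyclically.
\<close>

lemma sum_blocks_periodic:
  fixes v :: "real \<Rightarrow> 'b::comm_monoid_add"
  assumes v: "\<And>s. v (s + real n) = v s"
  shows "(\<Sum>k<n. v (\<epsilon> * (s + 1) + real k)) = (\<Sum>k<n. v (\<epsilon> * s + real k))"
proof -
  have *: "(\<Sum>k<n. v ((s + 1) + real k)) = (\<Sum>k<n. v (s + real k))" for s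
  proof -
    obtain m where m: "n = Suc m" using n_pos gr0_implies_Suc by blast
    have "(\<Sum>k<n. v ((s + 1) + real k)) = (\<Sum>k<m. v (s + real (Suc k))) + v (s + real n)"
      by (simp add: m algebra_simps)
    also have "\<dots> = (\<Sum>k<n. v (s + real k))"
      unfolding v unfolding m by (subst sum.lessThan_Suc_shift) (simp add: add.commute)
    finally show ?thesis .
  qed
  show ?thesis
  proof (cases "\<epsilon> = 1")
    case True then show ?thesis using *[of s] by simp
  next
    case False
    then have "\<epsilon> = -1" using \<epsilon> by simp
    then show ?thesis using *[of "- s - 1"] by (simp add: algebra_simps)
  qed
qed

text \<open>
  The \<open>n\<close> summands together integrate \<open>f (\<rho> s) * w s\<close> over \<open>n\<close> periods; the substitution \<open>t = \<rho> s\<close>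
  turns this into the integral of \<open>f\<close> over a single period.
\<close>

lemma nn_integral_transfer:
  fixes f :: "real \<Rightarrow> ennreal"
  assumes [measurable]: "f \<in> borel_measurable borel" and per: "\<And>t. f (t + 1) = f t"
  shows "(\<integral>\<^sup>+s. (\<Sum>k<n. f (branch k s) * ennreal (jac k s)) \<partial>unit_lborel) = (\<integral>\<^sup>+t. f t \<partial>unit_lborel)"
proof -
  define v where "v s = f (\<rho> s) * ennreal (w s)" for s
  define g where "g s = (\<Sum>k<n. v (s + real k))" for s
  have v_meas [measurable]: "v \<in> borel_measurable borel" unfolding v_def by measurable
  have g_meas [measurable]: "g \<in> borel_measurable borel" unfolding g_def by measurable
  have v_per: "v (s + real n) = v s" for s
    by (simp add: v_def w_shift \<rho>_shift per)
  have g_eps: "g (\<epsilon> * (s + 1)) = g (\<epsilon> * s)" for s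
    unfolding g_def by (rule sum_blocks_periodic) (rule v_per)
  have g_per: "g (s + 1) = g s" for s
  proof (cases "\<epsilon> = 1")
    case True then show ?thesis using g_eps[of s] by simp
  next
    case False
    then have "\<epsilon> = -1" using \<epsilon> by simp
    then show ?thesis using g_eps[of "- s - 1"] by (simp add: add.commute)
  qed
  have "(\<integral>\<^sup>+s. (\<Sum>k<n. f (branch k s) * ennreal (jac k s)) \<partial>unit_lborel)
      = (\<integral>\<^sup>+s. g (\<epsilon> * s) \<partial>unit_lborel)"
    by (simp add: branch_def jac_def g_def v_def)
  also have "\<dots> = (\<integral>\<^sup>+s. g s \<partial>unit_lborel)"
    using \<epsilon> nn_integral_periodic_reflect_unit[OF g_meas g_per] by auto
  also have "\<dots> = (\<Sum>k<n. \<integral>\<^sup>+s. v (s + real k) \<partial>unit_lborel)"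
    unfolding g_def by (intro nn_integral_sum borel_measurable_unit) measurable
  also have "\<dots> = (\<integral>\<^sup>+s. v s * indicator {0..<real n} s \<partial>lborel)"
    by (rule nn_integral_unit_blocks[symmetric]) measurable
  also have "\<dots> = (\<integral>\<^sup>+s. v s * indicator {0..real n} s \<partial>lborel)"
    using AE_lborel_singleton[of "real n"]
    by (intro nn_integral_cong_AE) (auto simp: indicator_def elim!: eventually_mono)
  also have "\<dots> = (\<integral>\<^sup>+t. f t * indicator {\<rho> 0..\<rho> (real n)} t \<partial>lborel)"
    unfolding v_def
  proof (rule nn_integral_substitution_aux[symmetric])
    show "continuous_on {0..real n} w" using continuous_w continuous_on_subset by blast
  qed (use \<rho>_deriv w_pos n_pos in \<open>auto simp: less_imp_le\<close>)
  also have "\<dots> = (\<integral>\<^sup>+t. f t * indicator {\<rho> 0..<\<rho> 0 + 1} t \<partial>lborel)"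
    using \<rho>_shift[of 0] AE_lborel_singleton[of "\<rho> (real n)"]
    by (intro nn_integral_cong_AE) (auto simp: indicator_def elim!: eventually_mono)
  also have "\<dots> = (\<integral>\<^sup>+t. f (t + \<rho> 0) \<partial>unit_lborel)"
    by (rule nn_integral_shift_unit) measurable
  also have "\<dots> = (\<integral>\<^sup>+t. f t \<partial>unit_lborel)"
    by (rule nn_integral_periodic_shift_unit) (use per in auto)
  finally show ?thesis .
qed

lemma transfer_measurable [measurable]:
  assumes [measurable]: "f \<in> borel_measurable borel"
  shows "transfer f \<in> borel_measurable borel"
  unfolding transfer_def by measurable

lemma transfer_nonneg: "(\<And>t. 0 \<le> f t) \<Longrightarrow> 0 \<le> transfer f s"
  unfolding transfer_def using jac_pos by (intro sum_nonneg mult_nonneg_nonneg) (auto simp: less_imp_le)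

lemma transfer_periodic:
  assumes per: "\<And>t. f (t + 1) = f t"
  shows "transfer f (s + 1) = transfer f s"
  unfolding transfer_def branch_def jac_def
  by (rule sum_blocks_periodic[where v="\<lambda>s. f (\<rho> s) * w s"]) (simp add: w_shift \<rho>_shift per)

lemma transfer_linear: "transfer (\<lambda>t. c * f t + d * g t) = (\<lambda>t. c * transfer f t + d * transfer g t)"
  by (rule ext) (simp add: transfer_def sum_distrib_left sum.distrib algebra_simps)

lemma integral_transfer:
  assumes [measurable]: "f \<in> borel_measurable borel" and per: "\<And>t. f (t + 1) = f t"
    and nn: "\<And>t. 0 \<le> f t"
  shows "(\<integral>t. transfer f t \<partial>unit_lborel) = (\<integral>t. f t \<partial>unit_lborel)"
proof -
  have "(\<integral>\<^sup>+t. ennreal (transfer f t) \<partial>unit_lborel) = (\<integral>\<^sup>+t. ennreal (f t) \<partial>unit_lborel)"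
  proof -
    have "ennreal (transfer f t) = (\<Sum>k<n. ennreal (f (branch k t)) * ennreal (jac k t))" for t
      unfolding transfer_def using jac_pos nn
      by (subst sum_ennreal[symmetric]) (auto simp: ennreal_mult' less_imp_le mult_nonneg_nonneg)
    then show ?thesis using nn_integral_transfer[of "\<lambda>t. ennreal (f t)"] per by simp
  qed
  then show ?thesis
    using nn transfer_nonneg[of f]
    by (subst (1 2) integral_eq_nn_integral) (auto intro!: borel_measurable_unit)
qed

text \<open>
  For one step, \<open>\<phi> \<circ> T\<close> is constant on the set of preimages of a point, so it can be
  taken out of the sum over the branches.
\<close>

lemma transfer_duality:
  fixes \<phi> :: "circle \<Rightarrow> real"
  assumes [measurable]: "f \<in> borel_measurable borel" "\<phi> \<in> borel_measurable borel"
    and per: "\<And>t. f (t + 1) = f t" and nn: "\<And>t. 0 \<le> f t" "\<And>x. 0 \<le> \<phi> x"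
  shows "(\<integral>t. f t * \<phi> ((T ^^ m) (circle_proj t)) \<partial>unit_lborel)
       = (\<integral>t. (transfer ^^ m) f t * \<phi> (circle_proj t) \<partial>unit_lborel)"
  using assms(1,3,4)
proof (induction m arbitrary: f)
  case (Suc m)
  note [measurable] = Suc.prems(1)
  have Tm [measurable]: "(T ^^ m) \<in> borel_measurable borel" for m
    by (induction m) (auto intro: measurable_comp)
  have proj_per: "circle_proj (t + 1) = circle_proj t" for t by (simp add: circle_proj_eq_iff)
  have "(\<integral>t. f t * \<phi> ((T ^^ Suc m) (circle_proj t)) \<partial>unit_lborel)
     = (\<integral>t. transfer (\<lambda>t. f t * \<phi> ((T ^^ Suc m) (circle_proj t))) t \<partial>unit_lborel)"
    using Suc.prems nn(2) proj_per
    by (intro integral_transfer[symmetric] mult_nonneg_nonneg) auto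
  also have "\<dots> = (\<integral>t. transfer f t * \<phi> ((T ^^ m) (circle_proj t)) \<partial>unit_lborel)"
    by (simp add: transfer_def funpow_Suc_right T_branch sum_distrib_right sum_distrib_left ac_simps del: funpow.simps)
  also have "\<dots> = (\<integral>t. (transfer ^^ m) (transfer f) t * \<phi> (circle_proj t) \<partial>unit_lborel)"
    using Suc.prems by (intro Suc.IH) (auto intro: transfer_nonneg transfer_periodic)
  finally show ?case by (simp add: funpow_Suc_right del: funpow.simps)
qed simp

end

section \<open>Contraction of densities with Lipschitz logarithm\<close>

lemma convergent_geometric:
  fixes f :: "nat \<Rightarrow> 'a::banach"
  assumes "0 \<le> r" "r < 1" and f: "\<And>m. norm (f (Suc m) - f m) \<le> C * r ^ m"
  shows "convergent f"
proof -
  have "summable (\<lambda>m. f (Suc m) - f m)"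
  proof (rule summable_comparison_test')
    show "summable (\<lambda>m. C * r ^ m)" using assms by (intro summable_mult summable_geometric) auto
  qed (rule f)
  then have "(\<lambda>k. (\<Sum>m<k. f (Suc m) - f m) + f 0) \<longlonglongrightarrow> (\<Sum>m. f (Suc m) - f m) + f 0"
    by (intro tendsto_add summable_LIMSEQ tendsto_const)
  then show ?thesis
    unfolding sum_lessThan_telescope by (simp add: convergentI)
qed

lemma prob_unit_interval [simp]: "measure unit_lborel {0..<1} = 1"
  using unit.prob_space by (simp add: space_restrict_space)

text \<open>
  The Lipschitz condition on the logarithm is stated multiplicatively, which keeps the class closed
  under sums and pointwise limits.
\<close>

definition cone_density :: "real \<Rightarrow> (real \<Rightarrow> real) \<Rightarrow> bool"
  where "cone_density a f \<longleftrightarrow>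
    (\<forall>t. 0 \<le> f t) \<and> (\<forall>t. f (t + 1) = f t) \<and>
    (\<forall>s t. f s \<le> f t * exp (a * \<bar>s - t\<bar>)) \<and> (\<integral>t. f t \<partial>unit_lborel) = 1"

lemma log_lipschitz_measurable:
  fixes f :: "real \<Rightarrow> real"
  assumes "\<And>s t. f s \<le> f t * exp (a * \<bar>s - t\<bar>)"
  shows "f \<in> borel_measurable borel"
  using log_lipschitz_continuous[of f a] assms by (simp add: borel_measurable_continuous_onI)

lemma cone_density_measurable: "cone_density a f \<Longrightarrow> f \<in> borel_measurable borel"
  using log_lipschitz_measurable[of f a] by (simp add: cone_density_def)

lemma cone_mono:
  assumes f: "cone_density a f" and ab: "a \<le> b"
  shows "cone_density b f"
proof -
  have "f s \<le> f t * exp (b * \<bar>s - t\<bar>)" for s t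
  proof -
    have "f s \<le> f t * exp (a * \<bar>s - t\<bar>)" using f by (simp add: cone_density_def)
    also have "\<dots> \<le> f t * exp (b * \<bar>s - t\<bar>)"
      using f ab by (intro mult_left_mono) (auto simp: cone_density_def mult_right_mono)
    finally show ?thesis .
  qed
  then show ?thesis using f by (simp add: cone_density_def)
qed

lemma integrable_unit_bounded:
  fixes f :: "real \<Rightarrow> real"
  assumes "f \<in> borel_measurable borel" and "\<And>t. t \<in> {0..<1} \<Longrightarrow> \<bar>f t\<bar> \<le> B"
  shows "integrable unit_lborel f"
  using assms by (intro unit.integrable_const_bound[where B=B] borel_measurable_unit)
    (auto simp: AE_restrict_space_iff)

lemma log_lipschitz_unit_bound:
  fixes f :: "real \<Rightarrow> real"
  assumes a: "0 \<le> a" and nn: "\<And>t. 0 \<le> f t" and lip: "\<And>s t. f s \<le> f t * exp (a * \<bar>s - t\<bar>)"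
    and s: "s \<in> {0..<1}" "t \<in> {0..<1}"
  shows "f s \<le> f t * exp a"
proof -
  have "a * \<bar>s - t\<bar> \<le> a * 1" using a s by (intro mult_left_mono) auto
  then have "f t * exp (a * \<bar>s - t\<bar>) \<le> f t * exp a" using nn by (intro mult_left_mono) auto
  then show ?thesis using lip[of s t] by simp
qed

lemma log_lipschitz_integrable:
  fixes f :: "real \<Rightarrow> real"
  assumes a: "0 \<le> a" and nn: "\<And>t. 0 \<le> f t" and lip: "\<And>s t. f s \<le> f t * exp (a * \<bar>s - t\<bar>)"
  shows "integrable unit_lborel f"
proof (rule integrable_unit_bounded)
  show "f \<in> borel_measurable borel" using lip by (rule log_lipschitz_measurable)
  show "\<bar>f t\<bar> \<le> f 0 * exp a" if "t \<in> {0..<1}" for t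
    using log_lipschitz_unit_bound[of a f t 0] that a nn lip by simp
qed

lemma cone_density_integrable: "cone_density a f \<Longrightarrow> 0 \<le> a \<Longrightarrow> integrable unit_lborel f"
  by (rule log_lipschitz_integrable[of a]) (auto simp: cone_density_def)

lemma unit_integral_le:
  fixes f :: "real \<Rightarrow> real"
  assumes "integrable unit_lborel f" "\<And>t. t \<in> {0..<1} \<Longrightarrow> f t \<le> c"
  shows "(\<integral>t. f t \<partial>unit_lborel) \<le> c"
proof -
  have "(\<integral>t. f t \<partial>unit_lborel) \<le> (\<integral>t. c \<partial>unit_lborel)"
    using assms by (intro integral_mono) (auto simp: space_restrict_space)
  then show ?thesis by (simp add: unit.prob_space)
qed

lemma unit_integral_ge:
  fixes f :: "real \<Rightarrow> real"
  assumes "integrable unit_lborel f" "\<And>t. t \<in> {0..<1} \<Longrightarrow> c \<le> f t"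
  shows "c \<le> (\<integral>t. f t \<partial>unit_lborel)"
proof -
  have "(\<integral>t. c \<partial>unit_lborel) \<le> (\<integral>t. f t \<partial>unit_lborel)"
    using assms by (intro integral_mono) (auto simp: space_restrict_space)
  then show ?thesis by (simp add: unit.prob_space)
qed

text \<open>
  Two values of \<open>f\<close> on the circle differ at most by the factor \<open>exp a\<close>, and the mean of \<open>f\<close> is 1.
\<close>

lemma cone_density_bounds:
  assumes f: "cone_density a f" and a: "0 \<le> a"
  shows "exp (- a) \<le> f t" "f t \<le> exp a"
proof -
  note int = cone_density_integrable[OF f a]
  have bd: "f s \<le> f t * exp a" if "s \<in> {0..<1}" "t \<in> {0..<1}" for s t
    using log_lipschitz_unit_bound[of a f s t] f that a by (simp add: cone_density_def)
  have fr: "frac t \<in> {0..<1}" by (simp add: frac_lt_1)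
  have ft: "f (frac t) = f t" using f by (intro periodic_frac) (simp add: cone_density_def)
  have "1 \<le> f (frac t) * exp a"
    using unit_integral_le[OF int, of "f (frac t) * exp a"] bd fr f by (simp add: cone_density_def)
  then show "exp (- a) \<le> f t" by (simp add: ft exp_minus field_simps)
  have "f (frac t) * exp (- a) \<le> f s" if "s \<in> {0..<1}" for s
    using bd[OF fr that] by (simp add: exp_minus field_simps)
  then have "f (frac t) * exp (- a) \<le> 1"
    using unit_integral_ge[OF int] f by (simp add: cone_density_def)
  then show "f t \<le> exp a" by (simp add: ft exp_minus field_simps)
qed

lemma cone_density_one: "0 \<le> a \<Longrightarrow> cone_density a (\<lambda>_. 1)"
  by (simp add: cone_density_def unit.prob_space)

text \<open>
  The exponential is convex, and \<open>b * x\<close> divides the segment from \<open>0\<close> to \<open>a * x\<close> in the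
  ratio \<open>b / a\<close>.
\<close>

lemma exp_convex_bound:
  fixes a b x :: real
  assumes "0 \<le> b" "b \<le> a" "0 < a"
  shows "(1 - b / a) * (exp (a * x) - 1) \<le> exp (a * x) - exp (b * x)"
proof -
  have "exp ((1 - b / a) *\<^sub>R 0 + (b / a) *\<^sub>R (a * x)) \<le> (1 - b / a) * exp 0 + (b / a) * exp (a * x)"
    using assms exp_convex by (intro convex_onD[where A=UNIV]) auto
  then show ?thesis using assms by (simp add: algebra_simps)
qed

text \<open>
  Subtracting a constant worsens the Lipschitz constant of the logarithm. The value of \<open>c\<close> is the
  amount that can be subtracted when the constant may grow from \<open>b\<close> to \<open>a\<close>: a density with
  constant \<open>b\<close> is at least \<open>exp (- b)\<close>, and the gap between the two exponential bounds is
  controlled by convexity.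
\<close>

lemma cone_density_split:
  assumes f: "cone_density b f" and ab: "0 \<le> b" "b < a"
    and c: "c = exp (- b) * (1 - b / a)" "c < 1"
  shows "cone_density a (\<lambda>t. (f t - c) / (1 - c))"
  unfolding cone_density_def
proof (intro conjI allI)
  have f_ge: "exp (- b) \<le> f t" for t using cone_density_bounds[OF f ab(1)] by simp
  have c_le: "c \<le> f t" for t
  proof -
    have "c \<le> exp (- b) * 1" unfolding c(1) using ab by (intro mult_left_mono) auto
    then show ?thesis using f_ge[of t] by simp
  qed
  show "0 \<le> (f t - c) / (1 - c)" for t using c_le c by simp
  show "(f (t + 1) - c) / (1 - c) = (f t - c) / (1 - c)" for t
    using f by (simp add: cone_density_def)
  show "(\<integral>t. (f t - c) / (1 - c) \<partial>unit_lborel) = 1"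
    using cone_density_integrable[OF f ab(1)] f c(2)
    by (simp add: cone_density_def unit.prob_space)
  show "(f s - c) / (1 - c) \<le> (f t - c) / (1 - c) * exp (a * \<bar>s - t\<bar>)" for s t
  proof -
    let ?d = "\<bar>s - t\<bar>"
    have E: "0 \<le> exp (a * ?d) - 1" using ab by simp
    have "c * (exp (a * ?d) - 1) = exp (- b) * ((1 - b / a) * (exp (a * ?d) - 1))"
      by (simp add: c(1))
    also have "\<dots> \<le> f t * ((1 - b / a) * (exp (a * ?d) - 1))"
      using f_ge ab E by (intro mult_right_mono mult_nonneg_nonneg) auto
    also have "\<dots> \<le> f t * (exp (a * ?d) - exp (b * ?d))"
      using exp_convex_bound[of b a ?d] ab f by (intro mult_left_mono) (auto simp: cone_density_def)
    finally have "f t * exp (b * ?d) - c \<le> (f t - c) * exp (a * ?d)" by (simp add: algebra_simps)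
    moreover have "f s \<le> f t * exp (b * ?d)" using f by (simp add: cone_density_def)
    ultimately have "f s - c \<le> (f t - c) * exp (a * ?d)" by simp
    then show ?thesis using c(2) by (simp add: divide_right_mono)
  qed
qed

context expanding_branches
begin

text \<open>
  The branches contract distances by \<open>\<theta>\<close>, which multiplies the old constant, and the distortion
  of the Jacobian adds \<open>K\<close>.
\<close>

lemma cone_density_transfer:
  assumes f: "cone_density a f" and a: "0 \<le> a"
  shows "cone_density (a * \<theta> + K) (transfer f)"
  unfolding cone_density_def
proof (intro conjI allI)
  note [measurable] = cone_density_measurable[OF f]
  have nn: "\<And>t. 0 \<le> f t" and per: "\<And>t. f (t + 1) = f t" using f by (auto simp: cone_density_def)
  show "0 \<le> transfer f t" for t using nn by (rule transfer_nonneg)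
  show "transfer f (t + 1) = transfer f t" for t using per by (rule transfer_periodic)
  show "(\<integral>t. transfer f t \<partial>unit_lborel) = 1"
    using f by (subst integral_transfer) (auto simp: cone_density_def)
  show "transfer f s \<le> transfer f t * exp ((a * \<theta> + K) * \<bar>s - t\<bar>)" for s t
  proof -
    have "f (branch k s) * jac k s
        \<le> f (branch k t) * jac k t * exp ((a * \<theta> + K) * \<bar>s - t\<bar>)" for k
    proof -
      have "f (branch k s) \<le> f (branch k t) * exp (a * \<bar>branch k s - branch k t\<bar>)"
        using f by (simp add: cone_density_def)
      also have "\<dots> \<le> f (branch k t) * exp (a * (\<theta> * \<bar>s - t\<bar>))"
        using nn a branch_lipschitz[of k s t] by (intro mult_left_mono) (auto simp: mult_left_mono)
      finally have 1: "f (branch k s) \<le> f (branch k t) * exp (a * (\<theta> * \<bar>s - t\<bar>))" .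
      have "f (branch k s) * jac k s
          \<le> (f (branch k t) * exp (a * (\<theta> * \<bar>s - t\<bar>))) * (jac k t * exp (K * \<bar>s - t\<bar>))"
        using nn jac_pos by (intro mult_mono 1 jac_distortion) (auto simp: less_imp_le)
      also have "\<dots> = f (branch k t) * jac k t * exp ((a * \<theta> + K) * \<bar>s - t\<bar>)"
        by (simp add: algebra_simps exp_add)
      finally show ?thesis .
    qed
    then show ?thesis unfolding transfer_def sum_distrib_right by (intro sum_mono) auto
  qed
qed

text \<open>
  The fixed point of \<open>a \<mapsto> a \<theta> + K\<close>: above it, the transfer operator strictly improves the constant.
\<close>

definition cone_const :: real
  where "cone_const = K / (1 - \<theta>)"

lemma cone_const_pos: "0 < cone_const"
  using K_pos theta_less by (simp add: cone_const_def)

lemma cone_const_less: "cone_const < a \<Longrightarrow> a * \<theta> + K < a"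
  using theta_less by (simp add: cone_const_def field_simps)

lemma cone_density_funpow:
  assumes f: "cone_density a f" and a: "cone_const < a"
  shows "cone_density a ((transfer ^^ m) f)"
proof (induction m)
  case (Suc m)
  then show ?case
    using cone_mono[OF cone_density_transfer[OF Suc]] cone_const_less[OF a] cone_const_pos a by simp
qed (simp add: f)

lemma funpow_transfer_linear:
  "(transfer ^^ m) (\<lambda>t. c * f t + d * g t) = (\<lambda>t. c * (transfer ^^ m) f t + d * (transfer ^^ m) g t)"
proof (induction m)
  case (Suc m)
  then show ?case by (simp add: transfer_linear)
qed simp

text \<open>
  One step maps both densities to the common constant \<open>c\<close> plus \<open>1 - c\<close> times densities of the same
  class. By linearity the constant cancels in the difference, and each step gains a factor \<open>1 - c\<close>.
\<close>

lemma transfer_contraction: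
  assumes a: "cone_const < a"
  shows "\<exists>r>0. r < 1 \<and> (\<forall>f g m t. cone_density a f \<longrightarrow> cone_density a g \<longrightarrow>
      \<bar>(transfer ^^ m) f t - (transfer ^^ m) g t\<bar> \<le> r ^ m * exp a)"
proof -
  \<comment> \<open>The improved constant: the gap between b and a is what pays for the split.\<close>
  define b where "b = a * \<theta> + K"
  have a0: "0 < a" using cone_const_pos a by simp
  have b0: "0 < b" using a0 theta_pos K_pos by (auto simp: b_def intro!: add_pos_pos)
  have ba: "b < a" using cone_const_less[OF a] by (simp add: b_def)
  define c where "c = exp (- b) * (1 - b / a)"
  have c0: "0 < c" using ba a0 by (simp add: c_def)
  have "c < 1 * 1"
    unfolding c_def using b0 ba a0 by (intro mult_strict_mono) auto
  then have c1: "c < 1" by simp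
  have split: "\<exists>f1. cone_density a f1 \<and> transfer f = (\<lambda>t. c * 1 + (1 - c) * f1 t)"
    if f: "cone_density a f" for f
  proof (intro exI conjI)
    have "cone_density b (transfer f)" unfolding b_def using f a0 by (intro cone_density_transfer) auto
    then show "cone_density a (\<lambda>t. (transfer f t - c) / (1 - c))"
      using b0 ba c1 by (intro cone_density_split[of b]) (auto simp: c_def)
    show "transfer f = (\<lambda>t. c * 1 + (1 - c) * ((transfer f t - c) / (1 - c)))"
      using c1 by (auto simp: field_simps)
  qed
  have contr: "\<bar>(transfer ^^ m) f t - (transfer ^^ m) g t\<bar> \<le> (1 - c) ^ m * exp a"
    if "cone_density a f" "cone_density a g" for f g m t
    using that
  proof (induction m arbitrary: f g)
    case 0
    have "0 < exp (- a)" by simp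
    then have "0 \<le> f t" "0 \<le> g t" "f t \<le> exp a" "g t \<le> exp a"
      using cone_density_bounds[OF 0(1), of t] cone_density_bounds[OF 0(2), of t] a0 by linarith+
    then show ?case by simp
  next
    case (Suc m)
    obtain f1 where f1: "cone_density a f1" "transfer f = (\<lambda>t. c * 1 + (1 - c) * f1 t)"
      using split[OF Suc.prems(1)] by blast
    obtain g1 where g1: "cone_density a g1" "transfer g = (\<lambda>t. c * 1 + (1 - c) * g1 t)"
      using split[OF Suc.prems(2)] by blast
    have "(transfer ^^ Suc m) f t - (transfer ^^ Suc m) g t
        = (1 - c) * ((transfer ^^ m) f1 t - (transfer ^^ m) g1 t)"
      unfolding funpow_Suc_right o_apply f1 g1 funpow_transfer_linear by (simp add: algebra_simps)
    then show ?case
      using Suc.IH[OF f1(1) g1(1)] c1 by (simp add: abs_mult mult_left_mono)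
  qed
  show ?thesis using c0 c1 contr by (intro exI[of _ "1 - c"]) auto
qed

text \<open>
  The iterates of the constant density 1 form a Cauchy sequence, since consecutive iterates are images of
  two densities of the class under the same power of the operator.
\<close>

lemma invariant_density_exists:
  "\<exists>h. cone_density (cone_const + 1) h \<and> transfer h = h"
proof -
  define a where "a = cone_const + 1"
  have a: "cone_const < a" "0 < a" using cone_const_pos by (simp_all add: a_def)
  obtain r where r: "0 < r" "r < 1"
    "\<And>f g m t. cone_density a f \<Longrightarrow> cone_density a g \<Longrightarrow>
      \<bar>(transfer ^^ m) f t - (transfer ^^ m) g t\<bar> \<le> r ^ m * exp a"
    using transfer_contraction[OF a(1)] by blast
  define L where "L m = (transfer ^^ m) (\<lambda>_. 1)" for m
  have L_cone: "cone_density a (L m)" for m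
    unfolding L_def using a by (intro cone_density_funpow cone_density_one) auto
  have L_add: "L (m + k) = (transfer ^^ m) (L k)" for m k
    by (simp add: L_def funpow_add)
  have "convergent (\<lambda>m. L m t)" for t
  proof -
    have "norm (L (Suc m) t - L m t) \<le> exp a * r ^ m" for m
      using r(3)[OF L_cone[of 1] L_cone[of 0], of m t] by (simp add: mult.commute flip: L_add)
    then show ?thesis using r by (intro convergent_geometric[of r _ "exp a"]) auto
  qed
  then obtain h where h: "\<And>t. (\<lambda>m. L m t) \<longlonglongrightarrow> h t"
    unfolding convergent_def by metis
  have L_bd: "\<bar>L m t\<bar> \<le> exp a" for m t
    using cone_density_bounds[OF L_cone[of m], of t] a L_cone[of m] by (simp add: cone_density_def)
  have "cone_density a h"
    unfolding cone_density_def
  proof (intro conjI allI)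
    show "0 \<le> h t" for t
      using h by (rule LIMSEQ_le_const) (use L_cone in \<open>auto simp: cone_density_def\<close>)
    show per: "h (t + 1) = h t" for t
    proof (rule LIMSEQ_unique[OF h])
      have "L m (t + 1) = L m t" for m using L_cone[of m] by (simp add: cone_density_def)
      then show "(\<lambda>m. L m (t + 1)) \<longlonglongrightarrow> h t" using h by simp
    qed
    show lip: "h s \<le> h t * exp (a * \<bar>s - t\<bar>)" for s t
      by (rule LIMSEQ_le[OF h tendsto_mult_right[OF h]])
        (use L_cone in \<open>auto simp: cone_density_def\<close>)
    have "(\<lambda>m. \<integral>t. L m t \<partial>unit_lborel) \<longlonglongrightarrow> (\<integral>t. h t \<partial>unit_lborel)"
    proof (rule integral_dominated_convergence[where w="\<lambda>_. exp a"])
      show "h \<in> borel_measurable unit_lborel"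
        using log_lipschitz_measurable[of h a] lip by (simp add: borel_measurable_unit)
      show "L m \<in> borel_measurable unit_lborel" for m
        using cone_density_measurable[OF L_cone] by (rule borel_measurable_unit)
    qed (use h L_bd in auto)
    moreover have "(\<integral>t. L m t \<partial>unit_lborel) = 1" for m
      using L_cone by (simp add: cone_density_def)
    ultimately show "(\<integral>t. h t \<partial>unit_lborel) = 1" by (simp add: LIMSEQ_const_iff)
  qed
  moreover have "transfer h = h"
  proof
    fix t
    have "(\<lambda>m. transfer (L m) t) \<longlonglongrightarrow> transfer h t"
      unfolding transfer_def by (intro tendsto_intros h)
    moreover have "(\<lambda>m. transfer (L m) t) \<longlonglongrightarrow> h t"
      using LIMSEQ_Suc[OF h[of t]] by (simp add: L_def)
    ultimately show "transfer h t = h t" by (rule LIMSEQ_unique)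
  qed
  ultimately show ?thesis unfolding a_def by blast
qed

definition h :: "real \<Rightarrow> real"
  where "h = (SOME h. cone_density (cone_const + 1) h \<and> transfer h = h)"

lemma h_cone: "cone_density (cone_const + 1) h" and transfer_h: "transfer h = h"
  using someI_ex[OF invariant_density_exists] by (simp_all add: h_def)

lemma funpow_transfer_tendsto_h:
  assumes f: "cone_density a f"
  shows "(\<lambda>m. (transfer ^^ m) f t) \<longlonglongrightarrow> h t"
proof -
  \<comment> \<open>The contraction is available above cone_const only; enlarging the constant loses nothing.\<close>
  define b where "b = max a (cone_const + 1)"
  have b: "cone_const < b" by (simp add: b_def)
  have fb: "cone_density b f" by (rule cone_mono[OF f]) (simp add: b_def)
  have hb: "cone_density b h" by (rule cone_mono[OF h_cone]) (simp add: b_def)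
  obtain r where r: "0 < r" "r < 1"
    "\<And>f g m t. cone_density b f \<Longrightarrow> cone_density b g \<Longrightarrow>
      \<bar>(transfer ^^ m) f t - (transfer ^^ m) g t\<bar> \<le> r ^ m * exp b"
    using transfer_contraction[OF b] by blast
  have fix_h: "(transfer ^^ m) h = h" for m
    by (induction m) (simp_all add: transfer_h)
  show ?thesis
  proof (rule Lim_null[THEN iffD2])
    show "(\<lambda>m. (transfer ^^ m) f t - h t) \<longlonglongrightarrow> 0"
    proof (rule Lim_null_comparison)
      show "\<forall>\<^sub>F m in sequentially. norm ((transfer ^^ m) f t - h t) \<le> r ^ m * exp b"
        using r(3)[OF fb hb] by (simp add: fix_h)
      show "(\<lambda>m. r ^ m * exp b) \<longlonglongrightarrow> 0"
        using r by (intro tendsto_mult_left_zero LIMSEQ_power_zero) auto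
    qed
  qed
qed

end

section \<open>Mixing and uniqueness of the invariant density\<close>

text \<open>
  These Lipschitz functions increase to the indicator of the open set \<open>U\<close>. The whole space is singled out
  because \<open>infdist\<close> to the empty set is 0.
\<close>

definition open_bump :: "nat \<Rightarrow> 'a::metric_space set \<Rightarrow> 'a \<Rightarrow> real"
  where "open_bump k U x = (if U = UNIV then 1 else min 1 (real k * infdist x (- U)))"

lemma open_bump_range: "0 \<le> open_bump k U x" "open_bump k U x \<le> 1"
  by (auto simp: open_bump_def infdist_nonneg)

lemma open_bump_lipschitz: "\<bar>open_bump k U x - open_bump k U y\<bar> \<le> real k * dist x y"
proof (cases "U = UNIV")
  case False
  have "\<bar>open_bump k U x - open_bump k U y\<bar> \<le> \<bar>real k * infdist x (- U) - real k * infdist y (- U)\<bar>"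
    using False by (auto simp: open_bump_def min_def)
  also have "\<dots> = real k * \<bar>infdist x (- U) - infdist y (- U)\<bar>"
    by (simp add: abs_mult flip: right_diff_distrib)
  also have "\<dots> \<le> real k * dist x y"
    by (intro mult_left_mono infdist_triangle_abs) auto
  finally show ?thesis .
qed (simp add: open_bump_def)

lemma open_bump_tendsto:
  assumes "open U"
  shows "(\<lambda>k. open_bump k U x) \<longlonglongrightarrow> indicator U x"
proof (cases "x \<in> U")
  case True
  show ?thesis
  proof (cases "U = UNIV")
    case False
    then have "0 < infdist x (- U)"
      using assms True by (intro infdist_pos_not_in_closed) auto
    then obtain N where N: "1 < real N * infdist x (- U)"
      using reals_Archimedean3 by blast
    have "\<forall>\<^sub>F k in sequentially. open_bump k U x = 1"
      using eventually_ge_at_top[of N]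
    proof eventually_elim
      case (elim k)
      have "real N * infdist x (- U) \<le> real k * infdist x (- U)"
        using elim by (intro mult_right_mono infdist_nonneg) auto
      then show ?case using N by (simp add: open_bump_def)
    qed
    then show ?thesis using True by (simp add: tendsto_eventually)
  qed (simp add: open_bump_def)
next
  case False
  then have "open_bump k U x = 0" for k by (auto simp: open_bump_def)
  then show ?thesis using False by simp
qed

lemma open_bump_measurable [measurable]: "open_bump k U \<in> borel_measurable borel"
  unfolding open_bump_def by (cases "U = UNIV") (auto intro!: borel_measurable_continuous_onI continuous_intros)

lemma open_bump_periodic:
  fixes U :: "real set"
  assumes "\<And>t. t + 1 \<in> U \<longleftrightarrow> t \<in> U"
  shows "open_bump k U (t + 1) = open_bump k U t"
proof -
  have "dist (t + 1) ` (- U) = dist t ` (- U)"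
  proof (intro set_eqI iffI)
    fix d assume "d \<in> dist (t + 1) ` (- U)"
    then obtain a where "a \<notin> U" "d = dist (t + 1) a" by auto
    then show "d \<in> dist t ` (- U)"
      using assms[of "a - 1"] by (intro image_eqI[of _ _ "a - 1"]) (auto simp: dist_real_def)
  next
    fix d assume "d \<in> dist t ` (- U)"
    then obtain a where "a \<notin> U" "d = dist t a" by auto
    then show "d \<in> dist (t + 1) ` (- U)"
      using assms[of a] by (intro image_eqI[of _ _ "a + 1"]) (auto simp: dist_real_def)
  qed
  then show ?thesis by (simp add: open_bump_def infdist_def)
qed

text \<open>
  In the application \<open>A m\<close> is the preimage of a set \<open>E\<close> under \<open>T ^^ m\<close>, and \<open>c\<close> is the invariant
  measure of \<open>E\<close>. The property is stated for single functions because it is extended from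
  Lipschitz functions to all integrable ones.
\<close>

definition mixes :: "'a measure \<Rightarrow> (nat \<Rightarrow> 'a set) \<Rightarrow> real \<Rightarrow> ('a \<Rightarrow> real) \<Rightarrow> bool"
  where "mixes M A c f \<longleftrightarrow> integrable M f \<and>
    (\<lambda>m. \<integral>x. f x * indicat_real (A m) x \<partial>M) \<longlonglongrightarrow> c * (\<integral>x. f x \<partial>M)"

lemma integrable_mult_indicator_right:
  fixes f :: "'a \<Rightarrow> real"
  shows "A \<in> sets M \<Longrightarrow> integrable M f \<Longrightarrow> integrable M (\<lambda>x. f x * indicat_real A x)"
  using integrable_mult_indicator[of A M f] by (simp add: mult.commute)

lemma mixes_add:
  assumes A: "\<And>m. A m \<in> sets M" and f: "mixes M A c f" and g: "mixes M A c g"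
  shows "mixes M A c (\<lambda>x. f x + g x)"
proof -
  have int: "integrable M f" "integrable M g" using f g by (auto simp: mixes_def)
  have "(\<integral>x. (f x + g x) * indicat_real (A m) x \<partial>M)
     = (\<integral>x. f x * indicat_real (A m) x \<partial>M) + (\<integral>x. g x * indicat_real (A m) x \<partial>M)" for m
    using integrable_mult_indicator_right[OF A int(1)] integrable_mult_indicator_right[OF A int(2)]
    by (simp add: distrib_right)
  moreover have "(\<lambda>m. (\<integral>x. f x * indicat_real (A m) x \<partial>M) + (\<integral>x. g x * indicat_real (A m) x \<partial>M))
     \<longlonglongrightarrow> c * (\<integral>x. f x \<partial>M) + c * (\<integral>x. g x \<partial>M)"
    using f g unfolding mixes_def by (intro tendsto_add) auto
  ultimately show ?thesis using int by (simp add: mixes_def distrib_left)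
qed

lemma mixes_scale:
  assumes f: "mixes M A c f"
  shows "mixes M A c (\<lambda>x. d * f x)"
proof -
  have "(\<lambda>m. d * (\<integral>x. f x * indicat_real (A m) x \<partial>M)) \<longlonglongrightarrow> d * (c * (\<integral>x. f x \<partial>M))"
    using f unfolding mixes_def by (intro tendsto_mult_left) auto
  then show ?thesis using f by (simp add: mixes_def mult.assoc mult.left_commute)
qed

text \<open>
  Both sides of the defining limit are Lipschitz in \<open>f\<close> with respect to the \<open>L\<^sup>1\<close> norm, uniformly in
  \<open>m\<close>, so the property passes to dominated limits.
\<close>

lemma mixes_limit:
  assumes A: "\<And>m. A m \<in> sets M" and c: "0 \<le> c" "c \<le> 1"
    and f: "\<And>k. mixes M A c (f k)"
    and g: "g \<in> borel_measurable M" "\<And>x. x \<in> space M \<Longrightarrow> (\<lambda>k. f k x) \<longlonglongrightarrow> g x"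
    and w: "integrable M w" "\<And>k x. x \<in> space M \<Longrightarrow> \<bar>f k x\<bar> \<le> w x"
  shows "mixes M A c g"
proof -
  have int_f: "integrable M (f k)" for k using f by (simp add: mixes_def)
  then have f_meas: "f k \<in> borel_measurable M" for k by simp
  have g_le: "\<bar>g x\<bar> \<le> w x" if "x \<in> space M" for x
    by (rule LIMSEQ_le_const2[OF tendsto_rabs[OF g(2)[OF that]]]) (use w that in auto)
  have int_g: "integrable M g"
    by (rule Bochner_Integration.integrable_bound[OF w(1) g(1)])
      (use g_le in \<open>auto intro!: AE_I2 intro: order_trans[OF _ abs_ge_self]\<close>)
  have "(\<lambda>k. \<integral>x. \<bar>f k x - g x\<bar> \<partial>M) \<longlonglongrightarrow> (\<integral>x. 0 \<partial>M)"
  proof (rule integral_dominated_convergence[where w="\<lambda>x. 2 * w x"])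
    show "AE x in M. (\<lambda>k. \<bar>f k x - g x\<bar>) \<longlonglongrightarrow> 0"
    proof (rule AE_I2)
      fix x assume x: "x \<in> space M"
      have "(\<lambda>k. \<bar>f k x - g x\<bar>) \<longlonglongrightarrow> \<bar>g x - g x\<bar>" by (intro tendsto_intros g(2) x)
      then show "(\<lambda>k. \<bar>f k x - g x\<bar>) \<longlonglongrightarrow> 0" by simp
    qed
    show "AE x in M. norm \<bar>f k x - g x\<bar> \<le> 2 * w x" for k
    proof (rule AE_I2)
      fix x assume "x \<in> space M"
      then show "norm \<bar>f k x - g x\<bar> \<le> 2 * w x"
        using w(2)[of x k] g_le[of x] by simp
    qed
  qed (use w g f_meas in auto)
  then have L1: "(\<lambda>k. \<integral>x. \<bar>f k x - g x\<bar> \<partial>M) \<longlonglongrightarrow> 0" by simp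
  have "(\<lambda>m. (\<integral>x. g x * indicat_real (A m) x \<partial>M) - c * (\<integral>x. g x \<partial>M)) \<longlonglongrightarrow> 0"
  proof (rule LIMSEQ_I)
    fix e :: real assume e: "0 < e"
    obtain k where k: "(\<integral>x. \<bar>f k x - g x\<bar> \<partial>M) < e / 3"
    proof -
      have "\<forall>\<^sub>F k in sequentially. (\<integral>x. \<bar>f k x - g x\<bar> \<partial>M) < e / 3"
        using order_tendstoD(2)[OF L1, of "e / 3"] e by simp
      then show ?thesis using that by (auto simp: eventually_sequentially)
    qed
    have "(\<lambda>m. (\<integral>x. f k x * indicat_real (A m) x \<partial>M)) \<longlonglongrightarrow> c * (\<integral>x. f k x \<partial>M)"
      using f by (simp add: mixes_def)
    from LIMSEQ_D[OF this, of "e / 3"] e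
    obtain N where N: "\<And>m. m \<ge> N \<Longrightarrow>
        norm ((\<integral>x. f k x * indicat_real (A m) x \<partial>M) - c * (\<integral>x. f k x \<partial>M)) < e / 3" by auto
    have d1: "\<bar>(\<integral>x. f k x * indicat_real (A m) x \<partial>M) - (\<integral>x. g x * indicat_real (A m) x \<partial>M)\<bar>
        \<le> (\<integral>x. \<bar>f k x - g x\<bar> \<partial>M)" for m
    proof -
      have "(\<integral>x. f k x * indicat_real (A m) x \<partial>M) - (\<integral>x. g x * indicat_real (A m) x \<partial>M)
          = (\<integral>x. f k x * indicat_real (A m) x - g x * indicat_real (A m) x \<partial>M)"
        using integrable_mult_indicator_right[OF A] int_f int_g by simp
      also have "\<bar>\<dots>\<bar> \<le> (\<integral>x. \<bar>f k x * indicat_real (A m) x - g x * indicat_real (A m) x\<bar> \<partial>M)"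
        by (rule integral_abs_bound)
      also have "\<dots> \<le> (\<integral>x. \<bar>f k x - g x\<bar> \<partial>M)"
        using int_f int_g integrable_mult_indicator_right[OF A] 
        by (intro integral_mono) (auto simp: indicator_def)
      finally show ?thesis .
    qed
    have d2: "\<bar>c * (\<integral>x. f k x \<partial>M) - c * (\<integral>x. g x \<partial>M)\<bar> \<le> (\<integral>x. \<bar>f k x - g x\<bar> \<partial>M)"
    proof -
      have "\<bar>c * (\<integral>x. f k x \<partial>M) - c * (\<integral>x. g x \<partial>M)\<bar> = c * \<bar>(\<integral>x. f k x - g x \<partial>M)\<bar>"
        using int_f int_g c by (simp add: abs_mult flip: right_diff_distrib)
      also have "\<dots> \<le> 1 * (\<integral>x. \<bar>f k x - g x\<bar> \<partial>M)"
        using c by (intro mult_mono integral_abs_bound) auto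
      finally show ?thesis by simp
    qed
    show "\<exists>N. \<forall>m\<ge>N. norm ((\<integral>x. g x * indicat_real (A m) x \<partial>M) - c * (\<integral>x. g x \<partial>M) - 0) < e"
    proof (intro exI[of _ N] allI impI)
      fix m assume "N \<le> m"
      then show "norm ((\<integral>x. g x * indicat_real (A m) x \<partial>M) - c * (\<integral>x. g x \<partial>M) - 0) < e"
        using N[of m] d1[of m] d2 k unfolding real_norm_def by linarith
    qed
  qed
  then show ?thesis using int_g by (simp add: mixes_def Lim_null[symmetric])
qed

text \<open>
  The sets whose indicator has the property form a Dynkin system, and the open sets are an
  intersection-stable generator.
\<close>

lemma mixes_indicator_borel:
  fixes M :: "'a::topological_space measure"
  assumes fin: "finite_measure M" and sets_M: "sets M = sets borel"
    and A: "\<And>m. A m \<in> sets M" and c: "0 \<le> c" "c \<le> 1"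
    and opn: "\<And>U. open U \<Longrightarrow> mixes M A c (indicat_real U)"
    and B: "B \<in> sets M"
  shows "mixes M A c (indicat_real B)"
proof -
  interpret finite_measure M by fact
  have B': "B \<in> sigma_sets UNIV {U::'a set. open U}"
    using B by (simp add: sets_M borel_def)
  have space_M: "space M = UNIV" using sets_eq_imp_space_eq[OF sets_M] by simp
  have int1: "integrable M (\<lambda>_. 1 :: real)" by simp
  have stable: "Int_stable {U::'a set. open U}" by (auto simp: Int_stable_def)
  have "{U::'a set. open U} \<subseteq> Pow UNIV" by simp
  from stable this B' show ?thesis
  proof (induction rule: sigma_sets_induct_disjoint)
    fix U :: "'a set" assume "U \<in> {U. open U}"
    then show "mixes M A c (indicat_real U)" using opn by simp
  next
    show "mixes M A c (indicat_real {})" using opn[of "{}"] by simp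
  next
    fix D :: "'a set" assume D: "mixes M A c (indicat_real D)"
    have "mixes M A c (\<lambda>x. indicat_real UNIV x + (-1) * indicat_real D x)"
      by (intro mixes_add[OF A] mixes_scale opn D) simp
    moreover have "(\<lambda>x. indicat_real UNIV x + (-1) * indicat_real D x) = indicat_real (UNIV - D)"
      by (auto simp: indicator_def)
    ultimately show "mixes M A c (indicat_real (UNIV - D))" by simp
  next
    fix D :: "nat \<Rightarrow> 'a set"
    assume disj: "disjoint_family D" and DB: "range D \<subseteq> sigma_sets UNIV {U. open U}"
      and D: "\<And>i. mixes M A c (indicat_real (D i))"
    have D_sets: "D i \<in> sets M" for i using DB by (auto simp: sets_M borel_def)
    have part: "mixes M A c (\<lambda>x. \<Sum>i<k. indicat_real (D i) x)" for k
    proof (induction k)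
      case 0
      have "(\<lambda>x. 0) = indicat_real ({} :: 'a set)" by auto
      then show ?case using opn[of "{}"] by simp
    next
      case (Suc k)
      then show ?case using mixes_add[OF A Suc D[of k]] by simp
    qed
    have lim: "(\<lambda>k. \<Sum>i<k. indicat_real (D i) x) \<longlonglongrightarrow> indicat_real (\<Union>i. D i) x" for x
    proof -
      have "(\<lambda>i. indicat_real (D i) x) sums indicat_real (\<Union>i. D i) x"
      proof (cases "\<exists>i. x \<in> D i")
        case True
        then obtain i where i: "x \<in> D i" by blast
        have "indicat_real (D j) x = (if j = i then 1 else 0)" for j
          using i disj by (auto simp: disjoint_family_on_def indicator_def)
        then show ?thesis using i sums_single[of i "\<lambda>_. 1::real"] by (auto simp: indicator_def)
      qed (auto simp: indicator_def)
      then show ?thesis by (simp add: sums_def)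
    qed
    have bd: "\<bar>\<Sum>i<k. indicat_real (D i) x\<bar> \<le> 1" for k x
    proof -
      have "(\<Sum>i<k. indicat_real (D i) x) \<le> indicat_real (\<Union>i. D i) x"
        by (rule incseq_le[OF _ lim]) (auto intro!: incseq_SucI)
      also have "\<dots> \<le> 1" by (simp add: indicator_def)
      finally show ?thesis by (simp add: sum_nonneg)
    qed
    show "mixes M A c (indicat_real (\<Union>i. D i))"
      by (rule mixes_limit[OF A c part _ lim int1]) (use D_sets bd in auto)
  qed
qed

lemma mixes_integrable:
  assumes A: "\<And>m. A m \<in> sets M" and c: "0 \<le> c" "c \<le> 1"
    and ind: "\<And>B. B \<in> sets M \<Longrightarrow> mixes M A c (indicat_real B)"
    and f: "integrable M (f :: 'a \<Rightarrow> real)"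
  shows "mixes M A c f"
  using f
proof (induction rule: integrable_induct)
  case (base B d)
  show ?case using mixes_scale[OF ind[OF base(1)], of d] by (simp add: mult.commute)
next
  case (add f g)
  then show ?case by (intro mixes_add A)
next
  case (lim f s)
  show ?case
  proof (rule mixes_limit[OF A c lim.IH _ lim.hyps(2)])
    show "integrable M (\<lambda>x. 2 * norm (f x))" using lim.hyps(4) by simp
    show "f \<in> borel_measurable M" using lim.hyps(4) by simp
  qed (use lim.hyps(3) in auto)
qed

context expanding_branches
begin

lemma measurable_funpow_T [measurable]: "(T ^^ m) \<in> borel_measurable borel"
  by (induction m) (auto intro: measurable_comp)

text \<open>
  The absolutely continuous invariant measure of \<open>T\<close>.
\<close>

definition acim :: "circle measure"
  where "acim = density m1 (\<lambda>x. ennreal (h (circle_coord x)))"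

lemma h_nonneg: "0 \<le> h t" and h_periodic: "h (t + 1) = h t" and h_pos: "0 < h t"
proof -
  show "0 \<le> h t" "h (t + 1) = h t" using h_cone by (simp_all add: cone_density_def)
  have "0 < exp (- (cone_const + 1))" by simp
  also have "\<dots> \<le> h t" using cone_density_bounds(1)[OF h_cone] cone_const_pos by simp
  finally show "0 < h t" .
qed

lemma h_measurable [measurable]: "h \<in> borel_measurable borel"
  using h_cone by (rule cone_density_measurable)

lemma h_coord: "h (circle_coord (circle_proj t)) = h t"
  by (simp add: circle_coord_proj periodic_frac h_periodic)

lemma sets_acim [simp, measurable_cong]: "sets acim = sets borel"
  by (simp add: acim_def)

lemma space_acim [simp]: "space acim = UNIV"
  by (simp add: acim_def)

lemma nn_integral_acim:
  assumes [measurable]: "f \<in> borel_measurable borel"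
  shows "(\<integral>\<^sup>+x. f x \<partial>acim) = (\<integral>\<^sup>+t. ennreal (h t) * f (circle_proj t) \<partial>unit_lborel)"
  unfolding acim_def by (subst nn_integral_density) (auto simp: nn_integral_m1 h_coord)

lemma prob_space_acim: "prob_space acim"
proof (rule prob_spaceI)
  have "emeasure acim (space acim) = (\<integral>\<^sup>+x. 1 \<partial>acim)" by simp
  also have "\<dots> = (\<integral>\<^sup>+t. ennreal (h t) \<partial>unit_lborel)" by (subst nn_integral_acim) auto
  also have "\<dots> = ennreal (\<integral>t. h t \<partial>unit_lborel)"
    using cone_density_integrable[OF h_cone] cone_const_pos h_nonneg
    by (intro nn_integral_eq_integral) auto
  finally show "emeasure acim (space acim) = 1" using h_cone by (simp add: cone_density_def)
qed

lemma integral_acim_indicator: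
  assumes [measurable]: "E \<in> sets borel"
  shows "(\<integral>t. h t * indicat_real E (circle_proj t) \<partial>unit_lborel) = measure acim E"
proof -
  have "emeasure acim E = (\<integral>\<^sup>+x. indicator E x \<partial>acim)" by simp
  also have "\<dots> = (\<integral>\<^sup>+t. ennreal (h t) * indicator E (circle_proj t) \<partial>unit_lborel)"
    by (rule nn_integral_acim) measurable
  also have "\<dots> = (\<integral>\<^sup>+t. ennreal (h t * indicat_real E (circle_proj t)) \<partial>unit_lborel)"
    by (intro nn_integral_cong) (auto simp: indicator_def)
  finally show ?thesis
    using h_nonneg by (subst integral_eq_nn_integral) (auto simp: measure_def intro!: borel_measurable_unit)
qed

lemma integral_m1:
  fixes f :: "circle \<Rightarrow> real"
  shows "f \<in> borel_measurable borel \<Longrightarrow> (\<integral>x. f x \<partial>m1) = (\<integral>t. f (circle_proj t) \<partial>unit_lborel)"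
  unfolding m1_def by (subst integral_distr) auto

text \<open>
  By duality the composition with \<open>T ^^ m\<close> moves to the density, whose iterates converge to \<open>h\<close>.
\<close>

lemma cone_density_mixes:
  assumes f: "cone_density a f" and E: "E \<in> sets borel"
  shows "(\<lambda>m. \<integral>t. f t * indicat_real E ((T ^^ m) (circle_proj t)) \<partial>unit_lborel) \<longlonglongrightarrow> measure acim E"
proof -
  define b where "b = max a (cone_const + 1)"
  have b: "cone_const < b" "0 \<le> b" using cone_const_pos by (simp_all add: b_def)
  have fb: "cone_density b f" by (rule cone_mono[OF f]) (simp add: b_def)
  note [measurable] = E cone_density_measurable[OF f]
  have fm: "cone_density b ((transfer ^^ m) f)" for m
    using fb b(1) by (rule cone_density_funpow)
  have "(\<lambda>m. \<integral>t. (transfer ^^ m) f t * indicat_real E (circle_proj t) \<partial>unit_lborel)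
      \<longlonglongrightarrow> (\<integral>t. h t * indicat_real E (circle_proj t) \<partial>unit_lborel)"
  proof (rule integral_dominated_convergence[where w="\<lambda>_. exp b"])
    show "(\<lambda>t. (transfer ^^ m) f t * indicat_real E (circle_proj t)) \<in> borel_measurable unit_lborel" for m
      using cone_density_measurable[OF fm[of m]] by (intro borel_measurable_unit borel_measurable_times) auto
    show "AE t in unit_lborel. norm ((transfer ^^ m) f t * indicat_real E (circle_proj t)) \<le> exp b" for m
      using cone_density_bounds(2)[OF fm[of m] b(2)] fm[of m]
      by (intro AE_I2) (auto simp: indicator_def cone_density_def)
    show "AE t in unit_lborel. (\<lambda>m. (transfer ^^ m) f t * indicat_real E (circle_proj t))
        \<longlonglongrightarrow> h t * indicat_real E (circle_proj t)"
      using funpow_transfer_tendsto_h[OF f] by (intro AE_I2 tendsto_mult_right)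
  qed (auto intro!: borel_measurable_unit)
  moreover have "(\<integral>t. f t * indicat_real E ((T ^^ m) (circle_proj t)) \<partial>unit_lborel)
      = (\<integral>t. (transfer ^^ m) f t * indicat_real E (circle_proj t) \<partial>unit_lborel)" for m
    using f by (intro transfer_duality) (auto simp: cone_density_def)
  ultimately show ?thesis by (simp add: integral_acim_indicator)
qed

text \<open>
  A nonnegative Lipschitz function becomes a multiple of a density with Lipschitz logarithm when 1 is added, and the
  constant 1 is itself such a density.
\<close>

lemma lipschitz_mixes:
  fixes g :: "circle \<Rightarrow> real"
  assumes g: "\<And>x. 0 \<le> g x" and L: "0 \<le> L"
    and lip: "\<And>s t. \<bar>g (circle_proj s) - g (circle_proj t)\<bar> \<le> L * \<bar>s - t\<bar>"
    and [measurable]: "g \<in> borel_measurable borel" and E: "E \<in> sets borel"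
  shows "mixes m1 (\<lambda>m. (T ^^ m) -` E) (measure acim E) g"
proof -
  \<comment> \<open>As f is at least 1, an additive Lipschitz bound is also a multiplicative one.\<close>
  define f where "f t = g (circle_proj t) + 1" for t
  have f_nn: "0 \<le> f t" for t using g by (simp add: f_def)
  have f_per: "f (t + 1) = f t" for t
    by (simp add: f_def) (metis Ints_1 add_diff_cancel_left' circle_proj_eq_iff)
  have f_lip: "f s \<le> f t * exp (L * \<bar>s - t\<bar>)" for s t
  proof -
    have "f s \<le> f t + L * \<bar>s - t\<bar>" using lip[of s t] by (simp add: f_def)
    also have "\<dots> \<le> f t * (1 + L * \<bar>s - t\<bar>)"
      using g[of "circle_proj t"] L by (simp add: f_def algebra_simps)
    also have "\<dots> \<le> f t * exp (L * \<bar>s - t\<bar>)"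
      by (intro mult_left_mono exp_ge_add_one_self f_nn)
    finally show ?thesis .
  qed
  have f_int: "integrable unit_lborel f" using L f_nn f_lip by (rule log_lipschitz_integrable)
  define c where "c = (\<integral>t. f t \<partial>unit_lborel)"
  have c: "1 \<le> c" unfolding c_def
    by (rule unit_integral_ge[OF f_int]) (use g in \<open>simp add: f_def\<close>)
  have cone: "cone_density L (\<lambda>t. f t / c)"
    using f_nn f_per f_lip c by (auto simp: cone_density_def c_def[symmetric] divide_right_mono)
  have g_int: "integrable m1 g"
    unfolding m1_def using f_int by (subst integrable_distr_eq) (auto simp: f_def[abs_def] dest: Bochner_Integration.integrable_diff[where g="\<lambda>_. 1"])
  have c_eq: "c = (\<integral>x. g x \<partial>m1) + 1"
  proof -
    have "(\<integral>x. g x \<partial>m1) = (\<integral>t. f t - 1 \<partial>unit_lborel)"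
      by (subst integral_m1) (auto simp: f_def)
    also have "\<dots> = c - 1" using f_int by (simp add: c_def)
    finally show ?thesis by simp
  qed
  have preE: "(T ^^ m) -` E \<in> sets borel" for m
    using measurable_sets[OF measurable_funpow_T E] by simp
  have eq: "(\<integral>x. g x * indicat_real ((T ^^ m) -` E) x \<partial>m1)
    = c * (\<integral>t. f t / c * indicat_real E ((T ^^ m) (circle_proj t)) \<partial>unit_lborel)
      - (\<integral>t. 1 * indicat_real E ((T ^^ m) (circle_proj t)) \<partial>unit_lborel)" for m
  proof -
    have ind: "integrable unit_lborel (\<lambda>t. indicat_real E ((T ^^ m) (circle_proj t)))"
      using E by (intro integrable_unit_bounded[where B=1]) (auto simp: indicator_def)
    have find: "integrable unit_lborel (\<lambda>t. f t * indicat_real E ((T ^^ m) (circle_proj t)))"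
      by (rule Bochner_Integration.integrable_bound[OF f_int])
        (use E f_nn in \<open>auto intro!: AE_I2 borel_measurable_unit simp: indicator_def f_def\<close>)
    have "(\<integral>x. g x * indicat_real ((T ^^ m) -` E) x \<partial>m1)
       = (\<integral>t. g (circle_proj t) * indicat_real E ((T ^^ m) (circle_proj t)) \<partial>unit_lborel)"
    proof (subst integral_m1)
      show "(\<lambda>x. g x * indicat_real ((T ^^ m) -` E) x) \<in> borel_measurable borel"
        using preE[of m] by (intro borel_measurable_times borel_measurable_indicator) auto
    qed (simp add: indicator_def)
    also have "\<dots> = (\<integral>t. f t * indicat_real E ((T ^^ m) (circle_proj t))
        - 1 * indicat_real E ((T ^^ m) (circle_proj t)) \<partial>unit_lborel)"
      by (simp add: f_def algebra_simps)
    also have "\<dots> = (\<integral>t. f t * indicat_real E ((T ^^ m) (circle_proj t)) \<partial>unit_lborel)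
        - (\<integral>t. 1 * indicat_real E ((T ^^ m) (circle_proj t)) \<partial>unit_lborel)"
      using ind find by simp
    finally show ?thesis using c by simp
  qed
  have "(\<lambda>m. c * (\<integral>t. f t / c * indicat_real E ((T ^^ m) (circle_proj t)) \<partial>unit_lborel)
      - (\<integral>t. 1 * indicat_real E ((T ^^ m) (circle_proj t)) \<partial>unit_lborel))
      \<longlonglongrightarrow> c * measure acim E - measure acim E"
    by (intro tendsto_diff tendsto_mult_left cone_density_mixes[OF cone E]
      cone_density_mixes[OF cone_density_one[of 0] E]) simp
  moreover have "c * measure acim E - measure acim E = measure acim E * (\<integral>x. g x \<partial>m1)"
    by (simp add: c_eq algebra_simps)
  ultimately show ?thesis using g_int by (simp add: mixes_def eq)
qed

lemma acim_mixing:
  assumes E: "E \<in> sets borel" and f: "integrable m1 (f :: circle \<Rightarrow> real)"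
  shows "mixes m1 (\<lambda>m. (T ^^ m) -` E) (measure acim E) f"
proof -
  interpret acim: prob_space acim by (rule prob_space_acim)
  interpret m1: prob_space m1 by (rule prob_space_m1)
  have preE: "(T ^^ m) -` E \<in> sets m1" for m
    using measurable_sets[OF measurable_funpow_T E] by simp
  have c: "0 \<le> measure acim E" "measure acim E \<le> 1" by simp_all
  have opn: "mixes m1 (\<lambda>m. (T ^^ m) -` E) (measure acim E) (indicat_real U)" if U: "open U" for U
  proof -
    \<comment> \<open>The circle carries no metric, so the bumps are taken on the real line, for a periodic open set.\<close>
    define V where "V = circle_proj -` U"
    have V: "open V" using U by (simp add: V_def open_circle_def)
    have V_per: "t + 1 \<in> V \<longleftrightarrow> t \<in> V" for t
    proof -
      have "circle_proj (t + 1) = circle_proj t" by (simp add: circle_proj_eq_iff)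
      then show ?thesis by (simp add: V_def)
    qed
    define g where "g k x = open_bump k V (circle_coord x)" for k x
    have g_proj: "g k (circle_proj t) = open_bump k V t" for k t
      by (simp add: g_def circle_coord_proj periodic_frac open_bump_periodic V_per)
    show ?thesis
    proof (rule mixes_limit[where f=g and w="\<lambda>_. 1"])
      show "mixes m1 (\<lambda>m. (T ^^ m) -` E) (measure acim E) (g k)" for k
      proof (rule lipschitz_mixes[where L="real k"])
        show "\<bar>g k (circle_proj s) - g k (circle_proj t)\<bar> \<le> real k * \<bar>s - t\<bar>" for s t
          using open_bump_lipschitz[of k V s t] by (simp add: g_proj dist_real_def)
        show "g k \<in> borel_measurable borel" unfolding g_def by measurable
      qed (use E in \<open>auto simp: g_def open_bump_range\<close>)
      show "(\<lambda>k. g k x) \<longlonglongrightarrow> indicat_real U x" for x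
        using open_bump_tendsto[OF V, of "circle_coord x"] by (simp add: g_def V_def indicator_def)
      show "\<bar>g k x\<bar> \<le> 1" for k x
        by (simp add: g_def open_bump_range)
      show "indicat_real U \<in> borel_measurable m1"
        using U by (intro borel_measurable_indicator) simp
    qed (use preE c in auto)
  qed
  have "mixes m1 (\<lambda>m. (T ^^ m) -` E) (measure acim E) (indicat_real B)" if "B \<in> sets m1" for B
    by (rule mixes_indicator_borel[OF _ sets_m1 preE c opn that]) unfold_locales
  then show ?thesis by (rule mixes_integrable[OF preE c _ f])
qed

text \<open>
  If \<open>D\<close> is the density of an invariant measure \<open>N\<close>, then the integral of \<open>D\<close> over the preimage of \<open>E\<close> under
  \<open>T ^^ m\<close> is \<open>N E\<close> for every \<open>m\<close>, while mixing makes it converge to \<open>acim E\<close>.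
\<close>

theorem acim_unique:
  assumes N: "prob_space N" and sets_N: "sets N = sets borel" and ac: "absolutely_continuous m1 N"
    and inv: "distr N borel T = N"
  shows "N = acim"
proof (rule measure_eqI)
  interpret N: prob_space N by fact
  interpret acim: prob_space acim by (rule prob_space_acim)
  interpret m1: prob_space m1 by (rule prob_space_m1)
  show "sets N = sets acim" using sets_N by simp
  have space_N: "space N = UNIV" using sets_eq_imp_space_eq[OF sets_N] by simp
  have sets_N': "sets N = sets m1" using sets_N by simp
  obtain D where D: "D \<in> borel_measurable m1" "AE x in m1. RN_deriv m1 N x = ennreal (D x)"
    "AE x in N. 0 < D x" "\<And>x. 0 \<le> D x"
    using m1.real_RN_deriv[OF N.finite_measure_axioms ac sets_N'] by metis
  have [measurable]: "D \<in> borel_measurable borel" using D(1) by simp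
  have N_eq: "N = density m1 (\<lambda>x. ennreal (D x))"
  proof -
    have "N = density m1 (RN_deriv m1 N)"
      using m1.density_RN_deriv[OF ac] sets_N by simp
    also have "\<dots> = density m1 (\<lambda>x. ennreal (D x))"
      using D by (intro density_cong) auto
    finally show ?thesis .
  qed
  have meas_N: "measure N E = (\<integral>x. D x * indicat_real E x \<partial>m1)" if [measurable]: "E \<in> sets borel" for E
  proof -
    have "measure N E = (\<integral>x. indicat_real E x \<partial>N)" by (simp add: space_N)
    also have "\<dots> = (\<integral>x. D x * indicat_real E x \<partial>m1)"
      unfolding N_eq using D(4) by (subst integral_density) auto
    finally show ?thesis .
  qed
  have "integrable N (\<lambda>_. 1 :: real)" by simp
  then have D_int: "integrable m1 D"
    unfolding N_eq using D(4) by (subst (asm) integrable_density) auto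
  have D_one: "(\<integral>x. D x \<partial>m1) = 1"
    using meas_N[of UNIV] N.prob_space by (simp add: space_N)
  fix E assume "E \<in> sets N"
  then have E: "E \<in> sets borel" using sets_N by simp
  have T_N: "T \<in> measurable N borel"
    using T_measurable measurable_cong_sets[OF sets_N refl, of borel] by blast
  have inv_m: "measure N ((T ^^ m) -` E) = measure N E" for m
  proof (induction m)
    case (Suc m)
    have preE: "(T ^^ m) -` E \<in> sets borel"
      using measurable_sets[OF measurable_funpow_T E] by simp
    have "measure N ((T ^^ Suc m) -` E) = measure N (T -` ((T ^^ m) -` E) \<inter> space N)"
      unfolding funpow_Suc_right by (simp add: vimage_comp space_N)
    also have "\<dots> = measure (distr N borel T) ((T ^^ m) -` E)"
      by (rule measure_distr[OF T_N preE, symmetric])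
    finally show ?case unfolding inv Suc .
  qed simp
  have "(\<lambda>m. \<integral>x. D x * indicat_real ((T ^^ m) -` E) x \<partial>m1) \<longlonglongrightarrow> measure acim E * (\<integral>x. D x \<partial>m1)"
    using acim_mixing[OF E D_int] by (simp add: mixes_def)
  moreover have "(\<integral>x. D x * indicat_real ((T ^^ m) -` E) x \<partial>m1) = measure N E" for m
    using meas_N[of "(T ^^ m) -` E"] measurable_sets[OF measurable_funpow_T E, of m] by (simp add: inv_m)
  ultimately have "measure N E = measure acim E" by (simp add: D_one LIMSEQ_const_iff)
  then show "emeasure N E = emeasure acim E"
    by (simp add: N.emeasure_eq_measure acim.emeasure_eq_measure)
qed

end

section \<open>Random backward orbits and their limits in the fibre\<close>

interpretation noise: sequence_space unit_lborel
  by unfold_locales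

abbreviation noise :: "(nat \<Rightarrow> real) measure"
  where "noise \<equiv> \<Pi>\<^sub>M i\<in>UNIV::nat set. unit_lborel"

context expanding_branches
begin

text \<open>
  The conditional probability of the preimage \<open>branch k s\<close> given its image \<open>s\<close>, under the invariant
  measure with density \<open>h\<close>.
\<close>

definition weight :: "nat \<Rightarrow> real \<Rightarrow> real"
  where "weight k s = h (branch k s) * jac k s / h s"

definition cut :: "nat \<Rightarrow> real \<Rightarrow> real"
  where "cut k s = (\<Sum>i<k. weight i s)"

text \<open>
  The unit interval is cut into consecutive pieces of length \<open>weight k\<close>, and the piece that contains
  the uniform variable \<open>u\<close> selects the branch. Writing the selection as a sum of indicators gives
  joint measurability in \<open>x\<close> and \<open>u\<close>.
\<close>

definition random_preimage :: "circle \<Rightarrow> real \<Rightarrow> circle"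
  where "random_preimage x u = circle_proj (\<Sum>k<n. branch k (circle_coord x) *
    indicat_real {cut k (circle_coord x)..<cut (Suc k) (circle_coord x)} u)"

lemma weight_nonneg: "0 \<le> weight k s"
  unfolding weight_def using h_nonneg jac_pos by (simp add: less_imp_le)

lemma cut_0 [simp]: "cut 0 s = 0"
  by (simp add: cut_def)

lemma cut_Suc: "cut (Suc k) s = cut k s + weight k s"
  by (simp add: cut_def)

lemma cut_n: "cut n s = 1"
proof -
  have "cut n s = transfer h s / h s" by (simp add: cut_def weight_def transfer_def sum_divide_distrib)
  then show ?thesis using h_pos[of s] by (simp add: transfer_h)
qed

lemma cut_mono: "j \<le> k \<Longrightarrow> cut j s \<le> cut k s"
  using lift_Suc_mono_le[of "\<lambda>k. cut k s" j k] by (simp add: cut_Suc weight_nonneg)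

lemma measurable_weight [measurable]: "weight k \<in> borel_measurable borel"
  unfolding weight_def by measurable

lemma measurable_cut [measurable]: "cut k \<in> borel_measurable borel"
  unfolding cut_def by measurable

lemma measurable_random_preimage [measurable]:
  "(\<lambda>(x, u). random_preimage x u) \<in> borel_measurable (borel \<Otimes>\<^sub>M borel)"
proof -
  have "(\<lambda>(x, u). \<Sum>k<n. branch k (circle_coord x) *
      indicat_real {cut k (circle_coord x)..<cut (Suc k) (circle_coord x)} u)
      \<in> borel_measurable (borel \<Otimes>\<^sub>M borel)"
    unfolding indicator_def atLeastLessThan_iff by measurable
  from measurable_compose[OF this measurable_circle_proj]
  show ?thesis by (simp add: random_preimage_def case_prod_beta)
qed

lemma cut_interval:
  assumes u: "u \<in> {0..<1}"
  shows "\<exists>k<n. \<forall>j<n. u \<in> {cut j s..<cut (Suc j) s} \<longleftrightarrow> j = k"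
proof -
  \<comment> \<open>The last cut point is 1, so some cut point exceeds u.\<close>
  define k where "k = (LEAST j. u < cut (Suc j) s)"
  obtain m where m: "n = Suc m" using n_pos gr0_implies_Suc by blast
  have ex: "u < cut (Suc m) s" using u cut_n[of s] by (simp add: m)
  have k1: "u < cut (Suc k) s" unfolding k_def using ex by (rule LeastI)
  have k2: "k \<le> m" unfolding k_def using ex by (rule Least_le)
  have k3: "cut k s \<le> u"
  proof (cases k)
    case 0 then show ?thesis using u by simp
  next
    case (Suc i)
    then have "\<not> u < cut (Suc i) s" unfolding k_def by (intro not_less_Least) simp
    then show ?thesis using Suc by simp
  qed
  have "j = k" if "cut j s \<le> u" "u < cut (Suc j) s" for j
  proof (rule ccontr)
    assume "j \<noteq> k"
    then consider "Suc j \<le> k" | "Suc k \<le> j" by linarith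
    then show False
    proof cases
      case 1 then show False using cut_mono[OF 1, of s] k3 that by linarith
    next
      case 2 then show False using cut_mono[OF 2, of s] k1 that by linarith
    qed
  qed
  then have "\<forall>j<n. u \<in> {cut j s..<cut (Suc j) s} \<longleftrightarrow> j = k"
    unfolding atLeastLessThan_iff using k1 k3 by blast
  moreover have "k < n" using k2 by (simp add: m)
  ultimately show ?thesis by blast
qed

lemma nn_integral_random_preimage:
  fixes \<psi> :: "circle \<Rightarrow> ennreal"
  assumes [measurable]: "\<psi> \<in> borel_measurable borel"
  shows "(\<integral>\<^sup>+u. \<psi> (random_preimage x u) \<partial>unit_lborel)
    = (\<Sum>k<n. ennreal (weight k (circle_coord x)) * \<psi> (circle_proj (branch k (circle_coord x))))"
proof -
  let ?s = "circle_coord x"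
  have "(\<integral>\<^sup>+u. \<psi> (random_preimage x u) \<partial>unit_lborel)
    = (\<integral>\<^sup>+u. (\<Sum>k<n. \<psi> (circle_proj (branch k ?s)) * indicator {cut k ?s..<cut (Suc k) ?s} u) \<partial>unit_lborel)"
  proof (intro nn_integral_cong)
    fix u assume "u \<in> space unit_lborel"
    then have "u \<in> {0..<1}" by (simp add: space_restrict_space)
    then obtain k where k: "k < n" "\<forall>j<n. u \<in> {cut j ?s..<cut (Suc j) ?s} \<longleftrightarrow> j = k"
      using cut_interval by blast
    have 1: "(\<Sum>j<n. branch j ?s * indicat_real {cut j ?s..<cut (Suc j) ?s} u) = branch k ?s"
    proof -
      have "(\<Sum>j<n. branch j ?s * indicat_real {cut j ?s..<cut (Suc j) ?s} u)
         = (\<Sum>j<n. if j = k then branch j ?s else 0)"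
        using k by (intro sum.cong refl) (simp add: indicator_def)
      then show ?thesis using k(1) by simp
    qed
    have 2: "(\<Sum>j<n. \<psi> (circle_proj (branch j ?s)) * indicator {cut j ?s..<cut (Suc j) ?s} u)
        = \<psi> (circle_proj (branch k ?s))"
    proof -
      have "(\<Sum>j<n. \<psi> (circle_proj (branch j ?s)) * indicator {cut j ?s..<cut (Suc j) ?s} u)
         = (\<Sum>j<n. if j = k then \<psi> (circle_proj (branch j ?s)) else 0)"
        using k by (intro sum.cong refl) (simp add: indicator_def)
      then show ?thesis using k(1) by simp
    qed
    show "\<psi> (random_preimage x u)
      = (\<Sum>j<n. \<psi> (circle_proj (branch j ?s)) * indicator {cut j ?s..<cut (Suc j) ?s} u)"
      unfolding random_preimage_def 1 2 ..
  qed
  also have "\<dots> = (\<Sum>k<n. \<integral>\<^sup>+u. \<psi> (circle_proj (branch k ?s)) * indicator {cut k ?s..<cut (Suc k) ?s} u \<partial>unit_lborel)"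
    by (intro nn_integral_sum borel_measurable_unit) measurable
  also have "\<dots> = (\<Sum>k<n. ennreal (weight k ?s) * \<psi> (circle_proj (branch k ?s)))"
  proof (intro sum.cong refl)
    fix k assume "k \<in> {..<n}"
    then have le: "cut (Suc k) ?s \<le> 1" using cut_mono[of "Suc k" n ?s] cut_n by simp
    have ge: "0 \<le> cut k ?s" using cut_mono[of 0 k ?s] by simp
    have "(\<integral>\<^sup>+u. \<psi> (circle_proj (branch k ?s)) * indicator {cut k ?s..<cut (Suc k) ?s} u \<partial>unit_lborel)
      = (\<integral>\<^sup>+u. \<psi> (circle_proj (branch k ?s)) * indicator {cut k ?s..<cut (Suc k) ?s} u \<partial>lborel)"
      unfolding nn_integral_unit using le ge by (intro nn_integral_cong) (auto simp: indicator_def)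
    also have "\<dots> = \<psi> (circle_proj (branch k ?s)) * ennreal (weight k ?s)"
      using weight_nonneg[of k ?s] by (subst nn_integral_cmult_indicator) (auto simp: cut_Suc)
    finally show "(\<integral>\<^sup>+u. \<psi> (circle_proj (branch k ?s)) * indicator {cut k ?s..<cut (Suc k) ?s} u \<partial>unit_lborel)
      = ennreal (weight k ?s) * \<psi> (circle_proj (branch k ?s))" by (simp add: mult.commute)
  qed
  finally show ?thesis .
qed

lemma measurable_random_preimage_unit [measurable (raw)]:
  assumes "f \<in> borel_measurable M" "g \<in> measurable M unit_lborel"
  shows "(\<lambda>z. random_preimage (f z) (g z)) \<in> borel_measurable M"
proof -
  have "g \<in> borel_measurable M"
    using assms(2) by (rule measurable_compose) (rule borel_measurable_unit, simp)
  then have "(\<lambda>z. (f z, g z)) \<in> measurable M (borel \<Otimes>\<^sub>M borel)" using assms(1) by measurable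
  from measurable_compose[OF this measurable_random_preimage] show ?thesis by simp
qed

text \<open>
  If \<open>x\<close> has law \<open>acim\<close> and \<open>z\<close> is its random preimage, then \<open>(x, z)\<close> has the law of \<open>(T z, z)\<close> with
  \<open>z\<close> distributed by \<open>acim\<close>. In coordinates, \<open>h s * weight k s\<close> is the \<open>k\<close>-th summand of the
  transfer operator at \<open>h\<close>, so this is the invariance of the integral under that operator.
\<close>

lemma random_preimage_reverses_T:
  fixes \<phi> :: "circle \<times> circle \<Rightarrow> ennreal"
  assumes [measurable]: "\<phi> \<in> borel_measurable (borel \<Otimes>\<^sub>M borel)"
  shows "(\<integral>\<^sup>+x. \<integral>\<^sup>+u. \<phi> (x, random_preimage x u) \<partial>unit_lborel \<partial>acim) = (\<integral>\<^sup>+z. \<phi> (T z, z) \<partial>acim)"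
proof -
  define f where "f t = ennreal (h t) * \<phi> (T (circle_proj t), circle_proj t)" for t
  have f_meas: "f \<in> borel_measurable borel" unfolding f_def by measurable
  have f_per: "f (t + 1) = f t" for t
  proof -
    have "circle_proj (t + 1) = circle_proj t" by (simp add: circle_proj_eq_iff)
    then show ?thesis by (simp add: f_def h_periodic)
  qed
  have meas: "(\<lambda>x. \<integral>\<^sup>+u. \<phi> (x, random_preimage x u) \<partial>unit_lborel) \<in> borel_measurable borel"
    by measurable
  have "(\<integral>\<^sup>+x. \<integral>\<^sup>+u. \<phi> (x, random_preimage x u) \<partial>unit_lborel \<partial>acim)
    = (\<integral>\<^sup>+t. ennreal (h t) * (\<integral>\<^sup>+u. \<phi> (circle_proj t, random_preimage (circle_proj t) u) \<partial>unit_lborel) \<partial>unit_lborel)"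
    by (rule nn_integral_acim[OF meas])
  also have "\<dots> = (\<integral>\<^sup>+t. (\<Sum>k<n. f (branch k t) * ennreal (jac k t)) \<partial>unit_lborel)"
  proof (intro nn_integral_cong)
    fix t assume "t \<in> space unit_lborel"
    then have t: "circle_coord (circle_proj t) = t"
      by (simp add: space_restrict_space circle_coord_proj_id)
    have "ennreal (h t) * (\<integral>\<^sup>+u. \<phi> (circle_proj t, random_preimage (circle_proj t) u) \<partial>unit_lborel)
      = ennreal (h t) * (\<Sum>k<n. ennreal (weight k t) * \<phi> (circle_proj t, circle_proj (branch k t)))"
      by (subst nn_integral_random_preimage) (simp_all add: t)
    also have "\<dots> = (\<Sum>k<n. f (branch k t) * ennreal (jac k t))"
      unfolding sum_distrib_left
    proof (intro sum.cong refl)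
      fix k
      have "h t * weight k t = h (branch k t) * jac k t" using h_pos[of t] by (simp add: weight_def)
      then have "ennreal (h t) * ennreal (weight k t) = ennreal (h (branch k t)) * ennreal (jac k t)"
        using h_nonneg jac_pos weight_nonneg by (simp add: less_imp_le flip: ennreal_mult)
      then show "ennreal (h t) * (ennreal (weight k t) * \<phi> (circle_proj t, circle_proj (branch k t)))
        = f (branch k t) * ennreal (jac k t)"
        by (simp add: f_def T_branch mult.assoc[symmetric]) (simp add: ac_simps)
    qed
    finally show "ennreal (h t) * (\<integral>\<^sup>+u. \<phi> (circle_proj t, random_preimage (circle_proj t) u) \<partial>unit_lborel)
      = (\<Sum>k<n. f (branch k t) * ennreal (jac k t))" .
  qed
  also have "\<dots> = (\<integral>\<^sup>+t. f t \<partial>unit_lborel)" by (rule nn_integral_transfer[OF f_meas f_per])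
  also have "\<dots> = (\<integral>\<^sup>+z. \<phi> (T z, z) \<partial>acim)"
    unfolding f_def by (subst nn_integral_acim) auto
  finally show ?thesis .
qed

end

locale contracting_skew_product = expanding_branches +
  fixes G :: "circle \<times> (real ^ 2) \<Rightarrow> real ^ 2" and \<alpha> :: real
  assumes G_measurable: "(\<lambda>p. if snd p \<in> disc then G p else 0) \<in> borel_measurable borel"
    and G_disc: "y \<in> disc \<Longrightarrow> G (x, y) \<in> disc"
    and G_contraction: "y1 \<in> disc \<Longrightarrow> y2 \<in> disc \<Longrightarrow> norm (G (x, y1) - G (x, y2)) \<le> \<alpha> * norm (y1 - y2)"
    and alpha: "0 \<le> \<alpha>" "\<alpha> < 1"
begin

text \<open>
  The values of \<open>G\<close> outside the disc are arbitrary; replacing them by 0 gives a map that is Borel and takes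
  values in the disc everywhere.
\<close>

definition Gd :: "circle \<times> (real ^ 2) \<Rightarrow> real ^ 2"
  where "Gd p = (if snd p \<in> disc then G p else 0)"

lemma measurable_Gd [measurable]: "Gd \<in> borel_measurable borel"
  using G_measurable by (simp add: Gd_def[abs_def])

lemma measurable_Gd_pair [measurable (raw)]:
  assumes [measurable]: "f \<in> borel_measurable M" "g \<in> borel_measurable M"
  shows "(\<lambda>z. Gd (f z, g z)) \<in> borel_measurable M"
  by measurable

lemma Gd_disc: "Gd p \<in> disc"
  using G_disc[of "snd p" "fst p"] by (auto simp: Gd_def)

lemma Gd_contraction: "y1 \<in> disc \<Longrightarrow> y2 \<in> disc \<Longrightarrow> norm (Gd (x, y1) - Gd (x, y2)) \<le> \<alpha> * norm (y1 - y2)"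
  using G_contraction by (simp add: Gd_def)

text \<open>
  The backward orbit of \<open>x\<close> driven by \<open>\<omega>\<close> is followed for \<open>m\<close> steps into the past; the centre of the fibre
  there is pushed forward to the fibre over \<open>x\<close>. The recursion peels off the most
  recent step, so that \<open>fibre_limit_eq\<close> has the form needed for invariance.
\<close>

primrec fibre_approx :: "nat \<Rightarrow> circle \<Rightarrow> (nat \<Rightarrow> real) \<Rightarrow> real ^ 2"
  where "fibre_approx 0 x \<omega> = 0"
  | "fibre_approx (Suc m) x \<omega> =
      Gd (random_preimage x (\<omega> 0), fibre_approx m (random_preimage x (\<omega> 0)) (\<lambda>i. \<omega> (Suc i)))"

definition fibre_limit :: "circle \<Rightarrow> (nat \<Rightarrow> real) \<Rightarrow> real ^ 2"
  where "fibre_limit x \<omega> = lim (\<lambda>m. fibre_approx m x \<omega>)"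

lemma fibre_approx_disc: "fibre_approx m x \<omega> \<in> disc"
proof (cases m)
  case (Suc k)
  then show ?thesis using Gd_disc by (simp del: mem_cball)
qed simp

text \<open>
  Two consecutive approximations start from two points of the disc in the fibre \<open>m\<close> steps in the past, at distance at most 1
  since one of them is the centre, and are pushed forward by the same \<open>m\<close> contractions.
\<close>

lemma fibre_approx_step: "norm (fibre_approx (Suc m) x \<omega> - fibre_approx m x \<omega>) \<le> \<alpha> ^ m"
proof (induction m arbitrary: x \<omega>)
  case 0
  show ?case using fibre_approx_disc[of "Suc 0" x \<omega>] by simp
next
  case (Suc m)
  let ?z = "random_preimage x (\<omega> 0)" and ?\<omega> = "\<lambda>i. \<omega> (Suc i)"
  have "norm (fibre_approx (Suc (Suc m)) x \<omega> - fibre_approx (Suc m) x \<omega>)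
      = norm (Gd (?z, fibre_approx (Suc m) ?z ?\<omega>) - Gd (?z, fibre_approx m ?z ?\<omega>))"
    by simp
  also have "\<dots> \<le> \<alpha> * norm (fibre_approx (Suc m) ?z ?\<omega> - fibre_approx m ?z ?\<omega>)"
    by (intro Gd_contraction fibre_approx_disc)
  also have "\<dots> \<le> \<alpha> * \<alpha> ^ m" by (intro mult_left_mono Suc alpha)
  finally show ?case by simp
qed

lemma fibre_approx_tendsto: "(\<lambda>m. fibre_approx m x \<omega>) \<longlonglongrightarrow> fibre_limit x \<omega>"
  unfolding fibre_limit_def convergent_LIMSEQ_iff[symmetric]
  by (rule convergent_geometric[of \<alpha> _ 1]) (use alpha fibre_approx_step in auto)

lemma fibre_limit_disc: "fibre_limit x \<omega> \<in> disc"
  by (rule closed_sequentially[OF closed_cball fibre_approx_disc fibre_approx_tendsto])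

text \<open>
  The limit over \<open>x\<close> is the image under \<open>G\<close> of the limit over the first random preimage, computed from the
  remaining noise.
\<close>

lemma fibre_limit_eq:
  "fibre_limit x \<omega> =
    Gd (random_preimage x (\<omega> 0), fibre_limit (random_preimage x (\<omega> 0)) (\<lambda>i. \<omega> (Suc i)))"
proof (rule LIMSEQ_unique[OF LIMSEQ_Suc[OF fibre_approx_tendsto]])
  let ?z = "random_preimage x (\<omega> 0)" and ?\<omega> = "\<lambda>i. \<omega> (Suc i)"
  have "(\<lambda>m. fibre_approx (Suc m) x \<omega> - Gd (?z, fibre_limit ?z ?\<omega>)) \<longlonglongrightarrow> 0"
  proof (rule Lim_null_comparison)
    show "\<forall>\<^sub>F m in sequentially. norm (fibre_approx (Suc m) x \<omega> - Gd (?z, fibre_limit ?z ?\<omega>))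
        \<le> \<alpha> * norm (fibre_approx m ?z ?\<omega> - fibre_limit ?z ?\<omega>)"
      using Gd_contraction[OF fibre_approx_disc fibre_limit_disc] by simp
    have "(\<lambda>m. \<alpha> * norm (fibre_approx m ?z ?\<omega> - fibre_limit ?z ?\<omega>))
        \<longlonglongrightarrow> \<alpha> * norm (fibre_limit ?z ?\<omega> - fibre_limit ?z ?\<omega>)"
      by (intro tendsto_intros fibre_approx_tendsto)
    then show "(\<lambda>m. \<alpha> * norm (fibre_approx m ?z ?\<omega> - fibre_limit ?z ?\<omega>)) \<longlonglongrightarrow> 0" by simp
  qed
  then show "(\<lambda>m. fibre_approx (Suc m) x \<omega>) \<longlonglongrightarrow> Gd (?z, fibre_limit ?z ?\<omega>)"
    by (rule Lim_null[THEN iffD2])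
qed

lemma measurable_fibre_approx: "(\<lambda>(x, \<omega>). fibre_approx m x \<omega>) \<in> borel_measurable (borel \<Otimes>\<^sub>M noise)"
proof (induction m)
  case (Suc m)
  have pre: "(\<lambda>z. random_preimage (fst z) (snd z 0)) \<in> borel_measurable (borel \<Otimes>\<^sub>M noise)"
    by measurable
  have shift: "(\<lambda>z i. snd z (Suc i)) \<in> measurable (borel \<Otimes>\<^sub>M noise) noise"
    by (intro measurable_abs_UNIV) measurable
  have "(\<lambda>z. (random_preimage (fst z) (snd z 0), \<lambda>i. snd z (Suc i)))
      \<in> measurable (borel \<Otimes>\<^sub>M noise) (borel \<Otimes>\<^sub>M noise)"
    using pre shift by (rule measurable_Pair)
  from measurable_compose[OF this Suc]
  have "(\<lambda>z. fibre_approx m (random_preimage (fst z) (snd z 0)) (\<lambda>i. snd z (Suc i)))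
      \<in> borel_measurable (borel \<Otimes>\<^sub>M noise)" by simp
  from measurable_Gd_pair[OF pre this] show ?case by (simp add: case_prod_beta)
qed simp

lemma measurable_fibre_limit_pair:
  "(\<lambda>z. fibre_limit (fst z) (snd z)) \<in> borel_measurable (borel \<Otimes>\<^sub>M noise)"
proof (rule borel_measurable_LIMSEQ_metric)
  show "(\<lambda>z. fibre_approx m (fst z) (snd z)) \<in> borel_measurable (borel \<Otimes>\<^sub>M noise)" for m
    using measurable_fibre_approx[of m] by (simp add: case_prod_beta)
qed (rule fibre_approx_tendsto)

lemma measurable_fibre_limit [measurable (raw)]:
  assumes "f \<in> borel_measurable M" "g \<in> measurable M noise"
  shows "(\<lambda>z. fibre_limit (f z) (g z)) \<in> borel_measurable M"
proof -
  have "(\<lambda>z. (f z, g z)) \<in> measurable M (borel \<Otimes>\<^sub>M noise)" using assms by (rule measurable_Pair)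
  from measurable_compose[OF this measurable_fibre_limit_pair] show ?thesis by simp
qed

end

section \<open>The invariant measure and its disintegration\<close>

lemma space_torus_borel [simp]: "space torus_borel = solid_torus"
  by (simp add: torus_borel_def space_restrict_space)

lemma solid_torus_borel [measurable]: "solid_torus \<in> sets borel"
  by (intro borel_closed closed_Times) auto

lemma sets_torus_borel_iff: "E \<in> sets torus_borel \<longleftrightarrow> E \<in> sets borel \<and> E \<subseteq> solid_torus"
  unfolding torus_borel_def using solid_torus_borel by (subst sets_restrict_space_iff) auto

lemma measurable_torus_borel:
  assumes "sets M = sets torus_borel" and f: "f \<in> measurable borel N"
  shows "f \<in> measurable M N"
  unfolding measurable_cong_sets[OF assms(1) refl] torus_borel_def
  by (rule measurable_restrict_space1[OF f])

lemma measurable_fst_borel: "fst \<in> measurable (borel :: ('a::topological_space \<times> 'b::topological_space) measure) borel"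
  by (intro borel_measurable_continuous_onI continuous_intros)

lemma measurable_snd_borel: "snd \<in> measurable (borel :: ('a::topological_space \<times> 'b::topological_space) measure) borel"
  by (intro borel_measurable_continuous_onI continuous_intros)

lemma measurable_into_torus_borel:
  "f \<in> borel_measurable M \<Longrightarrow> (\<And>z. snd (f z) \<in> disc) \<Longrightarrow> f \<in> measurable M torus_borel"
  unfolding torus_borel_def by (intro measurable_restrict_space2) (auto simp: mem_Times_iff)

text \<open>
  Open boxes form an intersection-stable generator of the Borel sets of the product. The comparison is
  made on the whole product space, because the boxes do not lie in the solid torus.
\<close>

lemma torus_borel_measure_eqI:
  assumes M: "prob_space M" "sets M = sets torus_borel" and N: "prob_space N" "sets N = sets torus_borel"
    and eq: "\<And>A U. open A \<Longrightarrow> open U \<Longrightarrow>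
      measure M ((A \<times> U) \<inter> solid_torus) = measure N ((A \<times> U) \<inter> solid_torus)"
  shows "M = N"
proof -
  interpret M: prob_space M by fact
  interpret N: prob_space N by fact
  let ?E = "{A \<times> U |A U. open A \<and> open U} :: (circle \<times> (real ^ 2)) set set"
  have sets_E: "sets (borel :: (circle \<times> (real ^ 2)) measure) = sigma_sets UNIV ?E"
  proof
    obtain B1 :: "circle set set" where B1: "countable B1" "topological_basis B1"
      using ex_countable_basis by blast
    obtain B2 :: "(real ^ 2) set set" where B2: "countable B2" "topological_basis B2"
      using ex_countable_basis by blast
    let ?P = "(\<lambda>(a, b). a \<times> b) ` (B1 \<times> B2)"
    have "(borel :: (circle \<times> (real ^ 2)) measure) = sigma UNIV ?P"
      using B1 B2 by (intro borel_eq_countable_basis topological_basis_prod) auto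
    moreover have "sets (sigma UNIV ?P) = sigma_sets UNIV ?P" by (rule sets_measure_of) simp
    ultimately have "sets (borel :: (circle \<times> (real ^ 2)) measure) = sigma_sets UNIV ?P"
      by (rule arg_cong[THEN trans])
    also have "\<dots> \<subseteq> sigma_sets UNIV ?E"
      using B1(2) B2(2) by (intro sigma_sets_mono') (auto dest: topological_basis_open)
    finally show "sets (borel :: (circle \<times> (real ^ 2)) measure) \<subseteq> sigma_sets UNIV ?E" .
    show "sigma_sets UNIV ?E \<subseteq> sets (borel :: (circle \<times> (real ^ 2)) measure)"
      by (intro sets.sigma_sets_subset') (auto intro!: borel_open open_Times)
  qed
  have space_M: "space M = solid_torus" using sets_eq_imp_space_eq[OF M(2)] by simp
  have space_N: "space N = solid_torus" using sets_eq_imp_space_eq[OF N(2)] by simp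
  have id_M: "(\<lambda>p. p) \<in> borel_measurable M" using M(2) by (rule measurable_torus_borel) simp
  have id_N: "(\<lambda>p. p) \<in> borel_measurable N" using N(2) by (rule measurable_torus_borel) simp
  have em_M: "emeasure (distr M borel (\<lambda>p. p)) C = emeasure M (C \<inter> solid_torus)" if "C \<in> sets borel" for C
    using that id_M by (simp add: emeasure_distr space_M)
  have em_N: "emeasure (distr N borel (\<lambda>p. p)) C = emeasure N (C \<inter> solid_torus)" if "C \<in> sets borel" for C
    using that id_N by (simp add: emeasure_distr space_N)
  have "distr M borel (\<lambda>p. p) = distr N borel (\<lambda>p. p)"
  proof (rule measure_eqI_generator_eq[where E="?E" and \<Omega>=UNIV and A="\<lambda>_. UNIV"])
    show "Int_stable ?E" 
      by (auto simp: Int_stable_def Times_Int_Times) (metis open_Int)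
    show "range (\<lambda>_::nat. UNIV) \<subseteq> ?E" by (auto intro!: exI[of _ UNIV])
    show "emeasure (distr M borel (\<lambda>p. p)) UNIV \<noteq> \<infinity>"
      by (simp add: em_M M.emeasure_eq_measure)
    fix C assume "C \<in> ?E"
    then obtain A U where AU: "C = A \<times> U" "open A" "open U" by blast
    then have "C \<in> sets borel" by (auto intro: borel_open open_Times)
    then show "emeasure (distr M borel (\<lambda>p. p)) C = emeasure (distr N borel (\<lambda>p. p)) C"
      using eq[OF AU(2,3)] by (simp add: em_M em_N AU(1) M.emeasure_eq_measure N.emeasure_eq_measure)
  qed (use sets_E in auto)
  then have eq': "emeasure M (C \<inter> solid_torus) = emeasure N (C \<inter> solid_torus)" if "C \<in> sets borel" for C
    using em_M[OF that] em_N[OF that] by simp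
  show ?thesis
  proof (rule measure_eqI)
    fix C assume "C \<in> sets M"
    then have "C \<in> sets borel" "C \<inter> solid_torus = C" using M(2) by (auto simp: sets_torus_borel_iff)
    then show "emeasure M C = emeasure N C" using eq'[of C] by simp
  qed (use M N in simp)
qed

lemma signed_measure_measure:
  assumes "prob_space \<mu>"
  shows "signed_measure \<mu> (measure \<mu>)"
proof -
  interpret prob_space \<mu> by fact
  show ?thesis
    unfolding signed_measure_def
    by (auto simp: measure_notin_sets intro!: finite_measure_UNION)
qed

lemma signed_measure_cong: "sets M = sets N \<Longrightarrow> signed_measure M = signed_measure N"
  by (simp add: signed_measure_def fun_eq_iff)

lemma finite_measure_null: "finite_measure (null_measure M)"
  by (rule finite_measureI) simp

text \<open>
  Everything is the positive set.
\<close>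

lemma jordan_decomposition_measure:
  assumes "prob_space \<mu>" and sets: "sets \<mu> = sets M"
  shows "jordan_decomposition M (measure \<mu>) \<mu> (null_measure M)"
proof -
  interpret prob_space \<mu> by fact
  have "measure (null_measure M) E = 0" for E by (simp add: measure_def)
  then show ?thesis
    unfolding jordan_decomposition_def
    using finite_measure_null sets by (auto simp: finite_measure_axioms intro!: bexI[of _ "space M"])
qed

lemma circle_marginal_null: "circle_marginal (null_measure torus_borel) = null_measure borel"
proof (rule measure_eqI)
  fix E assume "E \<in> sets (circle_marginal (null_measure torus_borel))"
  then have E: "E \<in> sets borel" by (simp add: circle_marginal_def)
  have "fst \<in> measurable (null_measure torus_borel) (borel :: circle measure)"
    by (rule measurable_torus_borel[OF _ measurable_fst_borel]) simp
  then show "emeasure (circle_marginal (null_measure torus_borel)) E = emeasure (null_measure borel) E"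
    using E by (simp add: circle_marginal_def emeasure_distr)
qed (simp add: circle_marginal_def)

text \<open>
  With density 0 any kernel serves; the one of \<open>P\<close> is at hand.
\<close>

lemma disintegration_null:
  assumes "disintegration P \<phi> \<kappa>"
  shows "disintegration (null_measure torus_borel) (\<lambda>_. 0) \<kappa>"
proof -
  have "density m1 (\<lambda>_. ennreal 0) = null_measure borel"
    by (rule measure_eqI) (auto simp: emeasure_density)
  then show ?thesis
    using assms by (simp add: disintegration_def circle_marginal_null)
qed

lemma abs_integral_le_measure:
  fixes g :: "'a \<Rightarrow> real"
  assumes "finite_measure M" and "\<And>x. x \<in> space M \<Longrightarrow> \<bar>g x\<bar> \<le> 1"
  shows "\<bar>\<integral>x. g x \<partial>M\<bar> \<le> measure M (space M)"
proof (cases "integrable M g")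
  case True
  interpret finite_measure M by fact
  have "\<bar>\<integral>x. g x \<partial>M\<bar> \<le> (\<integral>x. \<bar>g x\<bar> \<partial>M)" by (rule integral_abs_bound)
  also have "\<dots> \<le> (\<integral>x. 1 \<partial>M)" using True assms by (intro integral_mono) auto
  finally show ?thesis by simp
qed (simp add: not_integrable_integral_eq)

lemma leaf_subset: "leaf \<gamma> \<subseteq> solid_torus"
  by (auto simp: leaf_def)

text \<open>
  The second measure is 0 and the first has mass \<open>\<phi> \<gamma>\<close>, while the test functions are bounded by 1.
\<close>

lemma W10_leaf_restriction_le:
  assumes d: "disintegration P \<phi> \<kappa>"
  shows "W10 (leaf_restriction \<phi> \<kappa> \<gamma>) (leaf_restriction (\<lambda>_. 0) \<kappa> \<gamma>) \<le> ennreal (\<phi> \<gamma>)"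
  unfolding W10_def
proof (rule SUP_least)
  fix g :: "real ^ 2 \<Rightarrow> real"
  assume "g \<in> {g. 1-lipschitz_on disc g \<and> (\<forall>y\<in>disc. \<bar>g y\<bar> \<le> 1)}"
  then have g: "\<And>y. y \<in> disc \<Longrightarrow> \<bar>g y\<bar> \<le> 1" by auto
  have \<kappa>: "prob_space (\<kappa> \<gamma>)" and sets: "sets (\<kappa> \<gamma>) = sets (restrict_space torus_borel (leaf \<gamma>))"
    and nn: "0 \<le> \<phi> \<gamma>"
    using d by (auto simp: disintegration_def)
  interpret \<kappa>: prob_space "\<kappa> \<gamma>" by fact
  have sp: "space (\<kappa> \<gamma>) = leaf \<gamma>"
    using sets_eq_imp_space_eq[OF sets] leaf_subset by (auto simp: space_restrict_space)
  have "snd \<in> measurable torus_borel (borel :: (real ^ 2) measure)"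
    by (rule measurable_torus_borel[OF refl measurable_snd_borel])
  then have "snd \<in> measurable (restrict_space torus_borel (leaf \<gamma>)) (borel :: (real ^ 2) measure)"
    by (rule measurable_restrict_space1)
  then have "snd \<in> measurable (\<kappa> \<gamma>) (borel :: (real ^ 2) measure)"
    using measurable_cong_sets[OF sets refl] by blast
  then have snd_meas: "snd \<in> measurable (\<kappa> \<gamma>) disc_borel"
    unfolding disc_borel_def by (rule measurable_restrict_space2[rotated]) (auto simp: sp leaf_def)
  let ?R = "leaf_restriction \<phi> \<kappa> \<gamma>"
  interpret D: prob_space "distr (\<kappa> \<gamma>) disc_borel snd" by (rule \<kappa>.prob_space_distr[OF snd_meas])
  have sp_R: "space ?R = disc" "space (distr (\<kappa> \<gamma>) disc_borel snd) = disc"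
    by (simp_all add: leaf_restriction_def space_scale_measure disc_borel_def space_restrict_space)
  have em: "emeasure ?R (space ?R) = ennreal (\<phi> \<gamma>)"
    using D.emeasure_space_1 by (simp add: leaf_restriction_def space_scale_measure)
  have fin: "finite_measure ?R" by (rule finite_measureI) (simp add: em)
  have "(\<integral>y. g y \<partial>leaf_restriction (\<lambda>_. 0) \<kappa> \<gamma>) = 0"
    by (simp add: leaf_restriction_def)
  moreover have "\<bar>\<integral>y. g y \<partial>?R\<bar> \<le> measure ?R (space ?R)"
    by (rule abs_integral_le_measure[OF fin]) (use g sp_R in simp)
  moreover have "measure ?R (space ?R) = \<phi> \<gamma>" using em nn by (simp add: measure_def)
  ultimately show "ennreal \<bar>(\<integral>y. g y \<partial>?R) - (\<integral>y. g y \<partial>leaf_restriction (\<lambda>_. 0) \<kappa> \<gamma>)\<bar> \<le> ennreal (\<phi> \<gamma>)"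
    by (simp add: ennreal_leI)
qed

lemma L1_space_prob:
  assumes \<mu>: "prob_space \<mu>" and sets: "sets \<mu> = sets torus_borel" and d: "disintegration \<mu> \<phi> \<kappa>"
  shows "measure \<mu> \<in> L1_space"
proof -
  interpret prob_space \<mu> by fact
  note jordan = jordan_decomposition_measure[OF \<mu> sets]
  have \<phi>: "\<phi> \<in> borel_measurable borel" "\<And>\<gamma>. 0 \<le> \<phi> \<gamma>"
    and marg: "circle_marginal \<mu> = density m1 (\<lambda>\<gamma>. ennreal (\<phi> \<gamma>))"
    using d by (auto simp: disintegration_def)
  have "signed_measure torus_borel (measure \<mu>)"
    using signed_measure_measure[OF \<mu>] signed_measure_cong[OF sets] by simp
  moreover have "absolutely_continuous m1 (circle_marginal \<mu>)"
    unfolding marg using \<phi> by (intro absolutely_continuousI_density) auto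
  moreover have "absolutely_continuous m1 (circle_marginal (null_measure torus_borel))"
    by (auto simp: circle_marginal_null absolutely_continuous_def null_sets_def)
  ultimately have AB: "measure \<mu> \<in> AB" using jordan by (auto simp: AB_def)
  have fst_meas: "fst \<in> measurable \<mu> (borel :: circle measure)"
    by (rule measurable_torus_borel[OF sets measurable_fst_borel])
  have "(\<integral>\<^sup>+\<gamma>. W10 (leaf_restriction \<phi> \<kappa> \<gamma>) (leaf_restriction (\<lambda>_. 0) \<kappa> \<gamma>) \<partial>m1)
      \<le> (\<integral>\<^sup>+\<gamma>. ennreal (\<phi> \<gamma>) \<partial>m1)"
    by (intro nn_integral_mono W10_leaf_restriction_le[OF d])
  also have "\<dots> = emeasure (circle_marginal \<mu>) UNIV"
    unfolding marg using \<phi> by (subst emeasure_density) auto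
  also have "\<dots> = 1"
    unfolding circle_marginal_def using fst_meas emeasure_space_1 by (subst emeasure_distr) auto
  finally have "(\<integral>\<^sup>+\<gamma>. W10 (leaf_restriction \<phi> \<kappa> \<gamma>) (leaf_restriction (\<lambda>_. 0) \<kappa> \<gamma>) \<partial>m1) < \<infinity>"
    by (rule le_less_trans) simp
  then show ?thesis
    unfolding L1_space_def using AB jordan d disintegration_null[OF d] by blast
qed

text \<open>
  If \<open>\<mu> = P - N\<close> then \<open>\<mu> \<le> P\<close>, so a set that is null for the marginal of the positive part is null for the
  marginal of \<open>\<mu>\<close>.
\<close>

lemma L1_space_absolutely_continuous:
  assumes \<mu>: "prob_space \<mu>" and sets: "sets \<mu> = sets torus_borel" and L1: "measure \<mu> \<in> L1_space"
  shows "absolutely_continuous m1 (circle_marginal \<mu>)"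
proof -
  interpret prob_space \<mu> by fact
  obtain P N where PN: "jordan_decomposition torus_borel (measure \<mu>) P N"
    "absolutely_continuous m1 (circle_marginal P)"
    using L1 by (auto simp: L1_space_def AB_def)
  have sets_P: "sets P = sets torus_borel" using PN(1) by (simp add: jordan_decomposition_def)
  have fst_\<mu>: "fst \<in> measurable \<mu> (borel :: circle measure)"
    by (rule measurable_torus_borel[OF sets measurable_fst_borel])
  have fst_P: "fst \<in> measurable P (borel :: circle measure)"
    by (rule measurable_torus_borel[OF sets_P measurable_fst_borel])
  have sp: "space \<mu> = solid_torus" "space P = solid_torus"
    using sets_eq_imp_space_eq[OF sets] sets_eq_imp_space_eq[OF sets_P] by simp_all
  show ?thesis
    unfolding absolutely_continuous_def
  proof
    fix E assume E: "E \<in> null_sets m1"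
    then have E': "E \<in> sets borel" by auto
    have "E \<in> null_sets (circle_marginal P)" using E PN(2) by (auto simp: absolutely_continuous_def)
    then have "emeasure P (fst -` E \<inter> solid_torus) = 0"
      using E' fst_P by (simp add: circle_marginal_def null_sets_def emeasure_distr sp)
    then have P0: "measure P (fst -` E \<inter> solid_torus) = 0" by (simp add: measure_def)
    have "fst -` E \<inter> solid_torus \<in> sets torus_borel"
      using measurable_sets[OF fst_\<mu> E'] sets sp by simp
    then have "measure \<mu> (fst -` E \<inter> solid_torus) \<le> 0"
      using PN(1) P0 by (simp add: jordan_decomposition_def)
    then have "measure \<mu> (fst -` E \<inter> solid_torus) = 0" by (intro antisym) auto
    then have "emeasure \<mu> (fst -` E \<inter> solid_torus) = 0"
      by (simp add: emeasure_eq_measure)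
    then show "E \<in> null_sets (circle_marginal \<mu>)"
      using E' fst_\<mu> by (simp add: circle_marginal_def null_sets_def emeasure_distr sp)
  qed
qed

context contracting_skew_product
begin

text \<open>
  This map agrees with \<open>F\<close> on the solid torus and is Borel on the whole product.
\<close>

definition skew :: "circle \<times> (real ^ 2) \<Rightarrow> circle \<times> (real ^ 2)"
  where "skew p = (T (fst p), Gd p)"

lemma measurable_skew [measurable]: "skew \<in> borel_measurable borel"
  unfolding skew_def
  by (intro borel_measurable_Pair measurable_Gd measurable_compose[OF measurable_fst_borel T_measurable])

lemma prob_space_noise: "prob_space noise"
  by (rule prob_space_PiM) (rule prob_space_unit_lborel)

lemma sigma_finite_noise: "sigma_finite_measure noise"
  using prob_space_noise by (simp add: prob_space_imp_sigma_finite)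

text \<open>
  The law of a point \<open>x\<close> distributed by \<open>acim\<close> together with the random fibre point over it.
\<close>

definition solenoid_measure :: "(circle \<times> (real ^ 2)) measure"
  where "solenoid_measure = distr (acim \<Otimes>\<^sub>M noise) torus_borel (\<lambda>(x, \<omega>). (x, fibre_limit x \<omega>))"

lemma sets_solenoid [simp]: "sets solenoid_measure = sets torus_borel"
  by (simp add: solenoid_measure_def)

lemma measurable_solenoid_param:
  "(\<lambda>(x, \<omega>). (x, fibre_limit x \<omega>)) \<in> measurable (acim \<Otimes>\<^sub>M noise) torus_borel"
proof (rule measurable_into_torus_borel)
  have "(\<lambda>z. (fst z, fibre_limit (fst z) (snd z))) \<in> borel_measurable (borel \<Otimes>\<^sub>M noise)"
    by measurable
  moreover have "measurable (acim \<Otimes>\<^sub>M noise) borel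
      = (measurable (borel \<Otimes>\<^sub>M noise) borel :: (circle \<times> (nat \<Rightarrow> real) \<Rightarrow> circle \<times> (real ^ 2)) set)"
    by (intro measurable_cong_sets sets_pair_measure_cong) auto
  ultimately show "(\<lambda>(x, \<omega>). (x, fibre_limit x \<omega>)) \<in> borel_measurable (acim \<Otimes>\<^sub>M noise)"
    by (simp add: case_prod_beta)
  show "snd (case z of (x, \<omega>) \<Rightarrow> (x, fibre_limit x \<omega>)) \<in> disc" for z
    using fibre_limit_disc by (simp add: case_prod_beta del: mem_cball)
qed

lemma prob_space_solenoid: "prob_space solenoid_measure"
proof -
  interpret A: prob_space acim by (rule prob_space_acim)
  interpret N: prob_space noise by (rule prob_space_noise)
  interpret AN: pair_prob_space acim noise ..
  show ?thesis
    unfolding solenoid_measure_def by (rule AN.prob_space_distr[OF measurable_solenoid_param])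
qed

lemma nn_integral_solenoid:
  assumes f: "f \<in> borel_measurable borel"
  shows "(\<integral>\<^sup>+p. f p \<partial>solenoid_measure) = (\<integral>\<^sup>+x. \<integral>\<^sup>+\<omega>. f (x, fibre_limit x \<omega>) \<partial>noise \<partial>acim)"
proof -
  have f': "f \<in> borel_measurable torus_borel" by (rule measurable_torus_borel[OF refl f])
  have "(\<integral>\<^sup>+p. f p \<partial>solenoid_measure) = (\<integral>\<^sup>+z. f (case z of (x, \<omega>) \<Rightarrow> (x, fibre_limit x \<omega>)) \<partial>(acim \<Otimes>\<^sub>M noise))"
    unfolding solenoid_measure_def by (rule nn_integral_distr[OF measurable_solenoid_param]) (simp add: f')
  also have "\<dots> = (\<integral>\<^sup>+x. \<integral>\<^sup>+\<omega>. f (case (x, \<omega>) of (x, \<omega>) \<Rightarrow> (x, fibre_limit x \<omega>)) \<partial>noise \<partial>acim)"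
    by (rule sigma_finite_measure.nn_integral_fst[OF sigma_finite_noise, symmetric])
      (rule measurable_compose[OF measurable_solenoid_param f'])
  finally show ?thesis by simp
qed

text \<open>
  A sequence of independent uniform variables is one uniform variable followed by an
  independent copy of the sequence.
\<close>

lemma nn_integral_noise_split:
  assumes f: "f \<in> borel_measurable noise"
  shows "(\<integral>\<^sup>+\<omega>. f \<omega> \<partial>noise) = (\<integral>\<^sup>+u. \<integral>\<^sup>+\<omega>. f (case_nat u \<omega>) \<partial>noise \<partial>unit_lborel)"
proof -
  have m: "(\<lambda>(u, \<omega>). case_nat u \<omega>) \<in> measurable (unit_lborel \<Otimes>\<^sub>M noise) noise"
    by measurable
  have "(\<integral>\<^sup>+\<omega>. f \<omega> \<partial>noise) = (\<integral>\<^sup>+\<omega>. f \<omega> \<partial>distr (unit_lborel \<Otimes>\<^sub>M noise) noise (\<lambda>(u, \<omega>). case_nat u \<omega>))"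
    by (simp add: noise.PiM_iter)
  also have "\<dots> = (\<integral>\<^sup>+z. f (case z of (u, \<omega>) \<Rightarrow> case_nat u \<omega>) \<partial>(unit_lborel \<Otimes>\<^sub>M noise))"
    by (rule nn_integral_distr[OF m]) (simp add: f)
  also have "\<dots> = (\<integral>\<^sup>+u. \<integral>\<^sup>+\<omega>. f (case (u, \<omega>) of (u, \<omega>) \<Rightarrow> case_nat u \<omega>) \<partial>noise \<partial>unit_lborel)"
    by (rule sigma_finite_measure.nn_integral_fst[OF sigma_finite_noise, symmetric])
      (rule measurable_compose[OF m f])
  finally show ?thesis by simp
qed

text \<open>
  Splitting off the first noise variable \<open>u\<close> writes the fibre point over \<open>x\<close> as the image under \<open>G\<close> of the fibre point
  over the random preimage \<open>z\<close> of \<open>x\<close>. The pair \<open>(x, z)\<close> has the law of \<open>(T z, z)\<close>, and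
  \<open>T z\<close> together with that image is the value of \<open>skew\<close> at the point over \<open>z\<close>.
\<close>

lemma nn_integral_solenoid_skew:
  assumes f [measurable]: "f \<in> borel_measurable borel"
  shows "(\<integral>\<^sup>+p. f (skew p) \<partial>solenoid_measure) = (\<integral>\<^sup>+p. f p \<partial>solenoid_measure)"
proof -
  \<comment> \<open>The argument is a pair of a point and its preimage.\<close>
  define \<phi> where "\<phi> q = (\<integral>\<^sup>+\<omega>. f (fst q, Gd (snd q, fibre_limit (snd q) \<omega>)) \<partial>noise)" for q
  have \<phi>_meas: "\<phi> \<in> borel_measurable (borel \<Otimes>\<^sub>M borel)"
    unfolding \<phi>_def by measurable
  have "(\<integral>\<^sup>+p. f p \<partial>solenoid_measure) = (\<integral>\<^sup>+x. \<integral>\<^sup>+\<omega>. f (x, fibre_limit x \<omega>) \<partial>noise \<partial>acim)"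
    by (rule nn_integral_solenoid[OF f])
  also have "\<dots> = (\<integral>\<^sup>+x. \<integral>\<^sup>+u. \<phi> (x, random_preimage x u) \<partial>unit_lborel \<partial>acim)"
  proof (rule nn_integral_cong)
    fix x
    have "(\<lambda>\<omega>. f (x, fibre_limit x \<omega>)) \<in> borel_measurable noise" by measurable
    then have "(\<integral>\<^sup>+\<omega>. f (x, fibre_limit x \<omega>) \<partial>noise)
      = (\<integral>\<^sup>+u. \<integral>\<^sup>+\<omega>. f (x, fibre_limit x (case_nat u \<omega>)) \<partial>noise \<partial>unit_lborel)"
      by (rule nn_integral_noise_split)
    also have "\<dots> = (\<integral>\<^sup>+u. \<phi> (x, random_preimage x u) \<partial>unit_lborel)"
      by (subst fibre_limit_eq) (simp add: \<phi>_def)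
    finally show "(\<integral>\<^sup>+\<omega>. f (x, fibre_limit x \<omega>) \<partial>noise) = (\<integral>\<^sup>+u. \<phi> (x, random_preimage x u) \<partial>unit_lborel)" .
  qed
  also have "\<dots> = (\<integral>\<^sup>+z. \<phi> (T z, z) \<partial>acim)" by (rule random_preimage_reverses_T[OF \<phi>_meas])
  also have "\<dots> = (\<integral>\<^sup>+x. \<integral>\<^sup>+\<omega>. f (skew (x, fibre_limit x \<omega>)) \<partial>noise \<partial>acim)"
    by (simp add: \<phi>_def skew_def)
  also have "\<dots> = (\<integral>\<^sup>+p. f (skew p) \<partial>solenoid_measure)"
    by (rule nn_integral_solenoid[symmetric]) measurable
  finally show ?thesis by simp
qed

lemma measurable_skew_torus:
  assumes "sets M = sets torus_borel"
  shows "skew \<in> measurable M torus_borel"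
proof (rule measurable_into_torus_borel)
  show "skew \<in> borel_measurable M" using assms measurable_skew by (rule measurable_torus_borel)
  show "snd (skew z) \<in> disc" for z using Gd_disc by (simp add: skew_def del: mem_cball)
qed

lemma solenoid_invariant: "distr solenoid_measure torus_borel skew = solenoid_measure"
proof (rule measure_eqI)
  fix E assume "E \<in> sets (distr solenoid_measure torus_borel skew)"
  then have E: "E \<in> sets torus_borel" by simp
  then have E': "E \<in> sets borel" by (simp add: sets_torus_borel_iff)
  have "emeasure (distr solenoid_measure torus_borel skew) E
      = (\<integral>\<^sup>+p. indicator E p \<partial>distr solenoid_measure torus_borel skew)"
    using E by simp
  also have "\<dots> = (\<integral>\<^sup>+p. indicator E (skew p) \<partial>solenoid_measure)"
    using E by (intro nn_integral_distr measurable_skew_torus) auto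
  also have "\<dots> = (\<integral>\<^sup>+p. indicator E p \<partial>solenoid_measure)"
    using E' by (intro nn_integral_solenoid_skew) auto
  finally show "emeasure (distr solenoid_measure torus_borel skew) E = emeasure solenoid_measure E"
    using E by simp
qed simp

lemma circle_marginal_solenoid: "circle_marginal solenoid_measure = acim"
proof (rule measure_eqI)
  fix E assume "E \<in> sets (circle_marginal solenoid_measure)"
  then have [measurable]: "E \<in> sets borel" by (simp add: circle_marginal_def)
  have fst_meas: "fst \<in> measurable solenoid_measure (borel :: circle measure)"
    by (rule measurable_torus_borel[OF sets_solenoid measurable_fst_borel])
  have "emeasure (circle_marginal solenoid_measure) E = (\<integral>\<^sup>+x. indicator E x \<partial>distr solenoid_measure borel fst)"
    by (simp add: circle_marginal_def)
  also have "\<dots> = (\<integral>\<^sup>+p. indicator E (fst p) \<partial>solenoid_measure)"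
    by (intro nn_integral_distr fst_meas) measurable
  also have "\<dots> = (\<integral>\<^sup>+x. \<integral>\<^sup>+\<omega>. indicator E (fst (x, fibre_limit x \<omega>)) \<partial>noise \<partial>acim)"
    by (rule nn_integral_solenoid, rule measurable_compose[OF measurable_fst_borel]) measurable
  also have "\<dots> = (\<integral>\<^sup>+x. indicator E x \<partial>acim)"
    by (simp add: prob_space.emeasure_space_1[OF prob_space_noise])
  finally show "emeasure (circle_marginal solenoid_measure) E = emeasure acim E" by simp
qed (simp add: circle_marginal_def)

definition leaf_measure :: "circle \<Rightarrow> (circle \<times> (real ^ 2)) measure"
  where "leaf_measure \<gamma> = distr noise (restrict_space torus_borel (leaf \<gamma>)) (\<lambda>\<omega>. (\<gamma>, fibre_limit \<gamma> \<omega>))"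

text \<open>
  The construction conditions on \<open>x\<close> from the start: the measure on the leaf over \<open>\<gamma>\<close> is the law of the fibre
  point over \<open>\<gamma>\<close>, and the disintegration formula is Fubini's theorem.
\<close>

lemma solenoid_disintegration: "disintegration solenoid_measure (\<lambda>\<gamma>. h (circle_coord \<gamma>)) leaf_measure"
  unfolding disintegration_def
proof (intro conjI allI ballI)
  show "(\<lambda>\<gamma>. h (circle_coord \<gamma>)) \<in> borel_measurable borel" by measurable
  show "0 \<le> h (circle_coord \<gamma>)" for \<gamma> by (rule h_nonneg)
  show "circle_marginal solenoid_measure = density m1 (\<lambda>\<gamma>. ennreal (h (circle_coord \<gamma>)))"
    by (simp add: circle_marginal_solenoid acim_def)
  have meas: "(\<lambda>\<omega>. (\<gamma>, fibre_limit \<gamma> \<omega>)) \<in> measurable noise (restrict_space torus_borel (leaf \<gamma>))" for \<gamma>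
  proof (rule measurable_restrict_space2)
    have "(\<lambda>\<omega>. (\<gamma>, fibre_limit \<gamma> \<omega>)) \<in> borel_measurable noise" by measurable
    then show "(\<lambda>\<omega>. (\<gamma>, fibre_limit \<gamma> \<omega>)) \<in> measurable noise torus_borel"
      by (rule measurable_into_torus_borel) (use fibre_limit_disc in \<open>simp del: mem_cball\<close>)
  qed (use fibre_limit_disc in \<open>auto simp: leaf_def simp del: mem_cball\<close>)
  show "prob_space (leaf_measure \<gamma>)" for \<gamma>
    unfolding leaf_measure_def by (rule prob_space.prob_space_distr[OF prob_space_noise meas])
  show "sets (leaf_measure \<gamma>) = sets (restrict_space torus_borel (leaf \<gamma>))" for \<gamma>
    by (simp add: leaf_measure_def)
  fix E assume E: "E \<in> sets torus_borel"
  then have [measurable]: "E \<in> sets borel" by (simp add: sets_torus_borel_iff)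
  have em: "emeasure (leaf_measure \<gamma>) (E \<inter> leaf \<gamma>) = (\<integral>\<^sup>+\<omega>. indicator E (\<gamma>, fibre_limit \<gamma> \<omega>) \<partial>noise)" for \<gamma>
  proof -
    have E\<gamma>: "E \<inter> leaf \<gamma> \<in> sets (restrict_space torus_borel (leaf \<gamma>))"
      using E by (auto simp: sets_restrict_space)
    then have "emeasure (leaf_measure \<gamma>) (E \<inter> leaf \<gamma>) = (\<integral>\<^sup>+p. indicator (E \<inter> leaf \<gamma>) p \<partial>leaf_measure \<gamma>)"
      by (simp add: leaf_measure_def)
    also have "\<dots> = (\<integral>\<^sup>+\<omega>. indicator (E \<inter> leaf \<gamma>) (\<gamma>, fibre_limit \<gamma> \<omega>) \<partial>noise)"
      unfolding leaf_measure_def using E\<gamma> by (intro nn_integral_distr meas) auto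
    also have "\<dots> = (\<integral>\<^sup>+\<omega>. indicator E (\<gamma>, fibre_limit \<gamma> \<omega>) \<partial>noise)"
      using fibre_limit_disc by (intro nn_integral_cong) (auto simp: indicator_def leaf_def simp del: mem_cball)
    finally show ?thesis .
  qed
  have meas_em: "(\<lambda>\<gamma>. \<integral>\<^sup>+\<omega>. indicator E (\<gamma>, fibre_limit \<gamma> \<omega>) \<partial>noise) \<in> borel_measurable borel"
    by measurable
  then show "(\<lambda>\<gamma>. emeasure (leaf_measure \<gamma>) (E \<inter> leaf \<gamma>)) \<in> borel_measurable borel"
    by (simp add: em)
  have "emeasure solenoid_measure E = (\<integral>\<^sup>+p. indicator E p \<partial>solenoid_measure)"
    using E by simp
  also have "\<dots> = (\<integral>\<^sup>+\<gamma>. \<integral>\<^sup>+\<omega>. indicator E (\<gamma>, fibre_limit \<gamma> \<omega>) \<partial>noise \<partial>acim)"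
    by (rule nn_integral_solenoid) measurable
  also have "\<dots> = (\<integral>\<^sup>+\<gamma>. ennreal (h (circle_coord \<gamma>)) * (\<integral>\<^sup>+\<omega>. indicator E (\<gamma>, fibre_limit \<gamma> \<omega>) \<partial>noise) \<partial>m1)"
    unfolding acim_def using meas_em by (intro nn_integral_density) auto
  finally show "emeasure solenoid_measure E
      = (\<integral>\<^sup>+\<gamma>. emeasure (leaf_measure \<gamma>) (E \<inter> leaf \<gamma>) * ennreal (h (circle_coord \<gamma>)) \<partial>m1)"
    by (simp add: em mult.commute)
qed

end

section \<open>Uniqueness of the invariant measure over its marginal\<close>

context contracting_skew_product
begin

lemma fst_funpow_skew: "fst ((skew ^^ m) p) = (T ^^ m) (fst p)"
  by (induction m) (simp_all add: skew_def)

lemma snd_funpow_skew_disc: "snd p \<in> disc \<Longrightarrow> snd ((skew ^^ m) p) \<in> disc"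
  using Gd_disc by (cases m) (auto simp: skew_def simp del: mem_cball)

lemma funpow_skew_contraction:
  assumes "y1 \<in> disc" "y2 \<in> disc"
  shows "norm (snd ((skew ^^ m) (x, y1)) - snd ((skew ^^ m) (x, y2))) \<le> \<alpha> ^ m * norm (y1 - y2)"
proof (induction m)
  case (Suc m)
  let ?z = "\<lambda>y. snd ((skew ^^ m) (x, y))"
  have split: "(skew ^^ m) (x, y) = ((T ^^ m) x, ?z y)" for y
    using fst_funpow_skew[of m "(x, y)"] by (simp add: prod_eq_iff)
  have "norm (snd ((skew ^^ Suc m) (x, y1)) - snd ((skew ^^ Suc m) (x, y2)))
      = norm (Gd ((T ^^ m) x, ?z y1) - Gd ((T ^^ m) x, ?z y2))"
    by (simp add: skew_def flip: split)
  also have "\<dots> \<le> \<alpha> * norm (?z y1 - ?z y2)"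
    using assms snd_funpow_skew_disc[of "(x, _)"] by (intro Gd_contraction) auto
  also have "\<dots> \<le> \<alpha> * (\<alpha> ^ m * norm (y1 - y2))"
    by (intro mult_left_mono Suc alpha)
  finally show ?case by (simp add: mult.assoc)
qed simp

lemma measurable_funpow_skew: "(skew ^^ m) \<in> borel_measurable borel"
  by (induction m) (auto intro: measurable_comp measurable_skew)

lemma integral_funpow_skew:
  fixes f :: "circle \<times> (real ^ 2) \<Rightarrow> real"
  assumes sets: "sets M = sets torus_borel" and inv: "distr M torus_borel skew = M"
    and f: "f \<in> borel_measurable borel"
  shows "(\<integral>p. f ((skew ^^ m) p) \<partial>M) = (\<integral>p. f p \<partial>M)"
proof (induction m)
  case (Suc m)
  have fm: "(\<lambda>p. f ((skew ^^ m) p)) \<in> borel_measurable borel"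
    by (rule measurable_compose[OF measurable_funpow_skew f])
  have "(\<integral>p. f ((skew ^^ m) p) \<partial>M) = (\<integral>p. f ((skew ^^ m) p) \<partial>distr M torus_borel skew)"
    by (simp add: inv)
  also have "\<dots> = (\<integral>p. f ((skew ^^ m) (skew p)) \<partial>M)"
    by (rule integral_distr[OF measurable_skew_torus[OF sets] measurable_torus_borel[OF refl fm]])
  finally show ?case using Suc by (simp add: funpow_Suc_right del: funpow.simps)
qed simp

text \<open>
  By invariance \<open>f\<close> may be replaced by its composition with the \<open>m\<close>-th iterate, and there the fibre
  coordinate may be moved to the centre of the disc at the cost of \<open>L \<alpha>\<^sup>m\<close>. What remains depends
  on the base point only. The factor that depends on the base point may be any indicator, as moving within
  a leaf leaves it unchanged.
\<close>

lemma invariant_integral_approx: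
  fixes g :: "real ^ 2 \<Rightarrow> real"
  assumes M: "prob_space M" and sets: "sets M = sets torus_borel" and inv: "distr M torus_borel skew = M"
    and A: "A \<in> sets borel" and g: "g \<in> borel_measurable borel" "\<And>y. \<bar>g y\<bar> \<le> 1"
    and lip: "\<And>y z. \<bar>g y - g z\<bar> \<le> L * dist y z" and L: "0 \<le> L"
  defines "f \<equiv> \<lambda>p. indicat_real A (fst p) * g (snd p)"
  shows "\<bar>(\<integral>p. f p \<partial>M) - (\<integral>x. f ((skew ^^ m) (x, 0)) \<partial>circle_marginal M)\<bar> \<le> L * \<alpha> ^ m"
proof -
  interpret prob_space M by fact
  have f: "f \<in> borel_measurable borel"
    unfolding f_def
    by (intro borel_measurable_times measurable_compose[OF measurable_fst_borel borel_measurable_indicator]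
      measurable_compose[OF measurable_snd_borel g(1)] A)
  have f_bd: "\<bar>f p\<bar> \<le> 1" for p using g(2) by (simp add: f_def indicator_def)
  have fm: "(\<lambda>p. f ((skew ^^ m) p)) \<in> borel_measurable borel"
    by (rule measurable_compose[OF measurable_funpow_skew f])
  have f0: "(\<lambda>x. f ((skew ^^ m) (x, 0))) \<in> borel_measurable borel"
  proof (rule measurable_compose[OF _ fm])
    show "(\<lambda>x. (x, 0)) \<in> measurable borel (borel :: (circle \<times> (real ^ 2)) measure)"
      by (intro borel_measurable_continuous_onI continuous_intros)
  qed
  have fst_M: "fst \<in> measurable M (borel :: circle measure)"
    by (rule measurable_torus_borel[OF sets measurable_fst_borel])
  have int1: "integrable M (\<lambda>p. f ((skew ^^ m) p))"
    using measurable_torus_borel[OF sets fm] f_bd by (intro integrable_const_bound[where B=1]) auto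
  have int2: "integrable M (\<lambda>p. f ((skew ^^ m) (fst p, 0)))"
    using measurable_compose[OF fst_M f0] f_bd by (intro integrable_const_bound[where B=1]) auto
  have close: "\<bar>f ((skew ^^ m) p) - f ((skew ^^ m) (fst p, 0))\<bar> \<le> L * \<alpha> ^ m" if "p \<in> space M" for p
  proof -
    have "snd p \<in> disc" using that sets_eq_imp_space_eq[OF sets] by auto
    then have "norm (snd ((skew ^^ m) (fst p, snd p)) - snd ((skew ^^ m) (fst p, 0))) \<le> \<alpha> ^ m * norm (snd p - 0)"
      by (intro funpow_skew_contraction) auto
    also have "\<dots> \<le> \<alpha> ^ m * 1"
      using \<open>snd p \<in> disc\<close> alpha by (intro mult_left_mono) auto
    finally have d: "dist (snd ((skew ^^ m) p)) (snd ((skew ^^ m) (fst p, 0))) \<le> \<alpha> ^ m"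
      by (simp add: dist_norm)
    have "\<bar>f ((skew ^^ m) p) - f ((skew ^^ m) (fst p, 0))\<bar>
        \<le> \<bar>g (snd ((skew ^^ m) p)) - g (snd ((skew ^^ m) (fst p, 0)))\<bar>"
      by (simp add: f_def fst_funpow_skew indicator_def)
    also have "\<dots> \<le> L * dist (snd ((skew ^^ m) p)) (snd ((skew ^^ m) (fst p, 0)))" by (rule lip)
    also have "\<dots> \<le> L * \<alpha> ^ m" using d L by (intro mult_left_mono)
    finally show ?thesis .
  qed
  have "(\<integral>x. f ((skew ^^ m) (x, 0)) \<partial>circle_marginal M) = (\<integral>p. f ((skew ^^ m) (fst p, 0)) \<partial>M)"
    unfolding circle_marginal_def by (rule integral_distr[OF fst_M f0])
  then have "(\<integral>p. f p \<partial>M) - (\<integral>x. f ((skew ^^ m) (x, 0)) \<partial>circle_marginal M)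
      = (\<integral>p. f ((skew ^^ m) p) - f ((skew ^^ m) (fst p, 0)) \<partial>M)"
    using int1 int2 integral_funpow_skew[OF sets inv f, of m] by simp
  also have "\<bar>\<dots>\<bar> \<le> (\<integral>p. \<bar>f ((skew ^^ m) p) - f ((skew ^^ m) (fst p, 0))\<bar> \<partial>M)"
    by (rule integral_abs_bound)
  also have "\<dots> \<le> (\<integral>p. L * \<alpha> ^ m \<partial>M)"
    using int1 int2 close by (intro integral_mono) auto
  finally show ?thesis by (simp add: prob_space)
qed

text \<open>
  The integrals of \<open>indicat_real A (fst p) * open_bump k U (snd p)\<close> agree for both measures, because
  both are within \<open>k \<alpha>\<^sup>m\<close> of the same integral over the common marginal, for every \<open>m\<close>. Letting \<open>k\<close> tend to
  infinity gives the boxes \<open>A \<times> U\<close>.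
\<close>

lemma invariant_measure_unique:
  assumes M: "prob_space M" "sets M = sets torus_borel" "distr M torus_borel skew = M"
    and N: "prob_space N" "sets N = sets torus_borel" "distr N torus_borel skew = N"
    and marg: "circle_marginal M = circle_marginal N"
  shows "M = N"
proof (rule torus_borel_measure_eqI[OF M(1,2) N(1,2)])
  fix A :: "circle set" and U :: "(real ^ 2) set"
  assume "open A" "open U"
  then have A: "A \<in> sets borel" and U: "U \<in> sets borel" by simp_all
  define f where "f k p = indicat_real A (fst p) * open_bump k U (snd p)" for k and p :: "circle \<times> (real ^ 2)"
  have eq: "(\<integral>p. f k p \<partial>M) = (\<integral>p. f k p \<partial>N)" for k
  proof -
    have bound: "\<bar>(\<integral>p. f k p \<partial>M) - (\<integral>p. f k p \<partial>N)\<bar> \<le> 2 * (real k * \<alpha> ^ m)" for m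
    proof -
      have bd: "\<bar>open_bump k U y\<bar> \<le> 1" for y by (simp add: open_bump_range)
      have "\<bar>(\<integral>p. f k p \<partial>M) - (\<integral>x. f k ((skew ^^ m) (x, 0)) \<partial>circle_marginal M)\<bar> \<le> real k * \<alpha> ^ m"
        unfolding f_def
        by (rule invariant_integral_approx[OF M A open_bump_measurable bd open_bump_lipschitz]) simp
      moreover have "\<bar>(\<integral>p. f k p \<partial>N) - (\<integral>x. f k ((skew ^^ m) (x, 0)) \<partial>circle_marginal N)\<bar> \<le> real k * \<alpha> ^ m"
        unfolding f_def
        by (rule invariant_integral_approx[OF N A open_bump_measurable bd open_bump_lipschitz]) simp
      ultimately show ?thesis unfolding marg by linarith
    qed
    have "(\<lambda>m. 2 * (real k * \<alpha> ^ m)) \<longlonglongrightarrow> 2 * (real k * 0)"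
      using alpha by (intro tendsto_intros LIMSEQ_power_zero) auto
    then have "\<bar>(\<integral>p. f k p \<partial>M) - (\<integral>p. f k p \<partial>N)\<bar> \<le> 2 * (real k * 0)"
      by (rule LIMSEQ_le_const) (use bound in auto)
    then show ?thesis by simp
  qed
  have lim: "(\<lambda>k. \<integral>p. f k p \<partial>P) \<longlonglongrightarrow> measure P ((A \<times> U) \<inter> solid_torus)"
    if P: "prob_space P" "sets P = sets torus_borel" for P
  proof -
    interpret prob_space P by fact
    have sp: "space P = solid_torus" using sets_eq_imp_space_eq[OF P(2)] by simp
    have AU: "indicat_real (A \<times> U) \<in> borel_measurable (borel :: (circle \<times> (real ^ 2)) measure)"
      using \<open>open A\<close> \<open>open U\<close> by (intro borel_measurable_indicator borel_open open_Times)
    have "(\<lambda>k. \<integral>p. f k p \<partial>P) \<longlonglongrightarrow> (\<integral>p. indicat_real (A \<times> U) p \<partial>P)"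
    proof (rule integral_dominated_convergence[where w="\<lambda>_. 1"])
      show "indicat_real (A \<times> U) \<in> borel_measurable P" by (rule measurable_torus_borel[OF P(2) AU])
      show "f k \<in> borel_measurable P" for k
        unfolding f_def
        by (intro measurable_torus_borel[OF P(2)] borel_measurable_times A
          measurable_compose[OF measurable_fst_borel borel_measurable_indicator]
          measurable_compose[OF measurable_snd_borel open_bump_measurable])
      show "AE p in P. (\<lambda>k. f k p) \<longlonglongrightarrow> indicat_real (A \<times> U) p"
      proof (rule AE_I2)
        fix p :: "circle \<times> (real ^ 2)"
        have "(\<lambda>k. f k p) \<longlonglongrightarrow> indicat_real A (fst p) * indicator U (snd p)"
          unfolding f_def by (intro tendsto_mult_left open_bump_tendsto \<open>open U\<close>)
        then show "(\<lambda>k. f k p) \<longlonglongrightarrow> indicat_real (A \<times> U) p"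
          by (simp add: indicator_times case_prod_beta)
      qed
      show "AE p in P. norm (f k p) \<le> 1" for k
        by (rule AE_I2) (simp add: f_def indicator_def open_bump_range)
    qed simp
    then show ?thesis by (simp add: sp)
  qed
  show "measure M ((A \<times> U) \<inter> solid_torus) = measure N ((A \<times> U) \<inter> solid_torus)"
    using lim[OF M(1,2)] lim[OF N(1,2)] unfolding eq by (rule LIMSEQ_unique)
qed

lemma circle_marginal_invariant:
  assumes sets: "sets M = sets torus_borel" and inv: "distr M torus_borel skew = M"
  shows "distr (circle_marginal M) borel T = circle_marginal M"
proof -
  have fst_M: "fst \<in> measurable M (borel :: circle measure)"
    by (rule measurable_torus_borel[OF sets measurable_fst_borel])
  have fst_t: "fst \<in> measurable torus_borel (borel :: circle measure)"
    by (rule measurable_torus_borel[OF refl measurable_fst_borel])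
  have "distr (circle_marginal M) borel T = distr M borel (T \<circ> fst)"
    unfolding circle_marginal_def by (rule distr_distr[OF T_measurable fst_M])
  also have "T \<circ> fst = fst \<circ> skew" by (auto simp: skew_def)
  also have "distr M borel (fst \<circ> skew) = distr (distr M torus_borel skew) borel fst"
    by (rule distr_distr[OF fst_t measurable_skew_torus[OF sets], symmetric])
  finally show ?thesis by (simp add: inv circle_marginal_def)
qed

lemma transfer_operator_iff:
  assumes M: "prob_space M" and sets: "sets M = sets torus_borel"
    and F: "\<And>x y. y \<in> disc \<Longrightarrow> F (x, y) = (T x, G (x, y))"
  shows "transfer_operator F (measure M) = measure M \<longleftrightarrow> distr M torus_borel skew = M"
proof -
  interpret prob_space M by fact
  have sp: "space M = solid_torus" using sets_eq_imp_space_eq[OF sets] by simp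
  note meas = measurable_skew_torus[OF sets]
  interpret D: prob_space "distr M torus_borel skew" by (rule prob_space_distr[OF meas])
  have "F p = skew p" if "p \<in> solid_torus" for p
    using that F[of "snd p" "fst p"] by (auto simp: skew_def Gd_def)
  then have pre: "F -` E \<inter> solid_torus = skew -` E \<inter> space M" for E by (auto simp: sp)
  have op: "transfer_operator F (measure M) E = measure (distr M torus_borel skew) E" for E
  proof (cases "E \<in> sets torus_borel")
    case True
    then show ?thesis by (simp add: transfer_operator_def pre measure_distr[OF meas])
  next
    case False
    then show ?thesis by (simp add: transfer_operator_def measure_notin_sets)
  qed
  show ?thesis
  proof
    assume eq: "transfer_operator F (measure M) = measure M"
    show "distr M torus_borel skew = M"
    proof (rule measure_eqI)
      fix E
      have "measure (distr M torus_borel skew) E = measure M E" using eq op[of E] by (simp add: fun_eq_iff)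
      then show "emeasure (distr M torus_borel skew) E = emeasure M E"
        by (simp add: emeasure_eq_measure D.emeasure_eq_measure)
    qed (simp add: sets)
  next
    assume "distr M torus_borel skew = M"
    then show "transfer_operator F (measure M) = measure M" using op by (simp add: fun_eq_iff)
  qed
qed

theorem unique_invariant_L1_probability:
  assumes F: "\<And>x y. y \<in> disc \<Longrightarrow> F (x, y) = (T x, G (x, y))"
  shows "\<exists>!\<mu>. prob_space \<mu> \<and> sets \<mu> = sets torus_borel \<and> measure \<mu> \<in> L1_space \<and>
    transfer_operator F (measure \<mu>) = measure \<mu>"
proof (rule ex1I[of _ solenoid_measure])
  show "prob_space solenoid_measure \<and> sets solenoid_measure = sets torus_borel \<and>
      measure solenoid_measure \<in> L1_space \<and>
      transfer_operator F (measure solenoid_measure) = measure solenoid_measure"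
    using prob_space_solenoid sets_solenoid solenoid_invariant
      L1_space_prob[OF prob_space_solenoid sets_solenoid solenoid_disintegration]
      transfer_operator_iff[OF prob_space_solenoid sets_solenoid F] by blast
next
  fix \<mu>
  assume "prob_space \<mu> \<and> sets \<mu> = sets torus_borel \<and> measure \<mu> \<in> L1_space \<and>
    transfer_operator F (measure \<mu>) = measure \<mu>"
  then have \<mu>: "prob_space \<mu>" "sets \<mu> = sets torus_borel" "measure \<mu> \<in> L1_space"
    and "transfer_operator F (measure \<mu>) = measure \<mu>" by auto
  then have inv: "distr \<mu> torus_borel skew = \<mu>" using transfer_operator_iff[OF \<mu>(1,2) F] by simp
  have "circle_marginal \<mu> = acim"
  proof (rule acim_unique)
    show "prob_space (circle_marginal \<mu>)"
      unfolding circle_marginal_def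
      by (rule prob_space.prob_space_distr[OF \<mu>(1) measurable_torus_borel[OF \<mu>(2) measurable_fst_borel]])
    show "absolutely_continuous m1 (circle_marginal \<mu>)" by (rule L1_space_absolutely_continuous[OF \<mu>])
    show "distr (circle_marginal \<mu>) borel T = circle_marginal \<mu>"
      by (rule circle_marginal_invariant[OF \<mu>(2) inv])
  qed (simp add: circle_marginal_def)
  then show "\<mu> = solenoid_measure"
    by (intro invariant_measure_unique[OF \<mu>(1,2) inv prob_space_solenoid sets_solenoid solenoid_invariant])
      (simp add: circle_marginal_solenoid)
qed

end

section \<open>Solenoidal maps\<close>

lemma C2_on_real_derivatives:
  fixes \<tau> :: "real \<Rightarrow> real"
  assumes "C2_on \<tau> UNIV"
  obtains D D2 where "\<And>t. (\<tau> has_real_derivative D t) (at t)" "\<And>t. (D has_real_derivative D2 t) (at t)"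
    "continuous_on UNIV D2"
proof -
  obtain f' :: "real \<Rightarrow> real \<Rightarrow>\<^sub>L real" and f'' :: "real \<Rightarrow> real \<Rightarrow>\<^sub>L (real \<Rightarrow>\<^sub>L real)" where
    f: "\<And>x. (\<tau> has_derivative blinfun_apply (f' x)) (at x)"
      "\<And>x. (f' has_derivative blinfun_apply (f'' x)) (at x)" "continuous_on UNIV f''"
    using assms by (auto simp: C2_on_def)
  define D where "D t = blinfun_apply (f' t) 1" for t
  define D2 where "D2 t = blinfun_apply (blinfun_apply (f'' t) 1) 1" for t
  show thesis
  proof
    show "(\<tau> has_real_derivative D t) (at t)" for t
    proof -
      have "blinfun_apply (f' t) x = D t * x" for x
        using blinfun.scaleR_right[of "f' t" x 1] by (simp add: D_def)
      then have "blinfun_apply (f' t) = (*) (D t)" by auto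
      then show ?thesis using f(1)[of t] by (simp add: has_field_derivative_def)
    qed
    show "(D has_real_derivative D2 t) (at t)" for t
    proof -
      have "((\<lambda>t. blinfun_apply (f' t) 1) has_derivative (\<lambda>x. blinfun_apply (blinfun_apply (f'' t) x) 1)) (at t)"
        by (rule bounded_linear.has_derivative[OF blinfun.bounded_linear_left f(2)])
      moreover have "blinfun_apply (blinfun_apply (f'' t) x) 1 = D2 t * x" for x
        using blinfun.scaleR_right[of "f'' t" x 1] by (simp add: D2_def blinfun.scaleR_left)
      ultimately show ?thesis by (simp add: has_field_derivative_def D_def[abs_def])
    qed
    show "continuous_on UNIV D2"
      unfolding D2_def by (intro continuous_intros f(3))
  qed
qed

lemma deriv_shift_periodic:
  fixes f :: "real \<Rightarrow> real"
  assumes D: "\<And>t. (f has_real_derivative D t) (at t)" and f: "\<And>t. f (t + 1) = f t + c"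
  shows "D (t + 1) = D t"
proof -
  have "((\<lambda>s. f (s + 1)) has_real_derivative D (t + 1)) (at t)"
    using D[of "t + 1"] by (rule DERIV_shift[THEN iffD1])
  moreover have "((\<lambda>s. f (s + 1)) has_real_derivative D t) (at t)"
    unfolding f by (auto intro!: derivative_eq_intros D)
  ultimately show ?thesis by (rule DERIV_unique)
qed

text \<open>
  The lift \<open>\<tau>\<close> has a derivative \<open>D\<close> of constant sign \<open>\<epsilon>\<close>. Periodicity and compactness turn
  the pointwise bound \<open>1 < \<bar>D t\<bar>\<close> into a uniform one, and bound the second derivative. So \<open>\<psi> = \<epsilon> \<tau>\<close> is an expanding bijection of
  the real line, and \<open>\<rho>\<close> is its inverse. Since \<open>\<bar>D\<bar>\<close> is Lipschitz and at least 1, its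
  logarithm is Lipschitz, which is the distortion bound for \<open>w = 1 / \<bar>D \<circ> \<rho>\<bar>\<close>.
\<close>

lemma expanding_circle_map_branches:
  assumes "expanding_circle_map q T"
  shows "\<exists>\<rho> w n \<theta> K \<epsilon>. expanding_branches T \<rho> w n \<theta> K \<epsilon>"
proof -
  obtain \<tau> where lift: "circle_lift T \<tau>" and C2: "C2_on \<tau> UNIV"
    and exp: "\<And>t. \<bar>deriv \<tau> t\<bar> > 1" and deg: "\<And>t. \<tau> (t + 1) = \<tau> t + of_int q"
    using assms by (auto simp: expanding_circle_map_def)
  obtain D D2 where D: "\<And>t. (\<tau> has_real_derivative D t) (at t)"
    and D2: "\<And>t. (D has_real_derivative D2 t) (at t)" and D2_cont: "continuous_on UNIV D2"
    using C2_on_real_derivatives[OF C2] by metis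
  have D_gt: "1 < \<bar>D t\<bar>" for t using exp[of t] DERIV_imp_deriv[OF D] by simp
  have D_per: "D (t + 1) = D t" for t by (rule deriv_shift_periodic[OF D deg])
  have D2_per: "D2 (t + 1) = D2 t" for t by (rule deriv_shift_periodic[OF D2, of 0]) (simp add: D_per)
  have D_cont: "continuous_on UNIV D"
    using D2 by (meson DERIV_isCont continuous_at_imp_continuous_on)
  have \<tau>_cont: "continuous_on UNIV \<tau>"
    using D by (meson DERIV_isCont continuous_at_imp_continuous_on)
  have frac_mem: "frac t \<in> {0..1}" for t :: real using frac_lt_1[of t] by (simp add: less_imp_le)

  obtain K where K: "0 < K" "\<And>t. \<bar>D2 t\<bar> \<le> K"
  proof -
    have "bounded (D2 ` {0..1})"
      by (intro compact_imp_bounded compact_continuous_image continuous_on_subset[OF D2_cont]) auto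
    then obtain K where K: "0 < K" "\<And>t. t \<in> {0..1} \<Longrightarrow> \<bar>D2 t\<bar> \<le> K"
      by (auto simp: bounded_pos)
    have "\<bar>D2 t\<bar> \<le> K" for t
      using K(2)[OF frac_mem[of t]] periodic_frac[of D2 t] D2_per by simp
    then show thesis using that K(1) by blast
  qed
  have D_lip: "\<bar>D s - D t\<bar> \<le> K * \<bar>s - t\<bar>" for s t
    using field_differentiable_bound[of UNIV D D2 K s t] D2 K by (simp add: has_field_derivative_at_within)

  obtain \<Lambda> where \<Lambda>: "1 < \<Lambda>" "\<And>t. \<Lambda> \<le> \<bar>D t\<bar>"
  proof -
    have "continuous_on {0..1} (\<lambda>t. \<bar>D t\<bar>)"
      by (intro continuous_intros continuous_on_subset[OF D_cont]) auto
    then obtain u where u: "u \<in> {0..1}" "\<And>t. t \<in> {0..1} \<Longrightarrow> \<bar>D u\<bar> \<le> \<bar>D t\<bar>"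
      using continuous_attains_inf[of "{0..1::real}" "\<lambda>t. \<bar>D t\<bar>"] by auto
    have "\<bar>D u\<bar> \<le> \<bar>D t\<bar>" for t
      using u(2)[OF frac_mem[of t]] periodic_frac[of D t] D_per by simp
    then show thesis using that D_gt by blast
  qed

  obtain \<epsilon> :: real where \<epsilon>: "\<epsilon> = 1 \<or> \<epsilon> = -1" "\<And>t. \<epsilon> * D t = \<bar>D t\<bar>"
  proof -
    have "(\<forall>t. 0 < D t) \<or> (\<forall>t. D t < 0)"
    proof (rule ccontr)
      assume "\<not> ?thesis"
      then obtain s t where "D s \<le> 0" "0 \<le> D t" by (auto simp: not_less)
      then have "0 \<in> D ` UNIV"
        using connected_continuous_image[OF D_cont connected_UNIV]
        by (auto simp: connected_iff_interval)
      then obtain u where "D u = 0" by auto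
      then show False using D_gt[of u] by simp
    qed
    then show thesis
    proof
      assume "\<forall>t. 0 < D t"
      then have "1 * D t = \<bar>D t\<bar>" for t by (simp add: abs_of_pos)
      then show thesis using that[of 1] by blast
    next
      assume "\<forall>t. D t < 0"
      then have "-1 * D t = \<bar>D t\<bar>" for t by (simp add: abs_of_neg)
      then show thesis using that[of "-1"] by blast
    qed
  qed
  define \<psi> where "\<psi> t = \<epsilon> * \<tau> t" for t
  have \<psi>_deriv: "(\<psi> has_real_derivative \<bar>D t\<bar>) (at t)" for t
    unfolding \<psi>_def \<epsilon>(2)[symmetric] by (auto intro!: derivative_eq_intros D)
  have \<psi>_expand: "t - s \<le> \<psi> t - \<psi> s" if "s \<le> t" for s t
  proof -
    have "\<psi> s - s \<le> \<psi> t - t"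
    proof (rule DERIV_nonneg_imp_nondecreasing[OF that])
      fix x
      have "((\<lambda>x. \<psi> x - x) has_real_derivative \<bar>D x\<bar> - 1) (at x)"
        by (auto intro!: derivative_eq_intros \<psi>_deriv)
      then show "\<exists>y. ((\<lambda>x. \<psi> x - x) has_real_derivative y) (at x) \<and> 0 \<le> y"
        using D_gt[of x] by (intro exI[of _ "\<bar>D x\<bar> - 1"]) simp
    qed
    then show ?thesis by simp
  qed
  have \<psi>_surj: "\<exists>t. \<psi> t = s" for s
  proof -
    define b where "b = \<bar>s\<bar> + \<bar>\<psi> 0\<bar>"
    have "b \<ge> 0" by (simp add: b_def)
    then have "\<psi> (- b) \<le> s" "s \<le> \<psi> b"
      using \<psi>_expand[of 0 b] \<psi>_expand[of "- b" 0] unfolding b_def by linarith+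
    moreover have "continuous_on {- b..b} \<psi>"
      unfolding \<psi>_def by (intro continuous_intros continuous_on_subset[OF \<tau>_cont]) auto
    ultimately show ?thesis using IVT'[of \<psi> "- b" s b] \<open>b \<ge> 0\<close> by auto
  qed
  define \<rho> where "\<rho> s = (SOME t. \<psi> t = s)" for s
  have \<psi>_\<rho>: "\<psi> (\<rho> s) = s" for s unfolding \<rho>_def using \<psi>_surj[of s] by (rule someI_ex)
  have \<psi>_dist: "\<bar>s - t\<bar> \<le> \<bar>\<psi> s - \<psi> t\<bar>" for s t
    using \<psi>_expand[of s t] \<psi>_expand[of t s] by linarith
  have \<rho>_\<psi>: "\<rho> (\<psi> t) = t" for t using \<psi>_dist[of "\<rho> (\<psi> t)" t] by (simp add: \<psi>_\<rho>)
  have \<rho>_lip: "\<bar>\<rho> s - \<rho> t\<bar> \<le> \<bar>s - t\<bar>" for s t using \<psi>_dist[of "\<rho> s" "\<rho> t"] by (simp add: \<psi>_\<rho>)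
  have \<rho>_cont: "isCont \<rho> s" for s
    unfolding continuous_at_eps_delta using \<rho>_lip by (auto simp: dist_real_def intro: le_less_trans)
  define w where "w s = inverse \<bar>D (\<rho> s)\<bar>" for s
  have D_pos: "0 < \<bar>D t\<bar>" for t using D_gt[of t] by linarith
  have "real_of_int q * \<epsilon> = \<psi> 1 - \<psi> 0" using deg[of 0] by (simp add: \<psi>_def algebra_simps)
  then have "1 \<le> real_of_int q * \<epsilon>" using \<psi>_expand[of 0 1] by simp
  define n where "n = nat \<bar>q\<bar>"
  have n: "real n = \<epsilon> * real_of_int q"
    using \<epsilon>(1) \<open>1 \<le> real_of_int q * \<epsilon>\<close> by (auto simp: n_def)
  have "expanding_branches T \<rho> w n (1 / \<Lambda>) K \<epsilon>"
  proof
    have "T = (\<lambda>x. circle_proj (\<tau> (circle_coord x)))"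
      using lift by (auto simp: circle_lift_def)
    moreover have "(\<lambda>x. circle_proj (\<tau> (circle_coord x))) \<in> borel_measurable borel"
      by (intro measurable_compose[OF measurable_circle_coord] measurable_compose[OF _ measurable_circle_proj]
        borel_measurable_continuous_onI \<tau>_cont)
    ultimately show "T \<in> borel_measurable borel" by (simp only:)
    show "(\<rho> has_real_derivative w s) (at s)" for s
      unfolding w_def
      by (rule DERIV_inverse_function[where f=\<psi> and a="s - 1" and b="s + 1"])
        (use \<psi>_deriv D_pos[of "\<rho> s"] \<psi>_\<rho> \<rho>_cont in auto)
    show "\<rho> (s + real n) = \<rho> s + 1" for s
    proof -
      have "\<psi> (\<rho> s + 1) = s + real n"
        using \<psi>_\<rho>[of s] by (simp add: \<psi>_def deg n distrib_left)
      then show ?thesis using \<rho>_\<psi>[of "\<rho> s + 1"] by simp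
    qed
    show "T (circle_proj (\<rho> s)) = circle_proj (\<epsilon> * s)" for s
    proof -
      have "\<tau> (\<rho> s) = \<epsilon> * s" using \<psi>_\<rho>[of s] \<epsilon>(1) by (auto simp: \<psi>_def)
      then show ?thesis using lift by (simp add: circle_lift_def flip: \<open>\<tau> (\<rho> s) = \<epsilon> * s\<close>)
    qed
    show "0 < w s" for s using D_pos by (simp add: w_def)
    show "w s \<le> 1 / \<Lambda>" for s
      using \<Lambda>(1) \<Lambda>(2)[of "\<rho> s"] by (simp add: w_def divide_inverse le_imp_inverse_le)
    show "1 / \<Lambda> < 1" using \<Lambda>(1) by simp
    show "w s \<le> w t * exp (K * \<bar>s - t\<bar>)" for s t
    proof -
      have "\<bar>D (\<rho> t)\<bar> \<le> \<bar>D (\<rho> s)\<bar> + \<bar>D (\<rho> t) - D (\<rho> s)\<bar>" by linarith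
      also have "\<dots> \<le> \<bar>D (\<rho> s)\<bar> + K * \<bar>\<rho> t - \<rho> s\<bar>" using D_lip by simp
      also have "\<dots> \<le> \<bar>D (\<rho> s)\<bar> + K * \<bar>s - t\<bar>"
        using K(1) \<rho>_lip[of t s] by (simp add: abs_minus_commute)
      also have "\<dots> \<le> \<bar>D (\<rho> s)\<bar> + \<bar>D (\<rho> s)\<bar> * (K * \<bar>s - t\<bar>)"
        using K(1) D_gt[of "\<rho> s"] mult_right_mono[of 1 "\<bar>D (\<rho> s)\<bar>" "K * \<bar>s - t\<bar>"] by simp
      also have "\<dots> = \<bar>D (\<rho> s)\<bar> * (1 + K * \<bar>s - t\<bar>)" by (simp add: algebra_simps)
      also have "\<dots> \<le> \<bar>D (\<rho> s)\<bar> * exp (K * \<bar>s - t\<bar>)"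
        by (intro mult_left_mono exp_ge_add_one_self) auto
      finally show ?thesis
        using D_pos[of "\<rho> s"] D_pos[of "\<rho> t"] by (simp add: w_def field_simps)
    qed
    show "0 < K" by (rule K(1))
    show "\<epsilon> = 1 \<or> \<epsilon> = -1" by (rule \<epsilon>(1))
  qed
  then show ?thesis by blast
qed

text \<open>
  The coordinate of the circle jumps but is Borel, and in the coordinate the fibre map is continuous
  on a closed set.
\<close>

lemma fibre_map_measurable:
  fixes G :: "circle \<times> (real ^ 2) \<Rightarrow> real ^ 2"
  assumes "(\<lambda>(t, y). G (circle_proj t, y)) differentiable_on (UNIV \<times> disc)"
  shows "(\<lambda>p. if snd p \<in> disc then G p else 0) \<in> borel_measurable borel"
proof -
  define k where "k z = (if z \<in> UNIV \<times> disc then G (circle_proj (fst z), snd z) else 0)" for z :: "real \<times> (real ^ 2)"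
  have cont: "continuous_on (UNIV \<times> disc) (\<lambda>z. G (circle_proj (fst z), snd z))"
    using differentiable_imp_continuous_on[OF assms] by (simp add: case_prod_beta)
  have "(UNIV \<times> disc :: (real \<times> (real ^ 2)) set) \<in> sets borel"
    by (intro borel_closed closed_Times) auto
  then have "k \<in> borel_measurable borel"
    unfolding k_def using cont by (rule borel_measurable_continuous_on_if) (rule continuous_on_const)
  moreover have "(\<lambda>p. (circle_coord (fst p), snd p)) \<in> measurable borel (borel :: (real \<times> (real ^ 2)) measure)"
    by (intro borel_measurable_Pair measurable_snd_borel
      measurable_compose[OF measurable_fst_borel measurable_circle_coord])
  ultimately have "(\<lambda>p. k (circle_coord (fst p), snd p)) \<in> borel_measurable borel"
    by (rule measurable_compose[rotated])
  moreover have "k (circle_coord (fst p), snd p) = (if snd p \<in> disc then G p else 0)" for p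
    by (simp add: k_def)
  ultimately show ?thesis by simp
qed

theorem proposition100:
  fixes q :: int and F :: "circle \<times> (real ^ 2) \<Rightarrow> circle \<times> (real ^ 2)"
  assumes "solenoidal_map q F"
  shows "\<exists>!\<mu> :: (circle \<times> (real ^ 2)) measure.
    prob_space \<mu> \<and> sets \<mu> = sets torus_borel \<and> measure \<mu> \<in> L1_space \<and>
    transfer_operator F (measure \<mu>) = measure \<mu>"
proof -
  obtain T G \<alpha> where F_self: "C2_self_map F" and F: "\<And>x y. y \<in> disc \<Longrightarrow> F (x, y) = (T x, G (x, y))"
    and T: "expanding_circle_map q T"
    and G: "(\<lambda>(t, y). G (circle_proj t, y)) differentiable_on (UNIV \<times> disc)"
    and \<alpha>: "0 < \<alpha>" "\<alpha> < 1" "\<And>x y1 y2. y1 \<in> disc \<Longrightarrow> y2 \<in> disc \<Longrightarrow>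
      norm (G (x, y1) - G (x, y2)) \<le> \<alpha> * norm (y1 - y2)"
    using assms unfolding solenoidal_map_def by metis
  obtain \<rho> w n \<theta> K \<epsilon> where "expanding_branches T \<rho> w n \<theta> K \<epsilon>"
    using expanding_circle_map_branches[OF T] by blast
  then interpret expanding_branches T \<rho> w n \<theta> K \<epsilon> .
  interpret contracting_skew_product T \<rho> w n \<theta> K \<epsilon> G \<alpha>
  proof
    show "(\<lambda>p. if snd p \<in> disc then G p else 0) \<in> borel_measurable borel"
      by (rule fibre_map_measurable[OF G])
    show "G (x, y) \<in> disc" if y: "y \<in> disc" for x y
    proof -
      have "F (x, y) \<in> solid_torus" using F_self y by (auto simp: C2_self_map_def)
      then show ?thesis using F[OF y] by simp
    qed
  qed (use \<alpha> in auto)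
  show ?thesis by (rule unique_invariant_L1_probability[OF F])
qed

end
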